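(* Assume $d\ge 3$ and $\mathbb{E}[V(0)]=+\infty$. Let $\varepsilon>0$. There exists $C>0$ such that for any $\beta>0$ small enough and any $n\in\mathbb{N}$, $$e_{\beta,n}\le C\exp\left(-(1-\varepsilon)\sqrt{2d\,\mathfrak{I}_\beta}\;n\right),$$ where $$\mathfrak{I}_\beta=q_d\int\frac{1-e^{-\beta z}}{1-(1-q_d)e^{-\beta z}}\,\mathrm{d}\mu(z)$$ and $q_d=\mathbf{P}_0[\forall n\ge 1,\ S_n\neq 0]$ is the probability that the simple random walk on $\mathbb{Z}^d$ never returns to its starting point.
   Context: $(S_k)_{k\in\mathbb{N}}$ is the simple random walk on $\mathbb{Z}^d$, with law $\mathbf{P}_x$ and expectation $\mathbf{E}_x$ when started at $x$. Independently of $S$, $(V(x))_{x\in\mathbb{Z}^d}$ are i.i.d. random variables with common law $\mu$ on $[0,+\infty)$; $\mathbb{P}=\mu^{\otimes\mathbb{Z}^d}$ is their joint law and $\mathbb{E}$ the associated expectation. $\ell\in\mathbb{R}^d$ is a fixed vector of unit Euclidean norm, $T_n(\ell)=\inf\{k: S_k\cdot\ell\ge n\}$, and $$e_{\beta,n}=\mathbb{E}\mathbf{E}_0\left[\exp\left(-\sum_{k=0}^{T_n(\ell)-1}\beta V(S_k)\right)\right].$$ *)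

theory Defs
  imports "HOL-Probability.Probability"
begin

definition step_pmf :: "(int ^ 'd::finite) pmf" where
  "step_pmf = pmf_of_set (range (\<lambda>i. axis i 1) \<union> range (\<lambda>i. axis i (- 1)))"

text \<open>The law \<open>P_x\<close> of the simple random walk, as a measure on the space of trajectories.\<close>

definition srw :: "int ^ 'd::finite \<Rightarrow> (nat \<Rightarrow> int ^ 'd) measure" where
  "srw x = distr (PiM UNIV (\<lambda>_. measure_pmf step_pmf)) (PiM UNIV (\<lambda>_. count_space UNIV))
     (\<lambda>\<xi> k. x + (\<Sum>i<k. \<xi> i))"

definition potential :: "real measure \<Rightarrow> (int ^ 'd::finite \<Rightarrow> real) measure" where
  "potential \<mu> = PiM UNIV (\<lambda>_. \<mu>)"

definition of_int_vec :: "int ^ 'd \<Rightarrow> real ^ 'd" where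
  "of_int_vec x = (\<chi> i. of_int (x $ i))"

text \<open>The infimum is taken in \<open>enat\<close>, so the hitting time is \<open>\<infinity>\<close> if the half-space
  is never reached.\<close>

definition hit_time :: "real ^ 'd::finite \<Rightarrow> nat \<Rightarrow> (nat \<Rightarrow> int ^ 'd) \<Rightarrow> enat" where
  "hit_time l n S = (INF k \<in> {k. of_int_vec (S k) \<bullet> l \<ge> real n}. enat k)"

definition exp_neg :: "ennreal \<Rightarrow> real" where
  "exp_neg t = (if t = \<infinity> then 0 else exp (- enn2real t))"

text \<open>The sum is formed in \<open>[0,\<infinity>]\<close>, since it may diverge when the hitting time is infinite.
  The coercion \<open>ennreal\<close> truncates negative numbers to \<open>0\<close>, which is harmless for a law \<open>\<mu>\<close>
  carried by \<open>[0,\<infinity>)\<close>.\<close>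

definition path_cost ::
    "real \<Rightarrow> real ^ 'd::finite \<Rightarrow> nat \<Rightarrow> (int ^ 'd \<Rightarrow> real) \<Rightarrow> (nat \<Rightarrow> int ^ 'd) \<Rightarrow> ennreal" where
  "path_cost \<beta> l n V S =
     (\<Sum>k. if enat k < hit_time l n S then ennreal (\<beta> * V (S k)) else 0)"

definition e_crossing :: "real measure \<Rightarrow> real ^ 'd::finite \<Rightarrow> real \<Rightarrow> nat \<Rightarrow> real" where
  "e_crossing \<mu> l \<beta> n = (\<integral>V. (\<integral>S. exp_neg (path_cost \<beta> l n V S) \<partial>srw 0) \<partial>potential \<mu>)"

definition escape_prob :: "'d::finite itself \<Rightarrow> real" where
  "escape_prob _ = \<P>(S in srw (0 :: int ^ 'd). \<forall>n\<ge>1. S n \<noteq> 0)"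

definition I_const :: "'d::finite itself \<Rightarrow> real measure \<Rightarrow> real \<Rightarrow> real" where
  "I_const d \<mu> \<beta> = escape_prob d *
     (\<integral>z. (1 - exp (- \<beta> * z)) / (1 - (1 - escape_prob d) * exp (- \<beta> * z)) \<partial>\<mu>)"

text \<open>The measures above are probability measures and the integrand of \<open>e_crossing\<close>, which takes
  values in \<open>[0,1]\<close>, is jointly measurable. So neither of its integrals falls back on a default
  value.\<close>

lemma measurable_walk:
  "(\<lambda>\<xi> k::nat. x + (\<Sum>i<k. \<xi> i)) \<in> PiM UNIV (\<lambda>_. measure_pmf p) \<rightarrow>\<^sub>M PiM UNIV (\<lambda>_. count_space UNIV)"
  for x :: "int ^ 'd::finite"
proof -
  let ?M = "PiM UNIV (\<lambda>_::nat. measure_pmf p)"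
  have step: "(\<lambda>\<xi>. \<xi> i) \<in> ?M \<rightarrow>\<^sub>M count_space UNIV" for i
    using measurable_component_singleton[of i UNIV "\<lambda>_. measure_pmf p"]
    by (simp cong: measurable_cong_sets)
  have "(\<lambda>\<xi>. x + (\<Sum>i<k. \<xi> i)) \<in> ?M \<rightarrow>\<^sub>M count_space UNIV" for k
  proof (induction k)
    case (Suc k)
    have "(\<lambda>\<xi>. (x + (\<Sum>i<k. \<xi> i)) + \<xi> k) \<in> ?M \<rightarrow>\<^sub>M count_space UNIV"
      by (rule measurable_compose_countable[where f = "\<lambda>a \<xi>. a + \<xi> k", OF _ Suc])
        (rule measurable_compose[OF step], simp)
    then show ?case by (simp add: add.assoc)
  qed simp
  from this show ?thesis by (rule measurable_PiM_single') simp
qed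

lemma prob_space_srw: "prob_space (srw x)"
proof -
  interpret P: product_prob_space "\<lambda>_::nat. measure_pmf (step_pmf :: (int ^ 'd::finite) pmf)" UNIV
    by unfold_locales
  show ?thesis unfolding srw_def
    by (rule P.prob_space_distr) (rule measurable_walk)
qed

lemma prob_space_potential: "prob_space \<mu> \<Longrightarrow> prob_space (potential \<mu>)"
  unfolding potential_def by (rule prob_space_PiM)

lemma less_hit_time_iff:
  "enat k < hit_time l n S \<longleftrightarrow> (\<forall>j\<le>k. of_int_vec (S j) \<bullet> l < real n)"
proof -
  have "hit_time l n S \<le> enat k \<longleftrightarrow> (\<exists>j\<le>k. of_int_vec (S j) \<bullet> l \<ge> real n)"
  proof
    assume h: "hit_time l n S \<le> enat k"
    let ?A = "{k. of_int_vec (S k) \<bullet> l \<ge> real n}"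
    have "?A \<noteq> {}"
    proof
      assume "?A = {}"
      then have "hit_time l n S = \<infinity>" unfolding hit_time_def by (simp only:) (simp add: top_enat_def)
      with h show False by simp
    qed
    then obtain m where "enat m \<in> enat ` ?A" by blast
    then have "hit_time l n S \<in> enat ` ?A" unfolding hit_time_def by (rule wellorder_InfI)
    with h show "\<exists>j\<le>k. of_int_vec (S j) \<bullet> l \<ge> real n" by auto
  next
    assume "\<exists>j\<le>k. of_int_vec (S j) \<bullet> l \<ge> real n"
    then obtain j where "j \<le> k" "of_int_vec (S j) \<bullet> l \<ge> real n" by blast
    then show "hit_time l n S \<le> enat k" unfolding hit_time_def
      by (intro INF_lower2[of j]) auto
  qed
  then show ?thesis by (auto simp flip: not_le)
qed

lemma measurable_exp_neg [measurable]: "exp_neg \<in> borel_measurable borel"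
  unfolding exp_neg_def[abs_def] by measurable

lemma sets_srw [measurable_cong]:
  "sets (srw (x :: int ^ 'd::finite)) = sets (PiM UNIV (\<lambda>_. count_space UNIV))"
  by (simp add: srw_def)

lemma measurable_crossing_weight:
  assumes "sets \<mu> = sets borel"
  shows "(\<lambda>(V, S). exp_neg (path_cost \<beta> l n V S)) \<in> borel_measurable (potential \<mu> \<Otimes>\<^sub>M srw x)"
proof -
  have sV [measurable_cong]: "sets (potential \<mu> :: (int ^ 'd \<Rightarrow> real) measure) = sets (PiM UNIV (\<lambda>_. borel))"
    unfolding potential_def by (rule sets_PiM_cong) (auto simp: assms)
  have [measurable]: "(\<lambda>p. snd p k) \<in> potential \<mu> \<Otimes>\<^sub>M srw x \<rightarrow>\<^sub>M count_space UNIV" for k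
    by measurable
  have [measurable]: "(\<lambda>p. fst p (snd p k)) \<in> borel_measurable (potential \<mu> \<Otimes>\<^sub>M srw x)" for k
    by (rule measurable_compose_countable[where f = "\<lambda>z p. fst p z" and g = "\<lambda>p. snd p k"]) measurable
  have [measurable]: "Measurable.pred (potential \<mu> \<Otimes>\<^sub>M srw x) (\<lambda>p. of_int_vec (snd p j) \<bullet> l < real n)" for j
    by (rule measurable_compose[of "\<lambda>p. snd p j" _ "count_space UNIV" "\<lambda>z. of_int_vec z \<bullet> l < real n"]) auto
  show ?thesis
    unfolding path_cost_def less_hit_time_iff split_beta' by measurable
qed

end

theory Submission
  imports Defs
begin

text \<open>
  Averaging over the potential first, a site that is visited \<open>k\<close> times by the walk contributes the
  factor \<open>\<integral> exp (- \<beta> k z) \<partial>\<mu> = 1 - \<psi> k \<le> exp (- \<psi> k)\<close>. So \<open>e_crossing\<close> is at most the expectation of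
  \<open>exp (- \<Sum> \<psi> (local time))\<close>, the sum ranging over visited sites: a walk that is killed with a small
  probability at each site, with fewer killings at sites that are visited again. In time \<open>t\<close> a
  transient walk meets about \<open>q t\<close> new sites, each of which receives a geometric number of visits
  with parameter \<open>q\<close>, where \<open>q\<close> is the escape probability; the mean of \<open>\<psi>\<close> under this geometric law,
  times \<open>q\<close>, is exactly \<open>I = I_const\<close>. So the walk is killed at rate \<open>I\<close> per unit time, and Brownian
  motion with variance \<open>1 / d\<close> in direction \<open>l\<close> and killing rate \<open>I\<close> crosses a distance \<open>n\<close> with
  probability about \<open>exp (- sqrt (2 d I) n)\<close>.

  Three ideas turn this into a proof of the upper bound.

  The crossing is cut into stages, at the successive times when the walk has gained \<open>g = h / sqrt I\<close>
  in direction \<open>l\<close> since the end of the last stage, with a large constant \<open>h\<close>. In each stage only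
  the sites at or above its starting level are charged. The walk has never seen these sites when the
  stage starts, so the stages decouple by the strong Markov property (\<open>cost_split\<close>,
  \<open>weight_recursion\<close>), and a bound \<open>A\<close> for one stage gives \<open>A ^ k\<close> for \<open>k\<close> stages
  (\<open>weight_iterate\<close>).

  One stage lasts a time of order \<open>1 / I\<close>. The cost of a stage is bounded below by a sum over times
  of a local cost, a function of a window of \<open>2 m\<close> steps: the time in the middle of the window is
  charged \<open>\<psi>\<close> of the number of visits to its site in the rest of the window, if this site is not
  visited earlier in the window (\<open>window_cost\<close>). The mean of the local cost is nearly \<open>I\<close>
  (\<open>mean_window_cost\<close>, \<open>truncated_killing_rate\<close>). Sites that were visited long before the window
  must be discarded, but by transience they are rare if \<open>m\<close> is large (\<open>return_tail\<close>). As windows at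
  distance at least \<open>2 m\<close> are independent, the variance of the sum is of order \<open>I\<close>. So the cost is
  nearly \<open>I\<close> times the occupation time of the slab (\<open>weight_stage_le\<close>).

  It remains to bound the exponential moment of the occupation time of a slab before its upper end
  is reached. The function that is constant below the slab and a hyperbolic cosine inside it is
  superharmonic for the walk that is killed at a constant rate inside the slab, which gives
  \<open>1 / cosh (sqrt (2 d I) g)\<close> up to errors (\<open>discounted_hitting\<close>). Since \<open>h\<close> is large, the factor
  \<open>2 exp 2\<close> that is lost in each stage is absorbed by \<open>\<epsilon>\<close>, and the remaining errors vanish as \<open>\<beta>\<close>
  tends to \<open>0\<close> (\<open>stage_bound\<close>).
\<close>

section \<open>Expectations over finitely many steps\<close>

locale finite_walk =
  fixes p :: "'a::ab_group_add pmf"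
  assumes finite_steps: "finite (set_pmf p)"
begin

text \<open>
  Every estimate below concerns finitely many steps with finitely many values. Expectations over
  lists of steps are finite sums, so that no question of integrability or measurability arises.
\<close>

definition mean :: "nat \<Rightarrow> ('a list \<Rightarrow> real) \<Rightarrow> real" where
  "mean N f = measure_pmf.expectation (replicate_pmf N p) f"

definition steps :: "nat \<Rightarrow> 'a list set" where
  "steps N = {xs. set xs \<subseteq> set_pmf p \<and> length xs = N}"

lemma set_replicate_steps: "set_pmf (replicate_pmf N p) = steps N"
  by (auto simp: set_replicate_pmf steps_def lists_eq_set)

lemma finite_paths: "finite (set_pmf (replicate_pmf N p))"
  unfolding set_replicate_steps steps_def using finite_lists_length_eq[OF finite_steps] by simp

lemma integrable_path [simp]: "integrable (measure_pmf (replicate_pmf N p)) (f :: _ \<Rightarrow> real)"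
  by (rule integrable_measure_pmf_finite[OF finite_paths])

lemma integrable_step [simp]: "integrable (measure_pmf p) (f :: _ \<Rightarrow> real)"
  by (rule integrable_measure_pmf_finite[OF finite_steps])

lemma mean_mono:
  assumes "\<And>xs. xs \<in> steps N \<Longrightarrow> f xs \<le> g xs"
  shows "mean N f \<le> mean N g"
  unfolding mean_def using assms
  by (intro integral_mono_AE) (auto simp: AE_measure_pmf_iff set_replicate_steps)

lemma mean_cong:
  assumes "\<And>xs. xs \<in> steps N \<Longrightarrow> f xs = g xs"
  shows "mean N f = mean N g"
  using assms by (intro antisym mean_mono) auto

lemma mean_const [simp]: "mean N (\<lambda>_. c) = c"
  by (simp add: mean_def)

lemma mean_cmult: "mean N (\<lambda>xs. c * f xs) = c * mean N f"
  by (simp add: mean_def)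

lemma mean_multc: "mean N (\<lambda>xs. f xs * c) = mean N f * c"
  by (simp add: mean_def)

lemma mean_add: "mean N (\<lambda>xs. f xs + g xs) = mean N f + mean N g"
  by (simp add: mean_def)

lemma mean_diff: "mean N (\<lambda>xs. f xs - g xs) = mean N f - mean N g"
  by (simp add: mean_def)

lemma mean_sum: "mean N (\<lambda>xs. \<Sum>i\<in>A. f i xs) = (\<Sum>i\<in>A. mean N (f i))"
  by (simp add: mean_def)

lemma mean_nonneg: "(\<And>xs. xs \<in> steps N \<Longrightarrow> 0 \<le> f xs) \<Longrightarrow> 0 \<le> mean N f"
  using mean_mono[of N "\<lambda>_. 0" f] by simp

lemma mean_le_const: "(\<And>xs. xs \<in> steps N \<Longrightarrow> f xs \<le> c) \<Longrightarrow> mean N f \<le> c"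
  using mean_mono[of N f "\<lambda>_. c"] by simp

lemma mean_0 [simp]: "mean 0 f = f []"
  by (simp add: mean_def)

lemma mean_eq_sum: "mean N f = (\<Sum>xs\<in>steps N. pmf (replicate_pmf N p) xs * f xs)"
  unfolding mean_def by (subst integral_measure_pmf[OF finite_paths[of N]])
    (auto simp: set_replicate_steps[symmetric])

lemma mean_swap: "mean M (\<lambda>xs. mean N (\<lambda>ys. f xs ys)) = mean N (\<lambda>ys. mean M (\<lambda>xs. f xs ys))"
  unfolding mean_eq_sum[of N] by (simp add: mean_sum mean_cmult)

lemma mean_append: "mean (M + N) f = mean M (\<lambda>xs. mean N (\<lambda>ys. f (xs @ ys)))"
proof -
  have *: "replicate_pmf (M + N) p = replicate_pmf M p \<bind> (\<lambda>xs. map_pmf ((@) xs) (replicate_pmf N p))"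
    unfolding replicate_pmf_distrib by (simp add: map_pmf_def)
  have "mean (M + N) f = (\<Sum>xs\<in>steps M. pmf (replicate_pmf M p) xs * mean N (\<lambda>ys. f (xs @ ys)))"
    unfolding mean_def * set_replicate_steps[symmetric]
    by (subst pmf_expectation_bind[OF finite_paths[of M] _ order_refl]) (auto simp: finite_paths)
  then show ?thesis unfolding mean_eq_sum[of M] .
qed

lemma mean_1: "mean (Suc 0) f = measure_pmf.expectation p (\<lambda>x. f [x])"
  unfolding mean_def using replicate_pmf_1[of p] by simp

lemma mean_Suc: "mean (Suc N) f = measure_pmf.expectation p (\<lambda>x. mean N (\<lambda>xs. f (x # xs)))"
  using mean_append[of 1 N f] by (simp add: mean_1)

text \<open>
  The Markov property, in the form in which it is used throughout: disjoint blocks of steps are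
  independent.
\<close>

lemma mean_take_drop:
  assumes "i + M \<le> N"
  shows "mean N (\<lambda>xs. g (take i xs) * h (take M (drop i xs))) = mean i g * mean M h"
proof -
  obtain L where N: "N = i + (M + L)" using assms by (metis add.assoc le_Suc_ex)
  have "mean N (\<lambda>xs. g (take i xs) * h (take M (drop i xs))) =
        mean i (\<lambda>us. mean M (\<lambda>vs. mean L (\<lambda>ws. g us * h vs)))"
    unfolding N mean_append by (intro mean_cong) (auto simp: steps_def)
  then show ?thesis by (simp add: mean_cmult mean_multc)
qed

lemma mean_take: "M \<le> N \<Longrightarrow> mean N (\<lambda>xs. g (take M xs)) = mean M g"
  using mean_take_drop[of M 0 N g "\<lambda>_. 1"] by simp

text \<open>
  Independent steps with the same law can be read backwards. This turns the event that a site is new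
  into the event that the walk does not return.
\<close>

lemma mean_rev: "mean N (\<lambda>xs. f (rev xs)) = mean N f"
proof (induction N arbitrary: f)
  case (Suc N)
  have "mean (Suc N) (\<lambda>xs. f (rev xs)) = mean (Suc 0) (\<lambda>xs. mean N (\<lambda>ys. f (rev ys @ xs)))"
    unfolding mean_Suc mean_1 by simp
  also have "\<dots> = mean (Suc 0) (\<lambda>xs. mean N (\<lambda>ys. f (ys @ xs)))"
    using Suc.IH[of "\<lambda>ys. f (ys @ _)"] by simp
  also have "\<dots> = mean N (\<lambda>ys. mean (Suc 0) (\<lambda>xs. f (ys @ xs)))"
    by (rule mean_swap)
  also have "\<dots> = mean (N + Suc 0) f" by (rule mean_append[symmetric])
  finally show ?case by simp
qed simp

end

section \<open>Returns to the starting point\<close>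

definition pos :: "'a::ab_group_add list \<Rightarrow> nat \<Rightarrow> 'a" where
  "pos xs k = sum_list (take k xs)"

lemma pos_0 [simp]: "pos xs 0 = 0"
  by (simp add: pos_def)

lemma pos_take: "k \<le> M \<Longrightarrow> pos (take M xs) k = pos xs k"
  by (simp add: pos_def min_absorb2)

lemma pos_add: "pos xs (M + k) = pos xs M + pos (drop M xs) k"
  by (simp add: pos_def take_add)

lemma pos_Cons: "pos (x # xs) (Suc k) = x + pos xs k"
  by (simp add: pos_def)

lemma sum_list_drop: "sum_list (drop k xs) = sum_list xs - (sum_list (take k xs) :: 'a::ab_group_add)"
proof -
  have "sum_list xs = sum_list (take k xs) + sum_list (drop k xs)"
    by (subst append_take_drop_id[of k xs, symmetric], subst sum_list_append) simp
  then show ?thesis by simp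
qed

definition avoids_start :: "'a::ab_group_add list \<Rightarrow> bool" where
  "avoids_start xs \<longleftrightarrow> (\<forall>k\<in>{1..length xs}. pos xs k \<noteq> 0)"

definition first_return :: "'a::ab_group_add list \<Rightarrow> bool" where
  "first_return xs \<longleftrightarrow> xs \<noteq> [] \<and> pos xs (length xs) = 0 \<and> (\<forall>k\<in>{1..<length xs}. pos xs k \<noteq> 0)"

definition visits :: "'a::ab_group_add list \<Rightarrow> nat" where
  "visits xs = card {t. t \<le> length xs \<and> pos xs t = 0}"

lemma sum_of_bool_le_1:
  assumes "finite A" "\<And>i j. i \<in> A \<Longrightarrow> j \<in> A \<Longrightarrow> P i \<Longrightarrow> P j \<Longrightarrow> i = j"
  shows "(\<Sum>i\<in>A. of_bool (P i) :: real) \<le> of_bool (\<exists>i\<in>A. P i)"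
proof (cases "\<exists>i\<in>A. P i")
  case True
  then obtain i where i: "i \<in> A" "P i" by blast
  have "(\<Sum>j\<in>A. of_bool (P j) :: real) = (\<Sum>j\<in>{i}. of_bool (P j))"
    using assms i by (intro sum.mono_neutral_right) auto
  then show ?thesis using i by auto
qed (auto intro: sum_nonpos)

lemma avoids_start_take: "avoids_start xs \<Longrightarrow> avoids_start (take M xs)"
  by (auto simp: avoids_start_def pos_take)

lemma not_avoids_start_iff:
  "\<not> avoids_start xs \<longleftrightarrow> (\<exists>u\<in>{1..length xs}. first_return (take u xs))"
proof
  assume "\<not> avoids_start xs"
  then have ex: "\<exists>u. 1 \<le> u \<and> u \<le> length xs \<and> pos xs u = 0" by (auto simp: avoids_start_def)
  define u where "u = (LEAST u. 1 \<le> u \<and> u \<le> length xs \<and> pos xs u = 0)"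
  have u: "1 \<le> u" "u \<le> length xs" "pos xs u = 0"
    using LeastI_ex[OF ex] by (auto simp: u_def)
  have "pos xs k \<noteq> 0" if "1 \<le> k" "k < u" for k
    using not_less_Least[of k "\<lambda>u. 1 \<le> u \<and> u \<le> length xs \<and> pos xs u = 0"] that u by (auto simp: u_def)
  with u have "first_return (take u xs)"
    by (auto simp: first_return_def pos_take)
  with u show "\<exists>u\<in>{1..length xs}. first_return (take u xs)" by auto
qed (force simp: avoids_start_def first_return_def pos_take)

lemma first_return_unique:
  assumes "first_return (take u xs)" "first_return (take v xs)" "u \<le> length xs" "v \<le> length xs"
  shows "u = v"
proof -
  have False if "first_return (take u xs)" "first_return (take v xs)" "u < v" "v \<le> length xs" for u v
    using that by (auto simp: first_return_def pos_take dest: bspec[of _ _ u])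
  from this[of u v] this[of v u] assms show ?thesis by (cases u v rule: linorder_cases) auto
qed

lemma visits_pos: "visits xs > 0"
proof -
  have "0 \<in> {t. t \<le> length xs \<and> pos xs t = 0}" by simp
  then show ?thesis unfolding visits_def by (subst card_gt_0_iff) (auto simp del: mem_Collect_eq)
qed

lemma visits_after_return:
  assumes "pos xs u = 0" "u > 0" "u + M \<le> length xs"
  shows "Suc (visits (take M (drop u xs))) \<le> visits xs"
proof -
  let ?A = "{t. t \<le> length (take M (drop u xs)) \<and> pos (take M (drop u xs)) t = 0}"
  let ?B = "{t. t \<le> length xs \<and> pos xs t = 0}"
  have fin: "finite ?A" by simp
  \<comment> \<open>The visits after the return, and the start itself.\<close>
  have "insert 0 ((+) u ` ?A) \<subseteq> ?B"
    using assms by (auto simp: pos_take pos_add)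
  then have "card (insert 0 ((+) u ` ?A)) \<le> card ?B"
    by (intro card_mono) auto
  moreover have "card (insert 0 ((+) u ` ?A)) = Suc (card ?A)"
    using assms fin by (subst card_insert_disjoint) (auto simp: card_image)
  ultimately show ?thesis unfolding visits_def by simp
qed

context finite_walk
begin

definition escape_upto :: "nat \<Rightarrow> real" where
  "escape_upto m = mean m (\<lambda>xs. of_bool (avoids_start xs))"

text \<open>
  The probability that the walk never returns, as the limit of the probabilities that it does not
  return within \<open>m\<close> steps.
\<close>

definition escape :: real where
  "escape = (INF m. escape_upto m)"

definition return_at :: "nat \<Rightarrow> real" where
  "return_at m = mean m (\<lambda>xs. of_bool (sum_list xs = 0))"

lemma escape_upto_bounds: "0 \<le> escape_upto m" "escape_upto m \<le> 1"
  unfolding escape_upto_def by (auto intro!: mean_nonneg mean_le_const)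

lemma return_at_nonneg: "0 \<le> return_at m"
  unfolding return_at_def by (auto intro!: mean_nonneg)

lemma decseq_escape_upto: "decseq escape_upto"
  unfolding decseq_def
proof (intro allI impI)
  fix m n :: nat assume "m \<le> n"
  have "escape_upto n \<le> mean n (\<lambda>xs. of_bool (avoids_start (take m xs)))"
    unfolding escape_upto_def by (intro mean_mono) (auto simp: avoids_start_take)
  also have "\<dots> = escape_upto m" unfolding escape_upto_def using \<open>m \<le> n\<close> by (rule mean_take)
  finally show "escape_upto n \<le> escape_upto m" .
qed

lemma bdd_escape_upto: "bdd_below (range escape_upto)"
  by (auto simp: bdd_below_def intro!: exI[of _ 0] escape_upto_bounds)

lemma tendsto_escape: "escape_upto \<longlonglongrightarrow> escape"
  unfolding escape_def by (rule LIMSEQ_decseq_INF[OF bdd_escape_upto decseq_escape_upto])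

lemma escape_le: "escape \<le> escape_upto m"
  unfolding escape_def by (rule cINF_lower[OF bdd_escape_upto]) simp

lemma escape_bounds: "0 \<le> escape" "escape \<le> 1"
  using escape_le[of 0] escape_upto_bounds[of 0]
  by (auto simp: escape_def intro!: cINF_greatest escape_upto_bounds)

text \<open>
  The last visit to the starting point within \<open>N\<close> steps takes place at exactly one time, and given a
  visit at time \<open>i\<close> it is the last one with probability \<open>escape_upto (N - i)\<close>.
\<close>

lemma sum_return_at: "escape * (\<Sum>i\<le>N. return_at i) \<le> 1"
proof -
  have "escape * (\<Sum>i\<le>N. return_at i) \<le> (\<Sum>i\<le>N. return_at i * escape_upto (N - i))"
    unfolding sum_distrib_left
    by (intro sum_mono) (auto simp: mult.commute[of escape] intro!: mult_left_mono return_at_nonneg escape_le)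
  also have "\<dots> = (\<Sum>i\<le>N. mean N (\<lambda>xs. of_bool (sum_list (take i xs) = 0) *
                          of_bool (avoids_start (take (N - i) (drop i xs)))))"
    by (intro sum.cong refl, subst mean_take_drop) (auto simp: return_at_def escape_upto_def)
  also have "\<dots> = mean N (\<lambda>xs. \<Sum>i\<le>N. of_bool (pos xs i = 0 \<and> avoids_start (drop i xs)))"
    unfolding mean_sum[symmetric]
    by (intro mean_cong sum.cong) (auto simp: steps_def pos_def)
  also have "\<dots> \<le> 1"
  proof (rule mean_le_const)
    fix xs assume xs: "xs \<in> steps N"
    have *: False if "i < j" "j \<le> N" "pos xs i = 0" "pos xs j = 0" "avoids_start (drop i xs)" for i j
    proof -
      have "pos (drop i xs) (j - i) = 0"
        using that pos_add[of xs i "j - i"] by simp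
      moreover have "j - i \<in> {1..length (drop i xs)}" using that xs by (auto simp: steps_def)
      ultimately show False using that by (auto simp: avoids_start_def)
    qed
    have "(\<Sum>i\<le>N. of_bool (pos xs i = 0 \<and> avoids_start (drop i xs))) \<le>
        (of_bool (\<exists>i\<in>{..N}. pos xs i = 0 \<and> avoids_start (drop i xs)) :: real)"
    proof (rule sum_of_bool_le_1)
      fix i j assume "i \<in> {..N}" "j \<in> {..N}" "pos xs i = 0 \<and> avoids_start (drop i xs)"
         "pos xs j = 0 \<and> avoids_start (drop j xs)"
      then show "i = j" using *[of i j] *[of j i] by (cases i j rule: linorder_cases) auto
    qed simp
    also have "\<dots> \<le> 1" by simp
    finally show "(\<Sum>i\<le>N. of_bool (pos xs i = 0 \<and> avoids_start (drop i xs))) \<le> (1::real)" .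
  qed
  finally show ?thesis .
qed

lemma summable_return_at: "escape > 0 \<Longrightarrow> summable return_at"
proof (rule bounded_imp_summable[OF return_at_nonneg])
  fix n assume "escape > 0"
  then show "(\<Sum>i\<le>n. return_at i) \<le> 1 / escape"
    using sum_return_at[of n] by (simp add: field_simps)
qed

text \<open>
  Each further visit needs a return, and by the Markov property at the first return these are
  independent. Giving every return at most \<open>s\<close> steps loses little of the geometric law if \<open>s\<close> is
  large.
\<close>

lemma mean_visits_ge:
  assumes "k * s \<le> m"
  shows "(1 - escape_upto s) ^ k \<le> mean m (\<lambda>xs. of_bool (visits xs > k))"
  using assms
proof (induction k arbitrary: m)
  case 0
  then show ?case by (simp add: visits_pos)
next
  case (Suc k)
  let ?h = "\<lambda>xs. of_bool (visits xs > k) :: real"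
  have "1 - escape_upto s = mean s (\<lambda>xs. 1 - of_bool (avoids_start xs))"
    by (simp add: escape_upto_def mean_diff)
  also have "mean s (\<lambda>xs. 1 - of_bool (avoids_start xs)) \<le>
      mean s (\<lambda>xs. \<Sum>u\<in>{1..s}. of_bool (first_return (take u xs)))"
  proof (rule mean_mono)
    fix xs assume xs: "xs \<in> steps s"
    show "1 - of_bool (avoids_start xs) \<le> (\<Sum>u\<in>{1..s}. of_bool (first_return (take u xs)) :: real)"
    proof (cases "avoids_start xs")
      case False
      then obtain u where "u \<in> {1..s}" "first_return (take u xs)"
        using xs unfolding not_avoids_start_iff by (auto simp: steps_def)
      then show ?thesis
        using member_le_sum[of u "{1..s}" "\<lambda>u. of_bool (first_return (take u xs)) :: real"] by auto
    qed (auto intro: sum_nonneg)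
  qed
  also have "\<dots> = (\<Sum>u\<in>{1..s}. mean u (\<lambda>xs. of_bool (first_return xs)))"
    unfolding mean_sum by (intro sum.cong refl mean_take) auto
  finally have ret: "1 - escape_upto s \<le> (\<Sum>u\<in>{1..s}. mean u (\<lambda>xs. of_bool (first_return xs)))" .
  have "(1 - escape_upto s) ^ Suc k \<le> (1 - escape_upto s) * mean (k * s) ?h"
    using Suc.IH[of "k * s"] escape_upto_bounds by (auto intro!: mult_left_mono)
  also have "\<dots> \<le> (\<Sum>u\<in>{1..s}. mean u (\<lambda>xs. of_bool (first_return xs))) * mean (k * s) ?h"
    by (intro mult_right_mono ret mean_nonneg) auto
  also have "\<dots> = (\<Sum>u\<in>{1..s}. mean m (\<lambda>xs. of_bool (first_return (take u xs)) *
       of_bool (visits (take (k * s) (drop u xs)) > k)))"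
    unfolding sum_distrib_right using Suc.prems
    by (intro sum.cong refl mean_take_drop[symmetric]) auto
  also have "\<dots> = mean m (\<lambda>xs. \<Sum>u\<in>{1..s}. of_bool (first_return (take u xs) \<and>
       visits (take (k * s) (drop u xs)) > k))"
    unfolding mean_sum by (simp add: of_bool_conj)
  also have "\<dots> \<le> mean m (\<lambda>xs. of_bool (visits xs > Suc k))"
  proof (rule mean_mono)
    fix xs assume xs: "xs \<in> steps m"
    let ?P = "\<lambda>u. first_return (take u xs) \<and> visits (take (k * s) (drop u xs)) > k"
    have "(\<Sum>u\<in>{1..s}. of_bool (?P u) :: real) \<le> of_bool (\<exists>u\<in>{1..s}. ?P u)"
      using xs Suc.prems by (intro sum_of_bool_le_1) (auto intro: first_return_unique simp: steps_def)
    also have "\<dots> \<le> of_bool (visits xs > Suc k)"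
    proof -
      have "visits xs > Suc k" if "u \<in> {1..s}" "?P u" for u
      proof -
        have "Suc (visits (take (k * s) (drop u xs))) \<le> visits xs"
          using that xs Suc.prems
          by (intro visits_after_return) (auto simp: first_return_def steps_def pos_take)
        with that show ?thesis by auto
      qed
      then show ?thesis by auto
    qed
    finally show "(\<Sum>u\<in>{1..s}. of_bool (?P u) :: real) \<le> of_bool (visits xs > Suc k)" .
  qed
  finally show ?case .
qed

end

text \<open>
  The cost of a site that is visited \<open>k\<close> times; \<open>\<Delta> i\<close> is what visit number \<open>i + 1\<close> adds to it.
\<close>

definition psi :: "(nat \<Rightarrow> real) \<Rightarrow> nat \<Rightarrow> real" where
  "psi \<Delta> k = (\<Sum>i<k. \<Delta> i)"

lemma psi_mono: "(\<And>i. 0 \<le> \<Delta> i) \<Longrightarrow> j \<le> k \<Longrightarrow> psi \<Delta> j \<le> psi \<Delta> k"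
  unfolding psi_def by (intro sum_mono2) auto

lemma psi_nonneg: "(\<And>i. 0 \<le> \<Delta> i) \<Longrightarrow> 0 \<le> psi \<Delta> k"
  unfolding psi_def by (intro sum_nonneg) auto

lemma psi_le: "(\<And>i. \<Delta> i \<le> \<theta>) \<Longrightarrow> psi \<Delta> k \<le> real k * \<theta>"
  unfolding psi_def using sum_bounded_above[of "{..<k}" \<Delta> \<theta>] by simp

lemma psi_min: "psi \<Delta> (min K v) = (\<Sum>k<K. \<Delta> k * of_bool (v > k))"
proof -
  have "{..<min K v} = {..<K} \<inter> {k. k < v}" by auto
  then show ?thesis by (simp add: psi_def)
qed

text \<open>
  The local cost of the time in the middle of a window of \<open>2 m\<close> steps. At most \<open>K\<close> visits are
  counted, so that the cost stays bounded independently of \<open>m\<close>.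
\<close>

definition window_cost :: "(nat \<Rightarrow> real) \<Rightarrow> nat \<Rightarrow> nat \<Rightarrow> 'a::ab_group_add list \<Rightarrow> real" where
  "window_cost \<Delta> K m zs = of_bool (\<forall>t<m. pos zs t \<noteq> pos zs m) *
     psi \<Delta> (min K (card {t. m \<le> t \<and> t \<le> 2 * m \<and> pos zs t = pos zs m}))"

text \<open>
  The two factors of the local cost depend on the two halves of the window. The first half, read
  backwards, must not return to its start; the second half counts its visits to its start.
\<close>

lemma window_cost_append:
  assumes "length xs = m" "length ys = m"
  shows "window_cost \<Delta> K m (xs @ ys) = of_bool (avoids_start (rev xs)) * psi \<Delta> (min K (visits ys))"
proof -
  have p: "pos (xs @ ys) t = pos xs t" if "t \<le> m" for t
    using that assms by (simp add: pos_def)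
  have q: "pos (xs @ ys) (m + t) = pos xs m + pos ys t" for t
    using assms by (simp add: pos_def)
  have r: "pos (rev xs) k = pos xs m - pos xs (m - k)" if "k \<le> m" for k
    using that assms by (simp add: pos_def take_rev sum_list_drop)
  have "(\<forall>t<m. pos (xs @ ys) t \<noteq> pos (xs @ ys) m) \<longleftrightarrow> avoids_start (rev xs)"
  proof
    assume *: "\<forall>t<m. pos (xs @ ys) t \<noteq> pos (xs @ ys) m"
    show "avoids_start (rev xs)" unfolding avoids_start_def
    proof
      fix k assume "k \<in> {1..length (rev xs)}"
      then have "m - k < m" "k \<le> m" using assms by auto
      then show "pos (rev xs) k \<noteq> 0"
        using *[rule_format, of "m - k"] p[of m] p[of "m - k"] r[of k] by auto
    qed
  next
    assume *: "avoids_start (rev xs)"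
    show "\<forall>t<m. pos (xs @ ys) t \<noteq> pos (xs @ ys) m"
    proof (intro allI impI)
      fix t assume "t < m"
      then have "m - t \<in> {1..length (rev xs)}" using assms by auto
      then show "pos (xs @ ys) t \<noteq> pos (xs @ ys) m"
        using * p[of m] p[of t] r[of "m - t"] \<open>t < m\<close> by (auto simp: avoids_start_def)
    qed
  qed
  moreover have "card {t. m \<le> t \<and> t \<le> 2 * m \<and> pos (xs @ ys) t = pos (xs @ ys) m} = visits ys"
  proof -
    have "{t. m \<le> t \<and> t \<le> 2 * m \<and> pos (xs @ ys) t = pos (xs @ ys) m}
       = (+) m ` {t. t \<le> length ys \<and> pos ys t = 0}" (is "?A = _ ` ?B")
    proof (intro equalityI subsetI)
      fix t assume "t \<in> ?A"
      then show "t \<in> (+) m ` ?B"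
        using q[of "t - m"] p[of m] assms by (intro image_eqI[of _ _ "t - m"]) auto
    next
      fix t assume "t \<in> (+) m ` ?B"
      then show "t \<in> ?A" using q p[of m] assms by auto
    qed
    then show ?thesis by (simp add: visits_def card_image)
  qed
  ultimately show ?thesis by (simp add: window_cost_def)
qed

text \<open>
  The middle of the window is a new site with probability at least \<open>escape\<close>, and then it is visited
  a nearly geometric number of times.
\<close>

lemma (in finite_walk) mean_window_cost:
  assumes "\<And>i. 0 \<le> \<Delta> i" "K * s \<le> m"
  shows "escape * (\<Sum>k<K. \<Delta> k * (1 - escape_upto s) ^ k) \<le> mean (2 * m) (window_cost \<Delta> K m)"
proof -
  have "mean (2 * m) (window_cost \<Delta> K m) = mean m (\<lambda>xs. mean m (\<lambda>ys. window_cost \<Delta> K m (xs @ ys)))"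
    using mean_append[of m m] by (simp add: mult_2)
  also have "\<dots> = mean m (\<lambda>xs. of_bool (avoids_start (rev xs)) * mean m (\<lambda>ys. psi \<Delta> (min K (visits ys))))"
    unfolding mean_cmult[symmetric]
    by (intro mean_cong window_cost_append) (auto simp: steps_def)
  also have "\<dots> = escape_upto m * mean m (\<lambda>ys. psi \<Delta> (min K (visits ys)))"
    using mean_rev[of m "\<lambda>xs. of_bool (avoids_start xs)"] by (simp add: mean_multc escape_upto_def)
  also have "mean m (\<lambda>ys. psi \<Delta> (min K (visits ys))) = (\<Sum>k<K. \<Delta> k * mean m (\<lambda>ys. of_bool (visits ys > k)))"
    by (simp only: psi_min mean_sum mean_cmult)
  finally have eq: "mean (2 * m) (window_cost \<Delta> K m) =
     escape_upto m * (\<Sum>k<K. \<Delta> k * mean m (\<lambda>ys. of_bool (visits ys > k)))" .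
  have "(\<Sum>k<K. \<Delta> k * (1 - escape_upto s) ^ k) \<le> (\<Sum>k<K. \<Delta> k * mean m (\<lambda>ys. of_bool (visits ys > k)))"
  proof (intro sum_mono mult_left_mono mean_visits_ge)
    fix k assume "k \<in> {..<K}"
    then have "k * s \<le> K * s" by simp
    with assms show "k * s \<le> m" by linarith
  qed (use assms in auto)
  then show ?thesis unfolding eq
    using escape_upto_bounds escape_bounds assms
    by (intro mult_mono escape_le) (auto intro!: sum_nonneg mult_nonneg_nonneg)
qed

section \<open>Hitting a level under discounting\<close>

text \<open>
  The leading constant \<open>1 / 2\<close> is what fixes the constant in the exponent of the final bound.
\<close>

lemma cosh_le_quadratic:
  fixes y b :: real
  assumes "\<bar>y\<bar> \<le> b"
  shows "cosh y \<le> 1 + y\<^sup>2 / 2 * exp b"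
proof -
  define x where "x = \<bar>y\<bar> / 2"
  have x: "0 \<le> x" "2 * x \<le> b" "y\<^sup>2 = (2 * x)\<^sup>2" using assms by (auto simp: x_def)
  have "exp x - exp (- x) = exp x * (1 - exp (- (2 * x)))"
    by (simp add: algebra_simps flip: exp_add)
  also have "\<dots> \<le> exp x * (2 * x)"
    using exp_ge_add_one_self[of "- (2 * x)"] by (intro mult_left_mono) auto
  finally have s: "sinh x \<le> x * exp x" by (simp add: sinh_field_def mult_ac)
  have "cosh y = cosh (2 * x)" by (simp add: x_def cosh_def abs_if)
  also have "\<dots> = 1 + 2 * (sinh x)\<^sup>2" by (simp add: cosh_double cosh_square_eq)
  also have "\<dots> \<le> 1 + 2 * (x * exp x)\<^sup>2"
    using s x by (simp add: power_mono)
  also have "\<dots> = 1 + y\<^sup>2 / 2 * exp (2 * x)"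
    by (simp add: x power_mult_distrib exp_double)
  also have "\<dots> \<le> 1 + y\<^sup>2 / 2 * exp b" using x by (intro add_mono mult_left_mono) auto
  finally show ?thesis .
qed

lemma cosh_ge_quadratic: "1 + y\<^sup>2 / 2 \<le> cosh (y :: real)"
proof -
  have "\<bar>y / 2\<bar> \<le> \<bar>sinh (y / 2)\<bar>"
  proof -
    have "x \<le> sinh x" if "x \<ge> 0" for x :: real
    proof -
      have "(\<lambda>x. sinh x - x) 0 \<le> (\<lambda>x. sinh x - x) x"
        using that
        by (rule DERIV_nonneg_imp_nondecreasing)
           (auto intro!: exI derivative_eq_intros simp: cosh_real_ge_1)
      then show ?thesis by simp
    qed
    from this[of "\<bar>y / 2\<bar>"] show ?thesis by (simp only: sinh_real_abs)
  qed
  then have "(y / 2)\<^sup>2 \<le> (sinh (y / 2))\<^sup>2" by (simp only: abs_le_square_iff)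
  moreover have "cosh y = 1 + 2 * (sinh (y / 2))\<^sup>2"
    using cosh_double[of "y / 2"] by (simp add: cosh_square_eq)
  ultimately show ?thesis by (simp add: power_divide)
qed

text \<open>
  The solution of the one-dimensional equation with killing above \<open>a\<close> and none below it: constant
  below \<open>a\<close>, and with matching derivative at \<open>a\<close>.
\<close>

definition barrier :: "real \<Rightarrow> real \<Rightarrow> real \<Rightarrow> real" where
  "barrier \<kappa> a s = cosh (\<kappa> * max (s - a) 0)"

lemma barrier_ge_1: "1 \<le> barrier \<kappa> a s"
  by (simp add: barrier_def cosh_real_ge_1)

lemma barrier_mono: "0 \<le> \<kappa> \<Longrightarrow> s \<le> t \<Longrightarrow> barrier \<kappa> a s \<le> barrier \<kappa> a t"
  unfolding barrier_def by (subst cosh_real_nonneg_le_iff) (auto intro!: mult_left_mono)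

text \<open>
  Above \<open>a\<close> this is the addition theorem, because \<open>cosh\<close> exceeds the barrier wherever the two
  differ. Below \<open>a\<close>, a move by \<open>u\<close> ends at most \<open>\<bar>u\<bar>\<close> above \<open>a\<close>, so that both terms are at most
  \<open>cosh (\<kappa> * u)\<close>.
\<close>

lemma barrier_pair:
  assumes "0 \<le> \<kappa>"
  shows "barrier \<kappa> a (s + u) + barrier \<kappa> a (s - u) \<le> 2 * cosh (\<kappa> * u) * barrier \<kappa> a s"
proof (cases "s \<ge> a")
  case True
  have le: "barrier \<kappa> a (s + w) \<le> cosh (\<kappa> * (s + w - a))" for w
    by (cases "s + w \<ge> a") (auto simp: barrier_def max_def cosh_real_ge_1)
  have "barrier \<kappa> a (s + u) + barrier \<kappa> a (s - u) \<le> cosh (\<kappa> * (s - a) + \<kappa> * u) + cosh (\<kappa> * (s - a) - \<kappa> * u)"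
    using le[of u] le[of "- u"] by (simp add: algebra_simps)
  also have "\<dots> = 2 * cosh (\<kappa> * u) * barrier \<kappa> a s"
    using True by (simp add: barrier_def cosh_add cosh_diff max_def)
  finally show ?thesis .
next
  case False
  have le: "barrier \<kappa> a (s + w) \<le> cosh (\<kappa> * u)" if "w = u \<or> w = - u" for w
  proof -
    have "\<bar>\<kappa> * max (s + w - a) 0\<bar> \<le> \<bar>\<kappa> * u\<bar>"
      using that False assms by (auto simp: abs_mult intro!: mult_left_mono)
    then have "cosh \<bar>\<kappa> * max (s + w - a) 0\<bar> \<le> cosh \<bar>\<kappa> * u\<bar>"
      by (subst cosh_real_nonneg_le_iff) auto
    then show ?thesis by (simp add: barrier_def cosh_real_abs)
  qed
  have "barrier \<kappa> a s = 1" using False by (simp add: barrier_def)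
  then show ?thesis using le[of u] le[of "- u"] by simp
qed

text \<open>
  The walk is observed through an additive function \<open>lev\<close>, the coordinate in the direction of the
  crossing; \<open>v\<close> is the variance that a step has in this direction.
\<close>

locale leveled_walk = finite_walk p for p :: "'a::ab_group_add pmf" +
  fixes lev :: "'a \<Rightarrow> real" and v :: real
  assumes lev_add: "lev (x + y) = lev x + lev y"
    and lev_bounded: "x \<in> set_pmf p \<Longrightarrow> \<bar>lev x\<bar> \<le> 1"
    and symmetric: "map_pmf uminus p = p"
    and variance: "measure_pmf.expectation p (\<lambda>x. (lev x)\<^sup>2) = v"
    and variance_pos: "v > 0"
begin

lemma lev_0 [simp]: "lev 0 = 0"
  using lev_add[of 0 0] by simp

lemma lev_uminus: "lev (- x) = - lev x"
  using lev_add[of x "- x"] by simp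

lemma step_mono:
  "(\<And>x. x \<in> set_pmf p \<Longrightarrow> f x \<le> g x) \<Longrightarrow> measure_pmf.expectation p f \<le> (measure_pmf.expectation p g :: real)"
  by (intro integral_mono_AE) (auto simp: AE_measure_pmf_iff)

lemma step_symmetrize:
  fixes f :: "real \<Rightarrow> real"
  shows "measure_pmf.expectation p (\<lambda>x. f (lev x)) = measure_pmf.expectation p (\<lambda>x. (f (lev x) + f (- lev x)) / 2)"
proof -
  have "measure_pmf.expectation p (\<lambda>x. f (lev x)) = measure_pmf.expectation (map_pmf uminus p) (\<lambda>x. f (lev x))"
    by (simp add: symmetric)
  also have "\<dots> = measure_pmf.expectation p (\<lambda>x. f (- lev x))"
    by (simp add: lev_uminus integral_map_pmf)
  finally show ?thesis by simp
qed

lemma step_cosh_le: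
  assumes "0 \<le> \<kappa>"
  shows "measure_pmf.expectation p (\<lambda>x. cosh (\<kappa> * lev x)) \<le> 1 + \<kappa>\<^sup>2 * v / 2 * exp \<kappa>"
proof -
  have "measure_pmf.expectation p (\<lambda>x. cosh (\<kappa> * lev x))
      \<le> measure_pmf.expectation p (\<lambda>x. 1 + \<kappa>\<^sup>2 / 2 * exp \<kappa> * (lev x)\<^sup>2)"
  proof (rule step_mono)
    fix x assume "x \<in> set_pmf p"
    then have "\<bar>\<kappa> * lev x\<bar> \<le> \<kappa>"
      using lev_bounded[of x] assms mult_left_mono[of "\<bar>lev x\<bar>" 1 \<kappa>] by (simp add: abs_mult)
    from cosh_le_quadratic[OF this]
    show "cosh (\<kappa> * lev x) \<le> 1 + \<kappa>\<^sup>2 / 2 * exp \<kappa> * (lev x)\<^sup>2"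
      by (simp add: power_mult_distrib mult_ac)
  qed
  also have "\<dots> = 1 + \<kappa>\<^sup>2 * v / 2 * exp \<kappa>" by (simp add: variance)
  finally show ?thesis .
qed

lemma step_exp_ge: "1 + \<theta>\<^sup>2 * v / 2 \<le> measure_pmf.expectation p (\<lambda>x. exp (\<theta> * lev x))"
proof -
  have "1 + \<theta>\<^sup>2 * v / 2 = measure_pmf.expectation p (\<lambda>x. 1 + \<theta>\<^sup>2 / 2 * (lev x)\<^sup>2)"
    by (simp add: variance)
  also have "\<dots> \<le> measure_pmf.expectation p (\<lambda>x. cosh (\<theta> * lev x))"
  proof (rule step_mono)
    show "1 + \<theta>\<^sup>2 / 2 * (lev x)\<^sup>2 \<le> cosh (\<theta> * lev x)" for x
      using cosh_ge_quadratic[of "\<theta> * lev x"] by (simp add: power_mult_distrib)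
  qed
  also have "\<dots> = measure_pmf.expectation p (\<lambda>x. exp (\<theta> * lev x))"
    using step_symmetrize[of "\<lambda>y. exp (\<theta> * y)"] by (simp add: cosh_field_def)
  finally show ?thesis .
qed

definition reaches :: "real \<Rightarrow> real \<Rightarrow> 'a list \<Rightarrow> bool" where
  "reaches g s xs \<longleftrightarrow> (\<exists>j\<le>length xs. g \<le> s + lev (pos xs j))"

text \<open>
  The number of steps that start in \<open>[b, g)\<close> before the level \<open>g\<close> is reached; the walk starts from
  the level \<open>s\<close>, so that the first step can be split off.
\<close>

definition occupation :: "real \<Rightarrow> real \<Rightarrow> real \<Rightarrow> 'a list \<Rightarrow> nat" where
  "occupation g b s xs = card {i. i < length xs \<and> (\<forall>j\<le>i. s + lev (pos xs j) < g) \<and> b \<le> s + lev (pos xs i)}"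

lemma reaches_Cons: "reaches g s (x # xs) \<longleftrightarrow> g \<le> s \<or> reaches g (s + lev x) xs"
proof
  assume "reaches g s (x # xs)"
  then obtain j where j: "j \<le> length (x # xs)" "g \<le> s + lev (pos (x # xs) j)" by (auto simp: reaches_def)
  then show "g \<le> s \<or> reaches g (s + lev x) xs"
    by (cases j) (auto simp: reaches_def pos_Cons lev_add add.assoc)
next
  assume "g \<le> s \<or> reaches g (s + lev x) xs"
  then show "reaches g s (x # xs)"
  proof
    assume "g \<le> s"
    then show ?thesis by (auto simp: reaches_def intro!: exI[of _ 0])
  next
    assume "reaches g (s + lev x) xs"
    then obtain j where "j \<le> length xs" "g \<le> s + lev x + lev (pos xs j)" by (auto simp: reaches_def)
    then show ?thesis by (auto simp: reaches_def pos_Cons lev_add add.assoc intro!: exI[of _ "Suc j"])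
  qed
qed

lemma occupation_Cons:
  assumes "s < g"
  shows "occupation g b s (x # xs) = of_bool (b \<le> s) + occupation g b (s + lev x) xs"
proof -
  have all_le_Suc: "(\<forall>j\<le>Suc i. P j) \<longleftrightarrow> P 0 \<and> (\<forall>j\<le>i. P (Suc j))" for P i
    using All_less_Suc2[of "Suc i" P] by (simp add: less_Suc_eq_le)
  let ?A = "{i. i < length xs \<and> (\<forall>j\<le>i. s + lev x + lev (pos xs j) < g) \<and> b \<le> s + lev x + lev (pos xs i)}"
  have "{i. i < length (x # xs) \<and> (\<forall>j\<le>i. s + lev (pos (x # xs) j) < g) \<and> b \<le> s + lev (pos (x # xs) i)}
     = (if b \<le> s then {0} else {}) \<union> Suc ` ?A" (is "?B = ?C")
  proof (rule set_eqI)
    fix i show "i \<in> ?B \<longleftrightarrow> i \<in> ?C"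
      using assms
      by (cases i) (auto simp: pos_Cons lev_add add.assoc all_le_Suc)
  qed
  then show ?thesis unfolding occupation_def
    by (auto simp: card_image card_insert_if)
qed

text \<open>
  The barrier is a supermartingale under discounting by \<open>exp (- c)\<close> for each step from \<open>[b, g)\<close>:
  from a level in this slab a step multiplies its mean by at most \<open>exp c\<close>, and below \<open>b\<close> it is
  constant within reach of a step, as \<open>b + 1 \<le> a\<close>.
\<close>

lemma discounted_hitting:
  assumes "0 \<le> \<kappa>" "b + 1 \<le> a" "1 + \<kappa>\<^sup>2 * v / 2 * exp \<kappa> \<le> exp c"
  shows "mean J (\<lambda>xs. of_bool (reaches g s xs) * exp (- c * occupation g b s xs)) \<le> barrier \<kappa> a s / barrier \<kappa> a g"
proof (induction J arbitrary: s)
  case 0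
  have "barrier \<kappa> a g \<le> barrier \<kappa> a s" if "g \<le> s" using that assms by (intro barrier_mono)
  then show ?case using barrier_ge_1[of \<kappa> a g] barrier_ge_1[of \<kappa> a s]
    by (auto simp: reaches_def occupation_def field_simps)
next
  case (Suc J)
  have pos: "barrier \<kappa> a g > 0" using barrier_ge_1[of \<kappa> a g] by linarith
  have c: "0 \<le> c"
  proof -
    have "1 \<le> 1 + \<kappa>\<^sup>2 * v / 2 * exp \<kappa>" using variance_pos by simp
    then show ?thesis using assms(3) by (metis order_trans one_le_exp_iff)
  qed
  show ?case
  proof (cases "g \<le> s")
    case True
    have "mean (Suc J) (\<lambda>xs. of_bool (reaches g s xs) * exp (- c * occupation g b s xs)) \<le> 1"
      using c by (intro mean_le_const) auto
    also have "\<dots> \<le> barrier \<kappa> a s / barrier \<kappa> a g"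
      using pos True assms barrier_mono[of \<kappa> g s a] by (simp add: field_simps)
    finally show ?thesis .
  next
    case False
    then have "s < g" by simp
    have "mean (Suc J) (\<lambda>xs. of_bool (reaches g s xs) * exp (- c * occupation g b s xs)) =
      measure_pmf.expectation p (\<lambda>x. exp (- c * of_bool (b \<le> s)) * mean J (\<lambda>xs. of_bool (reaches g (s + lev x) xs) *
         exp (- c * occupation g b (s + lev x) xs)))"
      unfolding mean_Suc mean_cmult[symmetric] using \<open>s < g\<close>
      by (intro Bochner_Integration.integral_cong refl mean_cong)
         (auto simp: reaches_Cons occupation_Cons ring_distribs exp_diff exp_minus exp_add divide_simps)
    also have "\<dots> \<le> measure_pmf.expectation p (\<lambda>x. exp (- c * of_bool (b \<le> s)) * (barrier \<kappa> a (s + lev x) / barrier \<kappa> a g))"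
      by (intro step_mono mult_left_mono Suc.IH) auto
    also have "\<dots> = exp (- c * of_bool (b \<le> s)) * measure_pmf.expectation p (\<lambda>x. barrier \<kappa> a (s + lev x)) / barrier \<kappa> a g"
      by simp
    also have "\<dots> \<le> barrier \<kappa> a s / barrier \<kappa> a g"
    proof (rule divide_right_mono)
      show "exp (- c * of_bool (b \<le> s)) * measure_pmf.expectation p (\<lambda>x. barrier \<kappa> a (s + lev x)) \<le> barrier \<kappa> a s"
      proof (cases "b \<le> s")
        case True
        have "measure_pmf.expectation p (\<lambda>x. barrier \<kappa> a (s + lev x)) \<le>
            measure_pmf.expectation p (\<lambda>x. cosh (\<kappa> * lev x) * barrier \<kappa> a s)"
          unfolding step_symmetrize[of "\<lambda>y. barrier \<kappa> a (s + y)"]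
        proof (rule step_mono)
          show "(barrier \<kappa> a (s + lev x) + barrier \<kappa> a (s + - lev x)) / 2 \<le> cosh (\<kappa> * lev x) * barrier \<kappa> a s" for x
            using barrier_pair[of \<kappa> a s "lev x"] assms by simp
        qed
        also have "\<dots> \<le> exp c * barrier \<kappa> a s"
          using step_cosh_le[of \<kappa>] assms barrier_ge_1[of \<kappa> a s] by (simp add: mult_right_mono)
        finally show ?thesis using True by (simp add: exp_minus field_simps)
      next
        case False
        have "measure_pmf.expectation p (\<lambda>x. barrier \<kappa> a (s + lev x)) \<le> measure_pmf.expectation p (\<lambda>x. 1)"
        proof (rule step_mono)
          fix x assume "x \<in> set_pmf p"
          then have "s + lev x \<le> a" using lev_bounded[of x] assms False by auto
          then show "barrier \<kappa> a (s + lev x) \<le> 1" by (simp add: barrier_def)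
        qed
        then show ?thesis using False barrier_ge_1[of \<kappa> a s] by simp
      qed
    qed (use pos in auto)
    finally show ?thesis .
  qed
qed

text \<open>
  The exponential submartingale \<open>exp (\<theta> (level)) * \<rho> ^ (time)\<close> at the hitting time of \<open>g\<close>, where the
  level is at most \<open>g + 1\<close>. Choosing \<open>\<theta>\<close> small and then \<open>J\<close> large makes the bound close to \<open>1\<close>.
\<close>

lemma reaches_probability:
  fixes \<theta> :: real
  defines "\<rho> \<equiv> 1 / (1 + \<theta>\<^sup>2 * v / 2)"
  assumes "0 \<le> \<theta>" "s \<le> g + 1"
  shows "exp (\<theta> * (s - g - 1)) - \<rho> ^ J \<le> mean J (\<lambda>xs. of_bool (reaches g s xs))"
  using assms(3)
proof (induction J arbitrary: s)
  case 0
  then have "exp (\<theta> * (s - g - 1)) \<le> 1" using assms by (auto simp: mult_nonneg_nonpos)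
  then have "exp (\<theta> * (s - g - 1)) - \<rho> ^ 0 \<le> 0" by simp
  also have "0 \<le> mean 0 (\<lambda>xs. of_bool (reaches g s xs))" by (intro mean_nonneg) auto
  finally show ?case .
next
  case (Suc J)
  have \<rho>: "0 < \<rho>" "\<rho> \<le> 1"
    unfolding \<rho>_def using variance_pos by (auto simp: divide_simps add_pos_nonneg)
  show ?case
  proof (cases "g \<le> s")
    case True
    then have "mean (Suc J) (\<lambda>xs. of_bool (reaches g s xs)) = mean (Suc J) (\<lambda>_. 1)"
      by (intro mean_cong) (auto simp: reaches_def intro!: exI[of _ 0])
    moreover have "exp (\<theta> * (s - g - 1)) \<le> 1" using assms Suc.prems by (auto simp: mult_nonneg_nonpos)
    moreover have "0 \<le> \<rho> ^ Suc J" using \<rho> by simp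
    ultimately show ?thesis unfolding mean_const by linarith
  next
    case False
    define e where "e = exp (\<theta> * (s - g - 1))"
    have "e / \<rho> - \<rho> ^ J = e * (1 + \<theta>\<^sup>2 * v / 2) - \<rho> ^ J" by (simp add: \<rho>_def)
    also have "\<dots> \<le> e * measure_pmf.expectation p (\<lambda>x. exp (\<theta> * lev x)) - \<rho> ^ J"
      using step_exp_ge[of \<theta>] by (simp add: e_def)
    also have "\<dots> = measure_pmf.expectation p (\<lambda>x. exp (\<theta> * (s + lev x - g - 1)) - \<rho> ^ J)"
    proof -
      have "e * exp (\<theta> * lev x) = exp (\<theta> * (s + lev x - g - 1))" for x
        unfolding e_def exp_add[symmetric] by (simp add: algebra_simps)
      then show ?thesis by (simp flip: integral_mult_right_zero)
    qed
    also have "\<dots> \<le> measure_pmf.expectation p (\<lambda>x. mean J (\<lambda>xs. of_bool (reaches g (s + lev x) xs)))"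
    proof (intro step_mono Suc.IH)
      fix x assume "x \<in> set_pmf p"
      then show "s + lev x \<le> g + 1" using lev_bounded[of x] False by auto
    qed
    also have "\<dots> = mean (Suc J) (\<lambda>xs. of_bool (reaches g s xs))"
      unfolding mean_Suc using False by (simp add: reaches_Cons)
    finally have *: "e / \<rho> - \<rho> ^ J \<le> mean (Suc J) (\<lambda>xs. of_bool (reaches g s xs))" .
    have "e - \<rho> ^ Suc J = \<rho> * (e / \<rho> - \<rho> ^ J)" using \<rho> by (simp add: algebra_simps)
    also have "\<dots> \<le> \<rho> * mean (Suc J) (\<lambda>xs. of_bool (reaches g s xs))"
      using * \<rho> by (intro mult_left_mono) auto
    also have "\<dots> \<le> 1 * mean (Suc J) (\<lambda>xs. of_bool (reaches g s xs))"
      using \<rho> by (intro mult_right_mono mean_nonneg) auto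
    finally show ?thesis by (simp add: e_def)
  qed
qed

text \<open>
  Paths that do not reach \<open>g\<close> within \<open>J\<close> steps are not discounted at all; \<open>reaches_probability\<close> says
  that they are rare.
\<close>

lemma discounted_occupation:
  assumes "0 \<le> \<kappa>" "0 \<le> b" "1 + \<kappa>\<^sup>2 * v / 2 * exp \<kappa> \<le> exp c" "0 \<le> \<theta>" "b + 1 \<le> g"
  shows "mean J (\<lambda>xs. exp (- c * occupation g b 0 xs)) \<le>
    1 / cosh (\<kappa> * (g - b - 1)) + (1 - exp (- \<theta> * (g + 1)) + (1 / (1 + \<theta>\<^sup>2 * v / 2)) ^ J)"
proof -
  have c: "0 \<le> c"
  proof -
    have "1 \<le> 1 + \<kappa>\<^sup>2 * v / 2 * exp \<kappa>" using variance_pos by simp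
    then show ?thesis using assms(3) by (metis order_trans one_le_exp_iff)
  qed
  have "mean J (\<lambda>xs. exp (- c * occupation g b 0 xs)) \<le>
     mean J (\<lambda>xs. of_bool (reaches g 0 xs) * exp (- c * occupation g b 0 xs) + (1 - of_bool (reaches g 0 xs)))"
    using c by (intro mean_mono) auto
  also have "\<dots> = mean J (\<lambda>xs. of_bool (reaches g 0 xs) * exp (- c * occupation g b 0 xs))
      + (1 - mean J (\<lambda>xs. of_bool (reaches g 0 xs)))"
    by (simp add: mean_add mean_diff)
  also have "\<dots> \<le> barrier \<kappa> (b + 1) 0 / barrier \<kappa> (b + 1) g
      + (1 - (exp (\<theta> * (0 - g - 1)) - (1 / (1 + \<theta>\<^sup>2 * v / 2)) ^ J))"
    using assms by (intro add_mono diff_mono discounted_hitting reaches_probability order_refl) auto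
  also have e: "exp (\<theta> * (0 - g - 1)) = exp (- \<theta> * (g + 1))" by (simp add: algebra_simps)
  also have "barrier \<kappa> (b + 1) 0 = 1" using assms by (simp add: barrier_def)
  also have "barrier \<kappa> (b + 1) g = cosh (\<kappa> * (g - b - 1))" using assms by (simp add: barrier_def algebra_simps)
  finally show ?thesis by linarith
qed

lemma reaches_eventually:
  assumes "0 \<le> g" "\<eta> > 0"
  shows "\<exists>J. mean J (\<lambda>xs. of_bool (\<not> reaches g 0 xs)) \<le> \<eta>"
proof -
  define \<theta> where "\<theta> = \<eta> / (2 * (g + 1))"
  have \<theta>: "0 < \<theta>" using assms by (auto simp: \<theta>_def)
  define \<rho> where "\<rho> = 1 / (1 + \<theta>\<^sup>2 * v / 2)"
  have "0 < \<theta>\<^sup>2 * v / 2" using \<theta> variance_pos by simp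
  then have \<rho>: "0 < \<rho>" "\<rho> < 1" unfolding \<rho>_def by (auto simp: divide_simps)
  obtain J where J: "\<rho> ^ J < \<eta> / 2"
    using real_arch_pow_inv[of "\<eta> / 2" \<rho>] \<rho> assms by auto
  have "mean J (\<lambda>xs. of_bool (\<not> reaches g 0 xs)) = 1 - mean J (\<lambda>xs. of_bool (reaches g 0 xs))"
    by (simp add: of_bool_not_iff mean_diff)
  also have "\<dots> \<le> 1 - (exp (\<theta> * (0 - g - 1)) - \<rho> ^ J)"
    unfolding \<rho>_def using \<theta> assms by (intro diff_mono reaches_probability order_refl) auto
  also have "exp (\<theta> * (0 - g - 1)) \<ge> 1 - \<eta> / 2"
  proof -
    have "\<theta> * (0 - g - 1) = - (\<eta> / 2)" using assms by (simp add: \<theta>_def field_simps)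
    then show ?thesis using exp_ge_add_one_self[of "- (\<eta> / 2)"] by simp
  qed
  ultimately show ?thesis using J by (intro exI[of _ J]) linarith
qed

end

section \<open>The cost of a path and its decomposition into stages\<close>

context leveled_walk
begin

definition alive :: "real \<Rightarrow> 'a list \<Rightarrow> nat \<Rightarrow> bool" where
  "alive s xs k \<longleftrightarrow> (\<forall>j\<le>k. lev (pos xs j) < s)"

text \<open>
  The times of the first visits to the sites of nonnegative level, before the level \<open>s\<close> is reached.
  Sites are indexed by these times, so that shifting the path shifts a set of natural numbers.
\<close>

definition fresh :: "real \<Rightarrow> 'a list \<Rightarrow> nat set" where
  "fresh s xs = {k. k < length xs \<and> alive s xs k \<and> 0 \<le> lev (pos xs k) \<and> (\<forall>j<k. pos xs j \<noteq> pos xs k)}"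

definition local_time :: "real \<Rightarrow> 'a list \<Rightarrow> nat \<Rightarrow> nat" where
  "local_time s xs k = card {i. k \<le> i \<and> i < length xs \<and> alive s xs i \<and> pos xs i = pos xs k}"

definition cost :: "(nat \<Rightarrow> real) \<Rightarrow> real \<Rightarrow> 'a list \<Rightarrow> real" where
  "cost \<Delta> s xs = (\<Sum>k\<in>fresh s xs. psi \<Delta> (local_time s xs k))"

definition passage :: "real \<Rightarrow> 'a list \<Rightarrow> bool" where
  "passage g us \<longleftrightarrow> g \<le> lev (pos us (length us)) \<and> (\<forall>j<length us. lev (pos us j) < g)"

definition weight :: "(nat \<Rightarrow> real) \<Rightarrow> real \<Rightarrow> nat \<Rightarrow> real" where
  "weight \<Delta> s N = mean N (\<lambda>xs. exp (- cost \<Delta> s xs))"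

lemma finite_fresh [simp]: "finite (fresh s xs)"
  by (simp add: fresh_def)

lemma alive_take: "k \<le> N \<Longrightarrow> alive s (take N xs) k \<longleftrightarrow> alive s xs k"
  by (auto simp: alive_def pos_take)

lemma cost_nonneg: "(\<And>i. 0 \<le> \<Delta> i) \<Longrightarrow> 0 \<le> cost \<Delta> s xs"
  unfolding cost_def by (intro sum_nonneg psi_nonneg)

lemma cost_take_le:
  assumes "\<And>i. 0 \<le> \<Delta> i"
  shows "cost \<Delta> s (take N xs) \<le> cost \<Delta> s xs"
proof -
  have "cost \<Delta> s (take N xs) \<le> (\<Sum>k\<in>fresh s (take N xs). psi \<Delta> (local_time s xs k))"
    unfolding cost_def
  proof (intro sum_mono psi_mono assms)
    fix k assume "k \<in> fresh s (take N xs)"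
    then show "local_time s (take N xs) k \<le> local_time s xs k"
      unfolding local_time_def by (intro card_mono) (auto simp: alive_take pos_take fresh_def)
  qed
  also have "\<dots> \<le> cost \<Delta> s xs"
    unfolding cost_def
    by (intro sum_mono2 psi_nonneg assms) (auto simp: fresh_def alive_take pos_take)
  finally show ?thesis .
qed

lemma cost_passage:
  assumes "\<And>i. 0 \<le> \<Delta> i" "passage g (take u xs)" "u \<le> length xs"
  shows "cost \<Delta> g (take u xs) = cost \<Delta> g xs"
proof -
  have u: "k < u" if "alive g xs k" for k
    using that assms(2,3) by (force simp: alive_def passage_def pos_take min_absorb2 not_less[symmetric])
  have "k \<in> fresh g (take u xs) \<longleftrightarrow> k \<in> fresh g xs" for k
    using assms(3) u[of k] by (cases "k < u") (auto simp: fresh_def alive_take pos_take)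
  then have "fresh g (take u xs) = fresh g xs" by blast
  moreover have "local_time g (take u xs) k = local_time g xs k" if "k \<in> fresh g xs" for k
  proof -
    have "k < u" using that u by (auto simp: fresh_def)
    then have "k \<le> i \<and> i < length (take u xs) \<and> alive g (take u xs) i \<and> pos (take u xs) i = pos (take u xs) k
      \<longleftrightarrow> k \<le> i \<and> i < length xs \<and> alive g xs i \<and> pos xs i = pos xs k" for i
      using assms(3) u[of i] by (cases "i < u") (auto simp: alive_take pos_take)
    then show ?thesis by (simp add: local_time_def)
  qed
  ultimately show ?thesis by (simp add: cost_def)
qed

lemma passage_unique:
  assumes "passage g (take u xs)" "passage g (take w xs)" "u \<le> length xs" "w \<le> length xs"
  shows "u = w"
proof -
  have False if "passage g (take u xs)" "passage g (take w xs)" "u < w" "w \<le> length xs" for u w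
    using that by (force simp: passage_def pos_take min_absorb2)
  from this[of u w] this[of w u] assms show ?thesis by (cases u w rule: linorder_cases) auto
qed

lemma reaches_iff_passage: "reaches g 0 xs \<longleftrightarrow> (\<exists>u\<le>length xs. passage g (take u xs))"
proof
  assume "reaches g 0 xs"
  then have ex: "\<exists>u. u \<le> length xs \<and> g \<le> lev (pos xs u)" by (simp add: reaches_def)
  define u where "u = (LEAST u. u \<le> length xs \<and> g \<le> lev (pos xs u))"
  have u: "u \<le> length xs" "g \<le> lev (pos xs u)" using LeastI_ex[OF ex] by (auto simp: u_def)
  have "lev (pos xs j) < g" if "j < u" for j
    using not_less_Least[of j "\<lambda>u. u \<le> length xs \<and> g \<le> lev (pos xs u)"] that u by (auto simp: u_def)
  then have "passage g (take u xs)" using u by (auto simp: passage_def pos_take min_absorb2)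
  with u show "\<exists>u\<le>length xs. passage g (take u xs)" by blast
qed (auto simp: passage_def reaches_def pos_take min_absorb2)

lemma lev_passage_le:
  assumes "xs \<in> steps N" "0 < g" "passage g (take u xs)" "u \<le> N"
  shows "lev (pos xs u) \<le> g + 1"
proof (cases u)
  case 0
  then show ?thesis using assms by (simp add: passage_def)
next
  case (Suc j)
  then have "pos xs u = pos xs j + xs ! j"
    using assms by (simp add: pos_def take_Suc_conv_app_nth steps_def)
  moreover have "lev (pos xs j) < g"
    using assms Suc by (auto simp: passage_def steps_def pos_take)
  moreover have "\<bar>lev (xs ! j)\<bar> \<le> 1"
    using assms Suc by (intro lev_bounded) (auto simp: steps_def subset_eq)
  ultimately show ?thesis by (simp add: lev_add)
qed

text \<open>
  When the walk first reaches the level \<open>g\<close>, the sites on its present level and above are new to it,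
  since all sites that it has visited lie below \<open>g\<close>. So what is paid before this time and what is
  paid afterwards on these levels concern different sites. The overshoot is at most \<open>1\<close>, whence
  \<open>s - g - 1\<close>.
\<close>

lemma cost_split:
  assumes \<Delta>: "\<And>i. 0 \<le> \<Delta> i"
    and xs: "xs \<in> steps N" "0 < g" "passage g (take u xs)" "u \<le> N" and s: "g + 1 \<le> s"
  shows "cost \<Delta> g xs + cost \<Delta> (s - g - 1) (drop u xs) \<le> cost \<Delta> s xs"
proof -
  let ?t = "s - g - 1" and ?ys = "drop u xs"
  have len: "length xs = N" using xs by (simp add: steps_def)
  have before: "lev (pos xs j) < g" if "j < u" for j
    using that xs len by (auto simp: passage_def pos_take min_absorb2)
  have at: "g \<le> lev (pos xs u)" "lev (pos xs u) \<le> g + 1"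
    using xs len lev_passage_le by (auto simp: passage_def pos_take min_absorb2)
  have lt_u: "k < u" if "alive g xs k" for k
    using that at by (force simp: alive_def not_less[symmetric])
  have alive_g: "alive s xs k" if "alive g xs k" for k
    using that s by (force simp: alive_def)
  have alive_t: "alive s xs (u + k)" if "alive ?t ?ys k" for k
    unfolding alive_def
  proof (intro allI impI)
    fix j assume j: "j \<le> u + k"
    show "lev (pos xs j) < s"
    proof (cases "j < u")
      case True
      then show ?thesis using before[of j] s by simp
    next
      case False
      then have "lev (pos xs j) = lev (pos xs u) + lev (pos ?ys (j - u))"
        using pos_add[of xs u "j - u"] by (simp add: lev_add)
      moreover have "lev (pos ?ys (j - u)) < ?t" using that j False by (auto simp: alive_def)
      ultimately show ?thesis using at by simp
    qed
  qed
  have sub1: "fresh g xs \<subseteq> fresh s xs" by (auto simp: fresh_def alive_g)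
  have sub2: "(+) u ` fresh ?t ?ys \<subseteq> fresh s xs"
  proof
    fix i assume "i \<in> (+) u ` fresh ?t ?ys"
    then obtain k where i: "i = u + k" and k: "k \<in> fresh ?t ?ys" by auto
    have "pos xs j \<noteq> pos xs (u + k)" if "j < u + k" for j
    proof (cases "j < u")
      case True
      have "lev (pos xs j) < lev (pos xs (u + k))"
        using before[OF True] at k by (simp add: pos_add[of xs u k] lev_add fresh_def)
      then show ?thesis by auto
    next
      case False
      then show ?thesis using k that pos_add[of xs u "j - u"] by (auto simp: pos_add[of xs u k] fresh_def)
    qed
    then show "i \<in> fresh s xs"
      using k xs at unfolding i by (auto simp: fresh_def alive_t len pos_add[of xs u k] lev_add)
  qed
  have disj: "fresh g xs \<inter> (+) u ` fresh ?t ?ys = {}"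
    using lt_u by (force simp: fresh_def)
  have "cost \<Delta> g xs \<le> (\<Sum>k\<in>fresh g xs. psi \<Delta> (local_time s xs k))"
    unfolding cost_def local_time_def
    by (intro sum_mono psi_mono \<Delta> card_mono) (auto simp: alive_g)
  moreover have "cost \<Delta> ?t ?ys \<le> (\<Sum>k\<in>(+) u ` fresh ?t ?ys. psi \<Delta> (local_time s xs k))"
  proof -
    have "local_time ?t ?ys k \<le> local_time s xs (u + k)" for k
    proof -
      have "local_time ?t ?ys k = card ((+) u ` {i. k \<le> i \<and> i < length ?ys \<and> alive ?t ?ys i \<and> pos ?ys i = pos ?ys k})"
        unfolding local_time_def by (simp add: card_image)
      also have "\<dots> \<le> local_time s xs (u + k)"
        unfolding local_time_def using alive_t
        by (intro card_mono) (auto simp: pos_add)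
      finally show ?thesis .
    qed
    then have "cost \<Delta> ?t ?ys \<le> (\<Sum>k\<in>fresh ?t ?ys. psi \<Delta> (local_time s xs (u + k)))"
      unfolding cost_def by (intro sum_mono psi_mono \<Delta>)
    then show ?thesis by (simp add: sum.reindex)
  qed
  ultimately have "cost \<Delta> g xs + cost \<Delta> ?t ?ys \<le>
      (\<Sum>k\<in>fresh g xs \<union> (+) u ` fresh ?t ?ys. psi \<Delta> (local_time s xs k))"
    using disj by (subst sum.union_disjoint) auto
  also have "\<dots> \<le> cost \<Delta> s xs"
    unfolding cost_def using sub1 sub2 by (intro sum_mono2 psi_nonneg \<Delta>) auto
  finally show ?thesis .
qed

lemma weight_nonneg: "0 \<le> weight \<Delta> s N"
  unfolding weight_def by (intro mean_nonneg) auto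

lemma weight_antimono:
  assumes "\<And>i. 0 \<le> \<Delta> i" "M \<le> N"
  shows "weight \<Delta> s N \<le> weight \<Delta> s M"
proof -
  have "weight \<Delta> s N \<le> mean N (\<lambda>xs. exp (- cost \<Delta> s (take M xs)))"
    unfolding weight_def using assms by (intro mean_mono) (auto intro: cost_take_le)
  also have "\<dots> = weight \<Delta> s M" unfolding weight_def using assms by (intro mean_take)
  finally show ?thesis .
qed

text \<open>
  The strong Markov property at the first passage to \<open>g\<close>, which happens within \<open>N\<close> steps up to an
  error that vanishes as \<open>N\<close> grows.
\<close>

lemma weight_recursion:
  assumes \<Delta>: "\<And>i. 0 \<le> \<Delta> i" and g: "0 < g" "g + 1 \<le> s"
  shows "weight \<Delta> s (N + M) \<le> mean N (\<lambda>xs. of_bool (\<not> reaches g 0 xs)) + weight \<Delta> g N * weight \<Delta> (s - g - 1) M"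
proof -
  let ?t = "s - g - 1"
  define F where "F us = of_bool (passage g us) * exp (- cost \<Delta> g us)" for us
  have "weight \<Delta> s (N + M) \<le> mean (N + M) (\<lambda>xs. of_bool (\<not> reaches g 0 (take N xs)) +
      (\<Sum>u\<le>N. F (take u xs) * exp (- cost \<Delta> ?t (take M (drop u xs)))))"
    unfolding weight_def
  proof (rule mean_mono)
    fix xs assume xs: "xs \<in> steps (N + M)"
    show "exp (- cost \<Delta> s xs) \<le> of_bool (\<not> reaches g 0 (take N xs)) +
      (\<Sum>u\<le>N. F (take u xs) * exp (- cost \<Delta> ?t (take M (drop u xs))))"
    proof (cases "reaches g 0 (take N xs)")
      case False
      moreover have "exp (- cost \<Delta> s xs) \<le> 1" using cost_nonneg[of \<Delta> s xs] \<Delta> by simp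
      moreover have "0 \<le> (\<Sum>u\<le>N. F (take u xs) * exp (- cost \<Delta> ?t (take M (drop u xs))))"
        by (intro sum_nonneg) (auto simp: F_def)
      moreover have "of_bool (\<not> reaches g 0 (take N xs)) = (1::real)" using False by simp
      ultimately show ?thesis by linarith
    next
      case True
      then obtain u where u: "u \<le> N" "passage g (take u xs)"
        using xs by (auto simp: reaches_iff_passage steps_def min_def split: if_splits)
      have "cost \<Delta> g (take u xs) + cost \<Delta> ?t (take M (drop u xs)) \<le> cost \<Delta> g xs + cost \<Delta> ?t (drop u xs)"
        by (intro add_mono cost_take_le \<Delta>)
      also have "\<dots> \<le> cost \<Delta> s xs"
        using u by (intro cost_split[OF \<Delta> xs]) (use g in auto)
      finally have "exp (- cost \<Delta> s xs) \<le> F (take u xs) * exp (- cost \<Delta> ?t (take M (drop u xs)))"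
        using u by (simp add: F_def flip: exp_add)
      also have "\<dots> \<le> (\<Sum>u\<le>N. F (take u xs) * exp (- cost \<Delta> ?t (take M (drop u xs))))"
        using u by (intro member_le_sum[of u "{..N}" "\<lambda>u. F (take u xs) * exp (- cost \<Delta> ?t (take M (drop u xs)))"]) (auto simp: F_def)
      finally show ?thesis using True by simp
    qed
  qed
  also have "\<dots> = mean N (\<lambda>xs. of_bool (\<not> reaches g 0 xs)) + (\<Sum>u\<le>N. mean u F * weight \<Delta> ?t M)"
    unfolding mean_add mean_sum weight_def
    by (intro arg_cong2[of _ _ _ _ "(+)"] sum.cong refl mean_take mean_take_drop) auto
  also have "(\<Sum>u\<le>N. mean u F * weight \<Delta> ?t M) = mean N (\<lambda>xs. \<Sum>u\<le>N. F (take u xs)) * weight \<Delta> ?t M"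
    unfolding mean_sum sum_distrib_right by (intro sum.cong refl) (simp add: mean_take)
  also have "mean N (\<lambda>xs. \<Sum>u\<le>N. F (take u xs)) \<le> weight \<Delta> g N"
    unfolding weight_def
  proof (rule mean_mono)
    fix xs assume xs: "xs \<in> steps N"
    have "(\<Sum>u\<le>N. F (take u xs)) = (\<Sum>u\<le>N. of_bool (passage g (take u xs))) * exp (- cost \<Delta> g xs)"
      unfolding sum_distrib_right
      using xs cost_passage[OF \<Delta>, where xs = xs and g = g]
      by (intro sum.cong refl) (auto simp: F_def steps_def)
    also have "(\<Sum>u\<le>N. of_bool (passage g (take u xs))) \<le> (of_bool (\<exists>u\<in>{..N}. passage g (take u xs)) :: real)"
      using xs by (intro sum_of_bool_le_1) (auto simp: steps_def intro: passage_unique)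
    also have "\<dots> \<le> 1" by simp
    finally show "(\<Sum>u\<le>N. F (take u xs)) \<le> exp (- cost \<Delta> g xs)" by simp
  qed
  finally show ?thesis by (simp add: mult_right_mono weight_nonneg)
qed

text \<open>
  The number of steps in a stage has no bound that holds for all paths, so the bound \<open>A ^ k\<close> is only
  approached as the number \<open>N\<close> of steps grows. Each stage is estimated by its first \<open>L\<close> steps alone.
\<close>

lemma weight_iterate:
  assumes \<Delta>: "\<And>i. 0 \<le> \<Delta> i" and g: "0 < g" and A: "weight \<Delta> g L \<le> A"
  shows "real k * (g + 1) \<le> s \<Longrightarrow> 0 < \<eta> \<Longrightarrow> \<exists>N. weight \<Delta> s N \<le> A ^ k + \<eta>"
proof (induction k arbitrary: s \<eta>)
  case 0
  have "weight \<Delta> s 0 \<le> 1" unfolding weight_def using cost_nonneg[of \<Delta>] \<Delta> by simp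
  with 0 show ?case by (intro exI[of _ 0]) simp
next
  case (Suc k)
  have A0: "0 \<le> A" using A weight_nonneg order_trans by blast
  have "real k * (g + 1) \<le> s - g - 1" using Suc.prems by (simp add: algebra_simps)
  moreover have "0 < \<eta> / (2 * (A + 1))" using Suc.prems A0 by simp
  ultimately obtain M where M: "weight \<Delta> (s - g - 1) M \<le> A ^ k + \<eta> / (2 * (A + 1))"
    using Suc.IH by blast
  obtain J where J: "mean J (\<lambda>xs. of_bool (\<not> reaches g 0 xs)) \<le> \<eta> / 2"
    using reaches_eventually[of g "\<eta> / 2"] g Suc.prems by auto
  define N where "N = max J L"
  have "mean N (\<lambda>xs. of_bool (\<not> reaches g 0 xs)) \<le> mean N (\<lambda>xs. of_bool (\<not> reaches g 0 (take J xs)))"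
    by (intro mean_mono) (auto simp: reaches_def pos_take)
  also have "\<dots> = mean J (\<lambda>xs. of_bool (\<not> reaches g 0 xs))"
    by (rule mean_take) (simp add: N_def)
  also note J
  finally have 1: "mean N (\<lambda>xs. of_bool (\<not> reaches g 0 xs)) \<le> \<eta> / 2" .
  have "weight \<Delta> g N \<le> weight \<Delta> g L" by (intro weight_antimono \<Delta>) (simp add: N_def)
  with A have 2: "weight \<Delta> g N \<le> A" by simp
  have "0 \<le> real k * (g + 1)" using g by simp
  then have gs: "g + 1 \<le> s" using Suc.prems by (simp add: algebra_simps)
  have "weight \<Delta> s (N + M) \<le> \<eta> / 2 + A * (A ^ k + \<eta> / (2 * (A + 1)))"
    using weight_recursion[of \<Delta> g s N M, OF \<Delta> g gs] 1 mult_mono[OF 2 M A0 weight_nonneg] by linarith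
  also have "\<dots> = A ^ Suc k + (\<eta> / 2 + \<eta> / 2 * (A / (A + 1)))"
    by (simp add: algebra_simps)
  also have "\<dots> \<le> A ^ Suc k + (\<eta> / 2 + \<eta> / 2 * 1)"
    using A0 Suc.prems by (intro add_mono mult_left_mono order_refl) auto
  finally show ?case by (intro exI[of _ "N + M"]) simp
qed

end

section \<open>The cost of one stage\<close>

lemma window_cost_bounds:
  assumes "\<And>i. 0 \<le> \<Delta> i" "\<And>i. \<Delta> i \<le> \<theta>"
  shows "0 \<le> window_cost \<Delta> K m zs" "window_cost \<Delta> K m zs \<le> real K * \<theta>"
proof -
  have "psi \<Delta> (min K n) \<le> real K * \<theta>" for n
  proof -
    have "psi \<Delta> (min K n) \<le> psi \<Delta> K" using assms by (intro psi_mono) auto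
    also have "\<dots> \<le> real K * \<theta>" by (rule psi_le[OF assms(2)])
    finally show ?thesis .
  qed
  moreover have "0 \<le> real K * \<theta>" using assms(1)[of 0] assms(2)[of 0] by simp
  ultimately show "window_cost \<Delta> K m zs \<le> real K * \<theta>" by (simp add: window_cost_def)
  show "0 \<le> window_cost \<Delta> K m zs" using assms by (simp add: window_cost_def psi_nonneg)
qed

context leveled_walk
begin

lemma lev_pos_lipschitz:
  assumes "xs \<in> steps N" "i + t \<le> N"
  shows "\<bar>lev (pos xs (i + t)) - lev (pos xs i)\<bar> \<le> real t"
  using assms(2)
proof (induction t)
  case (Suc t)
  have "pos xs (i + Suc t) = pos xs (i + t) + xs ! (i + t)"
    using assms(1) Suc.prems by (simp add: pos_def take_Suc_conv_app_nth steps_def)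
  moreover have "\<bar>lev (xs ! (i + t))\<bar> \<le> 1"
    using assms(1) Suc.prems by (intro lev_bounded) (auto simp: steps_def subset_eq)
  ultimately show ?case using Suc by (simp add: lev_add)
qed simp

text \<open>
  As a step changes the level by at most \<open>1\<close>, this event forces the path up to the end of the window
  of \<open>2 * m\<close> steps from time \<open>i\<close> on to stay below \<open>g\<close>, and the middle of the window to have a
  nonnegative level. It is decided by the path up to time \<open>i\<close>, hence independent of the window.
\<close>

definition in_slab :: "real \<Rightarrow> nat \<Rightarrow> nat \<Rightarrow> 'a list \<Rightarrow> real" where
  "in_slab g m i xs = of_bool ((\<forall>j\<le>i. lev (pos xs j) < g - 2 * real m) \<and> real m \<le> lev (pos xs i))"

definition old_site :: "nat \<Rightarrow> nat \<Rightarrow> 'a list \<Rightarrow> real" where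
  "old_site m i xs = of_bool (\<exists>j<i. pos xs j = pos xs (i + m))"

lemma in_slab_bounds: "0 \<le> in_slab g m i xs" "in_slab g m i xs \<le> 1"
  by (auto simp: in_slab_def)

lemma in_slab_take: "i \<le> k \<Longrightarrow> in_slab g m i (take k xs) = in_slab g m i xs"
  by (simp add: in_slab_def pos_take)

lemma sum_in_slab:
  assumes "J \<le> length xs"
  shows "(\<Sum>i<J. in_slab g m i xs) = real (occupation (g - 2 * real m) (real m) 0 (take J xs))"
proof -
  have "(\<Sum>i<J. in_slab g m i xs) = real (card ({..<J} \<inter> {i. (\<forall>j\<le>i. lev (pos xs j) < g - 2 * real m) \<and> real m \<le> lev (pos xs i)}))"
    by (simp add: in_slab_def)
  also have "{..<J} \<inter> {i. (\<forall>j\<le>i. lev (pos xs j) < g - 2 * real m) \<and> real m \<le> lev (pos xs i)}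
    = {i. i < length (take J xs) \<and> (\<forall>j\<le>i. 0 + lev (pos (take J xs) j) < g - 2 * real m) \<and> real m \<le> 0 + lev (pos (take J xs) i)}"
    using assms by (auto simp: pos_take)
  finally show ?thesis by (simp only: occupation_def)
qed

text \<open>
  Every site must be charged at most once, at its first visit. If the middle of a window was visited
  earlier in the window, its local cost is \<open>0\<close>. If it was visited before the window, the correction
  \<open>real K * \<theta>\<close> is at least the local cost. Otherwise the visits within the window are part of the
  local time of a fresh site.
\<close>

lemma cost_ge_windows:
  assumes \<Delta>: "\<And>i. 0 \<le> \<Delta> i" "\<And>i. \<Delta> i \<le> \<theta>" and xs: "xs \<in> steps (J + 2 * m)"
  shows "(\<Sum>i<J. in_slab g m i xs * (window_cost \<Delta> K m (take (2 * m) (drop i xs)) - real K * \<theta> * old_site m i xs))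
    \<le> cost \<Delta> g xs"
proof -
  let ?Y = "\<lambda>i. window_cost \<Delta> K m (take (2 * m) (drop i xs))"
  let ?b = "\<lambda>k. if k \<in> fresh g xs then psi \<Delta> (local_time g xs k) else 0"
  have len: "length xs = J + 2 * m" using xs by (simp add: steps_def)
  have b: "0 \<le> ?b k" for k using psi_nonneg[of \<Delta>] \<Delta> by simp
  have term_le: "in_slab g m i xs * (?Y i - real K * \<theta> * old_site m i xs) \<le> ?b (i + m)" if i: "i < J" for i
  proof -
    have le: "?Y i - real K * \<theta> * old_site m i xs \<le> ?b (i + m)"
      if in': "\<forall>j\<le>i. lev (pos xs j) < g - 2 * real m" "real m \<le> lev (pos xs i)"
    proof -
      let ?zs = "take (2 * m) (drop i xs)"
      have zs: "pos xs (i + t) = pos xs i + pos ?zs t" if "t \<le> 2 * m" for t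
        using that by (simp add: pos_add pos_take)
      \<comment> \<open>The middle is visited earlier in the window, before the window, or not at all.\<close>
      consider "\<not> (\<forall>t<m. pos ?zs t \<noteq> pos ?zs m)" | "\<exists>j<i. pos xs j = pos xs (i + m)"
        | "\<forall>t<m. pos ?zs t \<noteq> pos ?zs m" "\<forall>j<i. pos xs j \<noteq> pos xs (i + m)" by blast
      then show ?thesis
      proof cases
        case 1
        then have "?Y i = 0" unfolding window_cost_def by simp
        moreover have "0 \<le> real K * \<theta> * old_site m i xs"
          using \<Delta>(1)[of 0] \<Delta>(2)[of 0] by (auto simp: old_site_def)
        ultimately show ?thesis using b[of "i + m"] by linarith
      next
        case 2
        then have "old_site m i xs = 1" by (simp add: old_site_def)
        then show ?thesis using b[of "i + m"] window_cost_bounds(2)[of \<Delta> \<theta> K m ?zs] \<Delta> by simp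
      next
        case 3
        have alive: "alive g xs (i + t)" if t: "t \<le> 2 * m" for t
          unfolding alive_def
        proof (intro allI impI)
          fix j assume j: "j \<le> i + t"
          show "lev (pos xs j) < g"
          proof (cases "j \<le> i")
            case True
            then show ?thesis using in'(1) by force
          next
            case False
            then have "\<bar>lev (pos xs (i + (j - i))) - lev (pos xs i)\<bar> \<le> real (j - i)"
              using j t i by (intro lev_pos_lipschitz[OF xs]) auto
            moreover have "lev (pos xs i) < g - 2 * real m" using in'(1) by simp
            moreover have "real (j - i) \<le> 2 * real m" using j t False by linarith
            ultimately show ?thesis using False by simp
          qed
        qed
        have "\<bar>lev (pos xs (i + m)) - lev (pos xs i)\<bar> \<le> real m"
          using i by (intro lev_pos_lipschitz[OF xs]) auto
        then have lev0: "0 \<le> lev (pos xs (i + m))" using in'(2) by linarith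
        have new: "pos xs j \<noteq> pos xs (i + m)" if "j < i + m" for j
        proof (cases "j < i")
          case False
          then show ?thesis using 3(1) that zs[of "j - i"] zs[of m] by auto
        qed (use 3 in auto)
        have fresh: "i + m \<in> fresh g xs"
          using i len alive[of m] lev0 new by (simp add: fresh_def)
        have "card {t. m \<le> t \<and> t \<le> 2 * m \<and> pos ?zs t = pos ?zs m}
            = card ((+) i ` {t. m \<le> t \<and> t \<le> 2 * m \<and> pos ?zs t = pos ?zs m})"
          by (simp add: card_image)
        also have "\<dots> \<le> local_time g xs (i + m)"
          unfolding local_time_def
        proof (intro card_mono subsetI)
          fix k assume "k \<in> (+) i ` {t. m \<le> t \<and> t \<le> 2 * m \<and> pos ?zs t = pos ?zs m}"
          then obtain t where "k = i + t" "m \<le> t" "t \<le> 2 * m" "pos ?zs t = pos ?zs m" by auto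
          then show "k \<in> {k. i + m \<le> k \<and> k < length xs \<and> alive g xs k \<and> pos xs k = pos xs (i + m)}"
            using zs[of t] zs[of m] i len alive[of t] by simp
        qed simp
        finally have "?Y i \<le> psi \<Delta> (local_time g xs (i + m))"
          using \<Delta> 3 unfolding window_cost_def by (auto intro!: psi_mono)
        moreover have "old_site m i xs = 0" using 3 by (simp add: old_site_def)
        ultimately show ?thesis using fresh by simp
      qed
    qed
    show ?thesis
    proof (cases "(\<forall>j\<le>i. lev (pos xs j) < g - 2 * real m) \<and> real m \<le> lev (pos xs i)")
      case True
      then have "in_slab g m i xs = 1" unfolding in_slab_def by (subst of_bool_eq_1_iff)
      then show ?thesis using le True by simp
    next
      case False
      then have "in_slab g m i xs = 0" unfolding in_slab_def by (subst of_bool_eq_0_iff)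
      then show ?thesis using b[of "i + m"] by simp
    qed
  qed
  have "(\<Sum>i<J. in_slab g m i xs * (?Y i - real K * \<theta> * old_site m i xs)) \<le> (\<Sum>i<J. ?b (i + m))"
    by (intro sum_mono term_le) simp
  also have "\<dots> = (\<Sum>k\<in>(\<lambda>i. i + m) ` {..<J}. ?b k)" by (simp add: sum.reindex)
  also have "\<dots> = (\<Sum>k\<in>(\<lambda>i. i + m) ` {..<J} \<inter> fresh g xs. psi \<Delta> (local_time g xs k))"
    by (simp add: sum.inter_restrict)
  also have "\<dots> \<le> cost \<Delta> g xs"
    unfolding cost_def using \<Delta> by (intro sum_mono2 psi_nonneg) auto
  finally show ?thesis .
qed

text \<open>
  A revisit after at least \<open>m + 1\<close> steps is a return of the walk that starts at the earlier visit.
\<close>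

lemma mean_old_site:
  assumes "i < J"
  shows "mean (J + 2 * m) (old_site m i) \<le> (\<Sum>j<i. return_at (i + m - j))"
proof -
  have "mean (J + 2 * m) (old_site m i) \<le>
    mean (J + 2 * m) (\<lambda>xs. \<Sum>j<i. of_bool (sum_list (take (i + m - j) (drop j xs)) = 0))"
  proof (rule mean_mono)
    fix xs assume "xs \<in> steps (J + 2 * m)"
    show "old_site m i xs \<le> (\<Sum>j<i. of_bool (sum_list (take (i + m - j) (drop j xs)) = 0))"
    proof (cases "\<exists>j<i. pos xs j = pos xs (i + m)")
      case True
      then obtain j where j: "j < i" "pos xs j = pos xs (i + m)" by blast
      then have "sum_list (take (i + m - j) (drop j xs)) = 0"
        using pos_add[of xs j "i + m - j"] by (simp add: pos_def[of "drop j xs"])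
      then have "old_site m i xs \<le> of_bool (sum_list (take (i + m - j) (drop j xs)) = 0)"
        by (simp add: old_site_def)
      also have "\<dots> \<le> (\<Sum>j<i. of_bool (sum_list (take (i + m - j) (drop j xs)) = 0))"
        using j by (intro member_le_sum[of j "{..<i}" "\<lambda>j. of_bool (sum_list (take (i + m - j) (drop j xs)) = 0)"]) auto
      finally show ?thesis .
    next
      case False
      then have "old_site m i xs = 0" by (simp add: old_site_def)
      then show ?thesis by (simp only:) (intro sum_nonneg, simp)
    qed
  qed
  also have "\<dots> = (\<Sum>j<i. return_at (i + m - j))"
    unfolding mean_sum
  proof (intro sum.cong refl)
    fix j assume "j \<in> {..<i}"
    then have "j + (i + m - j) \<le> J + 2 * m" using assms by auto
    from mean_take_drop[OF this, of "\<lambda>_. 1" "\<lambda>ys. of_bool (sum_list ys = 0)"]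
    show "mean (J + 2 * m) (\<lambda>xs. of_bool (sum_list (take (i + m - j) (drop j xs)) = 0)) = return_at (i + m - j)"
      by (simp add: return_at_def)
  qed
  finally show ?thesis .
qed

definition fluctuation :: "(nat \<Rightarrow> real) \<Rightarrow> nat \<Rightarrow> real \<Rightarrow> nat \<Rightarrow> nat \<Rightarrow> 'a list \<Rightarrow> real" where
  "fluctuation \<Delta> K g m i xs = in_slab g m i xs *
     (window_cost \<Delta> K m (take (2 * m) (drop i xs)) - mean (2 * m) (window_cost \<Delta> K m))"

text \<open>
  The later window is independent of everything before it, and its local cost is centered.
\<close>

lemma fluctuation_orthogonal:
  assumes "i + 2 * m \<le> k" "k < J"
  shows "mean (J + 2 * m) (\<lambda>xs. fluctuation \<Delta> K g m i xs * fluctuation \<Delta> K g m k xs) = 0"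
proof -
  let ?g = "\<lambda>us. fluctuation \<Delta> K g m i us * in_slab g m k us"
  let ?h = "\<lambda>zs. window_cost \<Delta> K m zs - mean (2 * m) (window_cost \<Delta> K m)"
  have "fluctuation \<Delta> K g m i xs * fluctuation \<Delta> K g m k xs = ?g (take k xs) * ?h (take (2 * m) (drop k xs))" for xs
    using assms by (simp add: fluctuation_def in_slab_take take_drop min_absorb2)
  then have "mean (J + 2 * m) (\<lambda>xs. fluctuation \<Delta> K g m i xs * fluctuation \<Delta> K g m k xs)
      = mean (J + 2 * m) (\<lambda>xs. ?g (take k xs) * ?h (take (2 * m) (drop k xs)))" by simp
  also have "\<dots> = mean k ?g * mean (2 * m) ?h" using assms by (intro mean_take_drop) simp
  also have "mean (2 * m) ?h = 0" by (simp add: mean_diff)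
  finally show ?thesis by simp
qed

lemma abs_fluctuation_le:
  assumes \<Delta>: "\<And>i. 0 \<le> \<Delta> i" "\<And>i. \<Delta> i \<le> \<theta>"
  shows "\<bar>fluctuation \<Delta> K g m i xs\<bar> \<le> real K * \<theta>"
proof -
  note w = window_cost_bounds[of \<Delta> \<theta> K m, OF \<Delta>]
  have "0 \<le> mean (2 * m) (window_cost \<Delta> K m)" "mean (2 * m) (window_cost \<Delta> K m) \<le> real K * \<theta>"
    by (auto intro!: mean_nonneg mean_le_const w)
  then have "\<bar>window_cost \<Delta> K m (take (2 * m) (drop i xs)) - mean (2 * m) (window_cost \<Delta> K m)\<bar> \<le> real K * \<theta>"
    using w[of "take (2 * m) (drop i xs)"] by linarith
  then show ?thesis
    using in_slab_bounds[of g m i xs] mult_mono[of "in_slab g m i xs" 1 _ "real K * \<theta>"]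
    by (auto simp: fluctuation_def abs_mult)
qed

lemma mean_square_fluctuation:
  assumes \<Delta>: "\<And>i. 0 \<le> \<Delta> i" "\<And>i. \<Delta> i \<le> \<theta>"
  shows "mean (J + 2 * m) (\<lambda>xs. (\<Sum>i<J. fluctuation \<Delta> K g m i xs)\<^sup>2) \<le> real J * (4 * real m) * (real K * \<theta>)\<^sup>2"
proof -
  let ?D = "fluctuation \<Delta> K g m"
  have "mean (J + 2 * m) (\<lambda>xs. (\<Sum>i<J. ?D i xs)\<^sup>2) = (\<Sum>i<J. \<Sum>k<J. mean (J + 2 * m) (\<lambda>xs. ?D i xs * ?D k xs))"
    by (simp add: power2_eq_square sum_product mean_sum)
  also have "\<dots> \<le> (\<Sum>i<J. \<Sum>k<J. (real K * \<theta>)\<^sup>2 * of_bool (k < i + 2 * m \<and> i < k + 2 * m))"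
  proof (intro sum_mono)
    fix i k assume ik: "i \<in> {..<J}" "k \<in> {..<J}"
    show "mean (J + 2 * m) (\<lambda>xs. ?D i xs * ?D k xs) \<le> (real K * \<theta>)\<^sup>2 * of_bool (k < i + 2 * m \<and> i < k + 2 * m)"
    proof (cases "k < i + 2 * m \<and> i < k + 2 * m")
      case True
      have "mean (J + 2 * m) (\<lambda>xs. ?D i xs * ?D k xs) \<le> (real K * \<theta>)\<^sup>2"
      proof (rule mean_le_const)
        fix xs
        have "?D i xs * ?D k xs \<le> \<bar>?D i xs\<bar> * \<bar>?D k xs\<bar>" by (simp flip: abs_mult)
        also have "\<dots> \<le> (real K * \<theta>)\<^sup>2"
          unfolding power2_eq_square
          using abs_fluctuation_le[of \<Delta> \<theta> K g m _ xs] \<Delta> by (intro mult_mono) (auto intro: order_trans[OF abs_ge_zero])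
        finally show "?D i xs * ?D k xs \<le> (real K * \<theta>)\<^sup>2" .
      qed
      with True show ?thesis by simp
    next
      case False
      then have "mean (J + 2 * m) (\<lambda>xs. ?D i xs * ?D k xs) = 0"
        using ik fluctuation_orthogonal[of i m k J \<Delta> K g] fluctuation_orthogonal[of k m i J \<Delta> K g]
        by (auto simp: not_less mult.commute)
      then show ?thesis by simp
    qed
  qed
  also have "\<dots> = (\<Sum>i<J. (real K * \<theta>)\<^sup>2 * real (card {k\<in>{..<J}. k < i + 2 * m \<and> i < k + 2 * m}))"
    by (intro sum.cong refl) (simp add: Int_def conj_ac mult_ac)
  also have "\<dots> \<le> (\<Sum>i<J. (real K * \<theta>)\<^sup>2 * (4 * real m))"
  proof (intro sum_mono mult_left_mono)
    fix i
    have "{k\<in>{..<J}. k < i + 2 * m \<and> i < k + 2 * m} \<subseteq> {i - 2 * m..<i + 2 * m}" by auto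
    then have "card {k\<in>{..<J}. k < i + 2 * m \<and> i < k + 2 * m} \<le> card {i - 2 * m..<i + 2 * m}"
      by (intro card_mono) auto
    then have "card {k\<in>{..<J}. k < i + 2 * m \<and> i < k + 2 * m} \<le> 4 * m" by simp
    then have "real (card {k\<in>{..<J}. k < i + 2 * m \<and> i < k + 2 * m}) \<le> real (4 * m)"
      using of_nat_mono by blast
    then show "real (card {k\<in>{..<J}. k < i + 2 * m \<and> i < k + 2 * m}) \<le> 4 * real m" by simp
  qed simp
  also have "\<dots> = real J * (4 * real m) * (real K * \<theta>)\<^sup>2" by simp
  finally show ?thesis .
qed

text \<open>
  If the fluctuations and the corrections are both at most \<open>1\<close>, the cost is at least \<open>c\<close> times the
  occupation time, minus \<open>2\<close>. Otherwise the sum of the squared fluctuation and the correction is at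
  least \<open>1\<close>, hence at least \<open>exp (- cost)\<close>. This pointwise bound replaces the estimates of the
  probabilities of the two bad events.
\<close>

lemma weight_stage_le:
  assumes \<Delta>: "\<And>i. 0 \<le> \<Delta> i" "\<And>i. \<Delta> i \<le> \<theta>"
    and \<tau>: "\<And>i. (\<Sum>j<i. return_at (i + m - j)) \<le> \<tau>"
    and c: "c \<le> mean (2 * m) (window_cost \<Delta> K m)"
  shows "weight \<Delta> g (J + 2 * m) \<le>
    exp 2 * mean J (\<lambda>xs. exp (- c * occupation (g - 2 * real m) (real m) 0 xs))
     + real J * (4 * real m) * (real K * \<theta>)\<^sup>2 + real K * \<theta> * (real J * \<tau>)"
proof -
  let ?y = "mean (2 * m) (window_cost \<Delta> K m)"
  let ?occ = "occupation (g - 2 * real m) (real m) 0"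
  let ?D = "\<lambda>xs. \<Sum>i<J. fluctuation \<Delta> K g m i xs"
  let ?R = "\<lambda>xs. \<Sum>i<J. old_site m i xs"
  have \<theta>: "0 \<le> real K * \<theta>" using \<Delta>(1)[of 0] \<Delta>(2)[of 0] by simp
  have "weight \<Delta> g (J + 2 * m) \<le> mean (J + 2 * m) (\<lambda>xs. exp 2 * exp (- c * ?occ (take J xs)) + (?D xs)\<^sup>2 + real K * \<theta> * ?R xs)"
    unfolding weight_def
  proof (rule mean_mono)
    fix xs assume xs: "xs \<in> steps (J + 2 * m)"
    define r where "r = real K * \<theta> * ?R xs"
    have r0: "0 \<le> r" unfolding r_def by (intro mult_nonneg_nonneg[OF \<theta>] sum_nonneg) (simp add: old_site_def)
    have "c * ?occ (take J xs) + ?D xs - r \<le> ?y * (\<Sum>i<J. in_slab g m i xs) + ?D xs - r"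
      using c sum_in_slab[of J xs g m] xs by (simp add: steps_def mult_right_mono)
    also have "\<dots> = (\<Sum>i<J. in_slab g m i xs * window_cost \<Delta> K m (take (2 * m) (drop i xs)) - real K * \<theta> * old_site m i xs)"
      unfolding r_def fluctuation_def sum_distrib_left by (simp add: algebra_simps sum_subtractf sum.distrib)
    also have "\<dots> \<le> (\<Sum>i<J. in_slab g m i xs * (window_cost \<Delta> K m (take (2 * m) (drop i xs)) - real K * \<theta> * old_site m i xs))"
    proof (rule sum_mono)
      fix i
      have "in_slab g m i xs * (real K * \<theta> * old_site m i xs) \<le> 1 * (real K * \<theta> * old_site m i xs)"
        using \<theta> by (intro mult_right_mono in_slab_bounds) (auto simp: old_site_def)
      then show "in_slab g m i xs * window_cost \<Delta> K m (take (2 * m) (drop i xs)) - real K * \<theta> * old_site m i xs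
         \<le> in_slab g m i xs * (window_cost \<Delta> K m (take (2 * m) (drop i xs)) - real K * \<theta> * old_site m i xs)"
        by (simp add: algebra_simps)
    qed
    also have "\<dots> \<le> cost \<Delta> g xs" by (rule cost_ge_windows[OF \<Delta> xs])
    finally have le: "c * ?occ (take J xs) + ?D xs - r \<le> cost \<Delta> g xs" .
    show "exp (- cost \<Delta> g xs) \<le> exp 2 * exp (- c * ?occ (take J xs)) + (?D xs)\<^sup>2 + real K * \<theta> * ?R xs"
    proof (cases "\<bar>?D xs\<bar> \<le> 1 \<and> r \<le> 1")
      case True
      then have "- cost \<Delta> g xs \<le> 2 + - c * ?occ (take J xs)" using le by linarith
      then have "exp (- cost \<Delta> g xs) \<le> exp 2 * exp (- c * ?occ (take J xs))" by (simp flip: exp_add)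
      with r0 show ?thesis unfolding r_def by (simp add: add_increasing2)
    next
      case False
      then have "1 \<le> (?D xs)\<^sup>2 + r"
      proof (cases "\<bar>?D xs\<bar> \<le> 1")
        case False
        then have "1 \<le> (?D xs)\<^sup>2" using abs_le_square_iff[of 1 "?D xs"] by simp
        with r0 show ?thesis by simp
      next
        case True
        with False have "1 \<le> r" by simp
        then show ?thesis using zero_le_power2[of "?D xs"] by linarith
      qed
      moreover have "exp (- cost \<Delta> g xs) \<le> 1 + 0" using cost_nonneg[of \<Delta> g xs] \<Delta> by simp
      moreover have "0 \<le> exp 2 * exp (- c * ?occ (take J xs))" by simp
      ultimately show ?thesis unfolding r_def by linarith
    qed
  qed
  also have "\<dots> = exp 2 * mean J (\<lambda>xs. exp (- c * ?occ xs)) + mean (J + 2 * m) (\<lambda>xs. (?D xs)\<^sup>2)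
      + real K * \<theta> * (\<Sum>i<J. mean (J + 2 * m) (old_site m i))"
    using mean_take[of J "J + 2 * m" "\<lambda>xs. exp (- c * ?occ xs)"]
    by (simp only: mean_add mean_cmult mean_sum)
  also have "\<dots> \<le> exp 2 * mean J (\<lambda>xs. exp (- c * ?occ xs)) + real J * (4 * real m) * (real K * \<theta>)\<^sup>2
      + real K * \<theta> * (\<Sum>i<J. \<tau>)"
  proof (intro add_mono order_refl mean_square_fluctuation \<Delta> mult_left_mono \<theta> sum_mono)
    fix i assume "i \<in> {..<J}"
    then have "i < J" by simp
    from order_trans[OF mean_old_site[OF this] \<tau>] show "mean (J + 2 * m) (old_site m i) \<le> \<tau>" .
  qed
  finally show ?thesis by simp
qed

end

section \<open>The killing rate and the choice of the scales\<close>

context finite_walk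
begin

text \<open>
  By summation by parts this is \<open>escape\<close> times the mean of \<open>psi \<Delta>\<close> under the geometric law with
  parameter \<open>escape\<close>: a new site is met with probability \<open>escape\<close>, and visit number \<open>k + 1\<close> takes
  place with probability \<open>(1 - escape) ^ k\<close>.
\<close>

definition killing_rate :: "(nat \<Rightarrow> real) \<Rightarrow> real" where
  "killing_rate \<Delta> = escape * (\<Sum>k. \<Delta> k * (1 - escape) ^ k)"

lemma summable_killing:
  assumes "escape > 0" "\<And>i. 0 \<le> \<Delta> i" "decseq \<Delta>"
  shows "summable (\<lambda>k. \<Delta> k * (1 - escape) ^ k)"
proof (rule summable_comparison_test')
  show "summable (\<lambda>k. \<Delta> 0 * (1 - escape) ^ k)"
    using assms escape_bounds by (intro summable_mult summable_geometric) auto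
  show "norm (\<Delta> k * (1 - escape) ^ k) \<le> \<Delta> 0 * (1 - escape) ^ k" for k
    using assms escape_bounds by (auto simp: abs_mult decseq_def intro!: mult_right_mono)
qed

lemma killing_rate_ge:
  assumes "escape > 0" "\<And>i. 0 \<le> \<Delta> i" "decseq \<Delta>"
  shows "escape * \<Delta> 0 \<le> killing_rate \<Delta>"
proof -
  have "(\<Sum>k<1. \<Delta> k * (1 - escape) ^ k) \<le> (\<Sum>k. \<Delta> k * (1 - escape) ^ k)"
    using assms escape_bounds by (intro sum_le_suminf summable_killing) auto
  then show ?thesis using assms by (simp add: killing_rate_def)
qed

text \<open>
  Everything that is cut off is at most \<open>\<eta> * escape * \<Delta> 0\<close>, and this is comparable to the rate
  itself. So \<open>K\<close> and \<open>s\<close> do not depend on \<open>\<Delta>\<close>, that is, on \<open>\<beta>\<close>.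
\<close>

lemma truncated_killing_rate:
  assumes "escape > 0" "\<eta> > 0"
  shows "\<exists>K s. \<forall>\<Delta>. (\<forall>i. 0 \<le> \<Delta> i) \<longrightarrow> decseq \<Delta> \<longrightarrow>
     (1 - \<eta>) * killing_rate \<Delta> \<le> escape * (\<Sum>k<K. \<Delta> k * (1 - escape_upto s) ^ k)"
proof -
  define r where "r = 1 - escape"
  have r: "0 \<le> r" "r < 1" using assms escape_bounds by (auto simp: r_def)
  obtain K where K: "r ^ K < escape * (\<eta> / 2)"
    using real_arch_pow_inv[of "escape * (\<eta> / 2)" r] r assms by auto
  have "(\<lambda>s. \<Sum>k<K. r ^ k - (1 - escape_upto s) ^ k) \<longlonglongrightarrow> (\<Sum>k<K. r ^ k - (1 - escape) ^ k)"
    by (intro tendsto_intros tendsto_escape)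
  then have "(\<lambda>s. \<Sum>k<K. r ^ k - (1 - escape_upto s) ^ k) \<longlonglongrightarrow> 0" by (simp add: r_def)
  then have "eventually (\<lambda>s. (\<Sum>k<K. r ^ k - (1 - escape_upto s) ^ k) < \<eta> / 2) sequentially"
    using assms by (intro order_tendstoD) auto
  then obtain s where s: "(\<Sum>k<K. r ^ k - (1 - escape_upto s) ^ k) < \<eta> / 2"
    by (auto simp: eventually_sequentially)
  show ?thesis
  proof (rule exI[of _ K], rule exI[of _ s], intro allI impI)
    fix \<Delta> :: "nat \<Rightarrow> real" assume \<Delta>0: "\<forall>i. 0 \<le> \<Delta> i" and dec: "decseq \<Delta>"
    then have \<Delta>: "0 \<le> \<Delta> i" for i by auto
    have le0: "\<Delta> k \<le> \<Delta> 0" for k using dec by (auto simp: decseq_def)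
    have sm: "summable (\<lambda>k. \<Delta> k * r ^ k)" unfolding r_def by (intro summable_killing assms \<Delta> dec)
    have rs: "(1 - escape_upto s) ^ k \<le> r ^ k" for k
      unfolding r_def using escape_le[of s] escape_upto_bounds[of s] by (intro power_mono) auto
    have "(\<Sum>k. \<Delta> (k + K) * r ^ (k + K)) \<le> (\<Sum>k. \<Delta> 0 * r ^ K * r ^ k)"
    proof (rule suminf_le)
      show "\<Delta> (k + K) * r ^ (k + K) \<le> \<Delta> 0 * r ^ K * r ^ k" for k
        using mult_right_mono[OF le0[of "k + K"], of "r ^ (k + K)"] r by (simp add: power_add mult_ac)
      show "summable (\<lambda>k. \<Delta> (k + K) * r ^ (k + K))" using sm by (subst summable_iff_shift)
      show "summable (\<lambda>k. \<Delta> 0 * r ^ K * r ^ k)" using r by (intro summable_mult summable_geometric) auto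
    qed
    also have "\<dots> = \<Delta> 0 * (r ^ K / escape)"
      using r by (subst suminf_mult) (auto simp: suminf_geometric r_def)
    also have "\<dots> \<le> \<Delta> 0 * (\<eta> / 2)"
      using K assms \<Delta>[of 0] by (intro mult_left_mono) (auto simp: field_simps)
    finally have tail: "(\<Sum>k. \<Delta> (k + K) * r ^ (k + K)) \<le> \<Delta> 0 * (\<eta> / 2)" .
    have "(\<Sum>k<K. \<Delta> k * r ^ k) - (\<Sum>k<K. \<Delta> k * (1 - escape_upto s) ^ k)
        = (\<Sum>k<K. \<Delta> k * (r ^ k - (1 - escape_upto s) ^ k))"
      by (simp add: sum_subtractf algebra_simps)
    also have "\<dots> \<le> (\<Sum>k<K. \<Delta> 0 * (r ^ k - (1 - escape_upto s) ^ k))"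
      using le0 rs by (intro sum_mono mult_right_mono) auto
    also have "\<dots> \<le> \<Delta> 0 * (\<eta> / 2)"
      unfolding sum_distrib_left[symmetric] using s \<Delta> by (intro mult_left_mono) auto
    finally have head: "(\<Sum>k<K. \<Delta> k * r ^ k) \<le> (\<Sum>k<K. \<Delta> k * (1 - escape_upto s) ^ k) + \<Delta> 0 * (\<eta> / 2)" by simp
    have "(\<Sum>k. \<Delta> k * r ^ k) = (\<Sum>k. \<Delta> (k + K) * r ^ (k + K)) + (\<Sum>k<K. \<Delta> k * r ^ k)"
      by (rule suminf_split_initial_segment[OF sm])
    then have "(\<Sum>k. \<Delta> k * r ^ k) \<le> (\<Sum>k<K. \<Delta> k * (1 - escape_upto s) ^ k) + \<Delta> 0 * \<eta>"
      using head tail by (simp add: algebra_simps)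
    then have "killing_rate \<Delta> \<le> escape * ((\<Sum>k<K. \<Delta> k * (1 - escape_upto s) ^ k) + \<Delta> 0 * \<eta>)"
      unfolding killing_rate_def r_def[symmetric] using assms by (intro mult_left_mono) auto
    moreover have "\<eta> * (escape * \<Delta> 0) \<le> \<eta> * killing_rate \<Delta>"
      using assms by (intro mult_left_mono killing_rate_ge \<Delta> dec) auto
    ultimately show "(1 - \<eta>) * killing_rate \<Delta> \<le> escape * (\<Sum>k<K. \<Delta> k * (1 - escape_upto s) ^ k)"
      by (simp add: algebra_simps)
  qed
qed

text \<open>
  The tail of the Green function at the starting point, which is finite by the last-exit
  decomposition.
\<close>

lemma return_tail:
  assumes "escape > 0" "\<tau> > 0"
  shows "\<exists>m0. \<forall>m\<ge>m0. \<forall>i. (\<Sum>j<i. return_at (i + m - j)) \<le> \<tau>"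
proof -
  note sm = summable_return_at[OF assms(1)]
  obtain m0 where m0: "\<And>n. n \<ge> m0 \<Longrightarrow> norm (\<Sum>l. return_at (l + n)) < \<tau>"
    using suminf_exist_split[OF assms(2) sm] by auto
  show ?thesis
  proof (intro exI[of _ m0] allI impI)
    fix m i assume m: "m0 \<le> m"
    have "(\<Sum>j<i. return_at (i + m - j)) = (\<Sum>j<i. return_at (Suc (i - Suc j) + m))"
      by (intro sum.cong refl arg_cong[of _ _ return_at]) auto
    also have "\<dots> = (\<Sum>l<i. return_at (l + Suc m))"
      using sum.nat_diff_reindex[of "\<lambda>l. return_at (Suc l + m)" i] by simp
    also have "\<dots> \<le> (\<Sum>l. return_at (l + Suc m))"
      using sm by (intro sum_le_suminf return_at_nonneg) (auto simp: summable_iff_shift simp del: add_Suc_right)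
    also have "\<dots> \<le> \<tau>" using m0[of "Suc m"] m by simp
    finally show "(\<Sum>j<i. return_at (i + m - j)) \<le> \<tau>" .
  qed
qed

end

lemma inverse_cosh_le: "1 / cosh y \<le> 2 * exp (- y)" for y :: real
proof -
  have "exp y \<le> 2 * cosh y" by (simp add: cosh_field_def)
  moreover have "0 < cosh y" using cosh_real_ge_1[of y] by linarith
  ultimately show ?thesis by (simp add: exp_minus field_simps)
qed

context leveled_walk
begin

text \<open>
  The constants are chosen in this order: the truncation \<open>K\<close>, \<open>s\<close> of the local cost; the length \<open>h\<close>
  of a stage in units of \<open>1 / sqrt I\<close>, which makes \<open>2 * exp 2 / cosh\<close> small; the duration \<open>M\<close> in
  units of \<open>1 / I\<close>, within which the stage ends with high probability; the window \<open>m\<close>, which makes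
  long returns rare even compared with \<open>1 / M\<close>; and at last the bound \<open>I0\<close> on the killing rate. In
  the statement, the gain \<open>g\<close> of a stage is increased by \<open>1\<close>, the largest possible overshoot.
\<close>

lemma stage_bound:
  assumes q: "escape > 0" and \<epsilon>: "0 < \<epsilon>" "\<epsilon> < 1"
  shows "\<exists>h>0. \<exists>I0>0. \<forall>\<Delta>. (\<forall>i. 0 \<le> \<Delta> i) \<longrightarrow> decseq \<Delta> \<longrightarrow> 0 < killing_rate \<Delta> \<longrightarrow> killing_rate \<Delta> \<le> I0 \<longrightarrow>
    (\<exists>L. weight \<Delta> (h / sqrt (killing_rate \<Delta>)) L
       \<le> exp (- (1 - \<epsilon>) * sqrt (2 * killing_rate \<Delta> / v) * (h / sqrt (killing_rate \<Delta>) + 1)))"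
proof -
  define D where "D = sqrt (2 / v)"
  have D: "0 < D" "D\<^sup>2 * v = 2" using variance_pos by (auto simp: D_def)
  define \<eta> where "\<eta> = \<epsilon> / 4"
  have \<eta>: "0 < \<eta>" "\<eta> < 1" using \<epsilon> by (auto simp: \<eta>_def)
  obtain K s where Ks: "\<And>\<Delta>. \<forall>i. 0 \<le> \<Delta> i \<Longrightarrow> decseq \<Delta> \<Longrightarrow>
     (1 - \<eta>) * killing_rate \<Delta> \<le> escape * (\<Sum>k<K. \<Delta> k * (1 - escape_upto s) ^ k)"
    using truncated_killing_rate[OF q \<eta>(1)] by blast
  \<comment> \<open>The gain \<open>\<epsilon> / 2 * D * h\<close> in the exponent pays for the factor \<open>exp 2\<close>, for a factor \<open>exp 3\<close> and
  for the overshoot.\<close>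
  define h where "h = 2 * (5 + D) / (\<epsilon> * D)"
  have h: "0 < h" "\<epsilon> / 2 * D * h = 5 + D" using D \<epsilon> by (auto simp: h_def)
  \<comment> \<open>The target, which does not depend on \<open>I\<close>. The five error terms below sum up to at most \<open>\<rho>\<close>.\<close>
  define \<rho> where "\<rho> = exp (- (1 - \<epsilon>) * D * (h + 1))"
  have \<rho>: "0 < \<rho>" by (simp add: \<rho>_def)
  \<comment> \<open>The parameter of the exponential submartingale in units of \<open>sqrt I\<close>.\<close>
  define a where "a = \<rho> / (8 * exp 2 * (h + 1))"
  have a: "0 < a" using \<rho> h by (simp add: a_def)
  define M where "M = 16 * exp 2 / (a\<^sup>2 * v * \<rho>)"
  have M: "0 < M" using a variance_pos \<rho> by (simp add: M_def)
  define \<tau> where "\<tau> = \<rho> * escape / (4 * (real K + 1) * (M + 1))"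
  have \<tau>: "0 < \<tau>" using \<rho> q M by (simp add: \<tau>_def)
  obtain m0 where m0: "\<And>m i. m \<ge> m0 \<Longrightarrow> (\<Sum>j<i. return_at (i + m - j)) \<le> \<tau>"
    using return_tail[OF q \<tau>] by blast
  define m where "m = max m0 (K * s)"
  define W where "W = min 1 (min (ln (1 / (1 - \<eta>)) / D) (\<eta> * h / (3 * real m + 1)))"
  have W: "0 < W" unfolding W_def using \<eta> D h by (auto intro!: divide_pos_pos ln_gt_zero)
  \<comment> \<open>\<open>W\<close> bounds \<open>sqrt I\<close>, so that the discretisation and the width \<open>m\<close> of the windows are
  negligible; the other term controls the variance.\<close>
  define I0 where "I0 = min (W\<^sup>2) (\<rho> * escape\<^sup>2 / (16 * (real m + 1) * (real K + 1)\<^sup>2 * (M + 1)))"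
  have I0: "0 < I0" unfolding I0_def using W \<rho> q M by (auto intro!: divide_pos_pos mult_pos_pos)
  show ?thesis
  proof (rule exI[of _ h], rule conjI[OF h(1)], rule exI[of _ I0], rule conjI[OF I0], intro allI impI)
    fix \<Delta> :: "nat \<Rightarrow> real"
    assume \<Delta>0: "\<forall>i. 0 \<le> \<Delta> i" and dec: "decseq \<Delta>" and pos: "0 < killing_rate \<Delta>" and small: "killing_rate \<Delta> \<le> I0"
    define I where "I = killing_rate \<Delta>"
    define w where "w = sqrt I"
    have I: "0 < I" "I \<le> I0" using pos small by (auto simp: I_def)
    have w: "0 < w" "w\<^sup>2 = I" using I by (auto simp: w_def)
    have "w \<le> W" unfolding w_def using I W by (intro real_le_lsqrt) (auto simp: I0_def)
    then have w1: "w \<le> 1" and w2: "w \<le> ln (1 / (1 - \<eta>)) / D" and w3: "w \<le> \<eta> * h / (3 * real m + 1)"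
      by (auto simp: W_def)
    have I1: "I \<le> 1" using w w1 by (metis less_imp_le one_power2 power_mono)
    have \<Delta>: "\<And>i. 0 \<le> \<Delta> i" "\<And>i. \<Delta> i \<le> \<Delta> 0" using \<Delta>0 dec by (auto simp: decseq_def)
    define \<theta> where "\<theta> = \<Delta> 0"
    have \<theta>: "0 \<le> \<theta>" "\<theta> \<le> I / escape"
      using \<Delta> killing_rate_ge[OF q \<Delta>(1) dec] q by (auto simp: \<theta>_def I_def field_simps)
    define J where "J = nat \<lceil>M / I\<rceil>"
    have J: "M / I \<le> real J" "real J \<le> (M + 1) / I"
    proof -
      have "0 < M / I" using M I by simp
      then show "M / I \<le> real J" unfolding J_def by linarith
      have "real J \<le> M / I + 1" unfolding J_def using \<open>0 < M / I\<close> by linarith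
      also have "\<dots> \<le> (M + 1) / I" using I I1 by (simp add: field_simps)
      finally show "real J \<le> (M + 1) / I" .
    qed
    define G where "G = h / w"
    have Gw: "G * w = h" using w by (simp add: G_def)
    define c where "c = (1 - \<eta>) * I"
    \<comment> \<open>Slightly less than the optimal \<open>sqrt (2 * c / v)\<close>, which leaves room for the factor \<open>exp \<kappa>\<close>.\<close>
    define \<kappa> where "\<kappa> = (1 - \<eta>) * D * w"
    have \<kappa>0: "0 \<le> \<kappa>" using \<eta> D w by (simp add: \<kappa>_def)
    have c: "c \<le> mean (2 * m) (window_cost \<Delta> K m)"
    proof -
      have "c \<le> escape * (\<Sum>k<K. \<Delta> k * (1 - escape_upto s) ^ k)"
        unfolding c_def I_def by (rule Ks[OF \<Delta>0 dec])
      also have "\<dots> \<le> mean (2 * m) (window_cost \<Delta> K m)"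
        by (rule mean_window_cost[OF \<Delta>(1)]) (simp add: m_def)
      finally show ?thesis .
    qed
    have stage: "weight \<Delta> G (J + 2 * m) \<le>
      exp 2 * mean J (\<lambda>xs. exp (- c * occupation (G - 2 * real m) (real m) 0 xs))
       + real J * (4 * real m) * (real K * \<theta>)\<^sup>2 + real K * \<theta> * (real J * \<tau>)"
      by (rule weight_stage_le[OF \<Delta>(1) _ _ c]) (auto simp: \<theta>_def \<Delta> m0 m_def)

    have exp\<kappa>: "exp \<kappa> \<le> 1 / (1 - \<eta>)"
    proof -
      have "\<kappa> \<le> D * w" unfolding \<kappa>_def using \<eta> D w by (simp add: mult_le_cancel_right1)
      also have "\<dots> \<le> ln (1 / (1 - \<eta>))" using w2 D by (simp add: field_simps)
      finally show ?thesis using \<eta> by (subst (asm) ln_ge_iff) auto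
    qed
    have key: "1 + \<kappa>\<^sup>2 * v / 2 * exp \<kappa> \<le> exp c"
    proof -
      have "\<kappa>\<^sup>2 * v / 2 = (1 - \<eta>)\<^sup>2 * I * (D\<^sup>2 * v) / 2"
        by (simp add: \<kappa>_def power_mult_distrib w mult_ac)
      also have "\<dots> = (1 - \<eta>)\<^sup>2 * I" using D by simp
      finally have "\<kappa>\<^sup>2 * v / 2 * exp \<kappa> \<le> (1 - \<eta>)\<^sup>2 * I * (1 / (1 - \<eta>))"
        using exp\<kappa> I by (simp only:) (intro mult_left_mono, auto)
      also have "\<dots> = c" using \<eta> by (simp add: c_def power2_eq_square)
      finally show ?thesis using exp_ge_add_one_self[of c] by linarith
    qed
    have mw: "(3 * real m + 1) * w \<le> \<eta> * h" using w3 by (simp add: field_simps)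
    have mG: "3 * real m + 1 \<le> \<eta> * G" using mw w by (simp add: G_def field_simps)
    have G0: "0 < G" using h w by (simp add: G_def)
    have "\<eta> * G \<le> 1 * G" using \<eta> G0 by (intro mult_right_mono) auto
    with mG have mG': "real m + 1 \<le> G - 2 * real m" by linarith
    have hit: "mean J (\<lambda>xs. exp (- c * occupation (G - 2 * real m) (real m) 0 xs)) \<le>
      1 / cosh (\<kappa> * (G - 2 * real m - real m - 1)) +
       (1 - exp (- (a * w) * (G - 2 * real m + 1)) + (1 / (1 + (a * w)\<^sup>2 * v / 2)) ^ J)"
      using \<kappa>0 key mG' a w by (intro discounted_occupation) auto
    have t1: "exp 2 * (1 / cosh (\<kappa> * (G - 2 * real m - real m - 1))) \<le> \<rho> / 4"
    proof -
      have "(1 - \<epsilon> / 2) * (D * h) \<le> (1 - \<eta>)\<^sup>2 * (D * h)"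
        using D h by (intro mult_right_mono) (auto simp: \<eta>_def power2_eq_square algebra_simps)
      also have "\<dots> = (1 - \<eta>) * D * ((h - \<eta> * h))" by (simp add: power2_eq_square algebra_simps)
      also have "\<dots> \<le> (1 - \<eta>) * D * (h - (3 * real m + 1) * w)"
        using mw \<eta> D by (intro mult_left_mono) auto
      also have "\<dots> = \<kappa> * (G - 2 * real m - real m - 1)"
        unfolding \<kappa>_def Gw[symmetric] by (simp add: algebra_simps)
      finally have *: "(1 - \<epsilon> / 2) * (D * h) \<le> \<kappa> * (G - 2 * real m - real m - 1)" .
      have e1: "exp 2 * (2 * exp (- x)) = 2 * exp (2 - x)" for x :: real
        by (simp add: exp_diff exp_minus divide_inverse)
      have "exp 2 * (1 / cosh (\<kappa> * (G - 2 * real m - real m - 1))) \<le> exp 2 * (2 * exp (- (\<kappa> * (G - 2 * real m - real m - 1))))"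
        by (intro mult_left_mono inverse_cosh_le) auto
      also have "\<dots> \<le> exp 2 * (2 * exp (- ((1 - \<epsilon> / 2) * (D * h))))"
        using * by (intro mult_left_mono) auto
      also have "\<dots> = 2 * exp (2 - (1 - \<epsilon> / 2) * (D * h))" by (rule e1)
      also have "\<dots> \<le> 2 * exp (- 3 - (1 - \<epsilon>) * D * (h + 1))"
      proof -
        have "2 - (1 - \<epsilon> / 2) * (D * h) + (1 - \<epsilon>) * D * (h + 1) = 2 - \<epsilon> / 2 * D * h + (1 - \<epsilon>) * D"
          by (simp add: algebra_simps)
        also have "\<dots> \<le> - 3" unfolding h(2) using mult_pos_pos[OF \<epsilon>(1) D(1)] by (simp add: algebra_simps)
        finally have "2 - (1 - \<epsilon> / 2) * (D * h) \<le> - 3 - (1 - \<epsilon>) * D * (h + 1)" by (simp only: le_diff_eq)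
        then show ?thesis by (intro mult_left_mono) (auto simp only: exp_le_cancel_iff)
      qed
      also have "\<dots> = 2 * exp (- 3) * \<rho>"
      proof -
        have "- 3 - (1 - \<epsilon>) * D * (h + 1) = - 3 + - (1 - \<epsilon>) * D * (h + 1)" by (simp only: minus_mult_left diff_conv_add_uminus)
        then show ?thesis by (simp only: \<rho>_def exp_add mult.assoc)
      qed
      \<comment> \<open>\<open>h\<close> was chosen to leave this factor \<open>exp (- 3) \<le> 1 / 8\<close>.\<close>
      also have "\<dots> \<le> 2 * (1 / 8) * \<rho>"
      proof -
        have "(2::real) ^ 3 \<le> exp 1 ^ 3" using exp_ge_add_one_self[of 1] by (intro power_mono) auto
        then have "(8::real) \<le> exp 3" by (simp flip: exp_of_nat_mult)
        then show ?thesis using \<rho> by (intro mult_right_mono mult_left_mono) (auto simp: exp_minus field_simps)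
      qed
      finally show ?thesis by simp
    qed
    have t2: "exp 2 * (1 - exp (- (a * w) * (G - 2 * real m + 1))) \<le> \<rho> / 8"
    proof -
      have "1 - exp (- x * y) \<le> x * y" for x y :: real
        using exp_ge_add_one_self[of "- x * y"] by simp
      then have "1 - exp (- (a * w) * (G - 2 * real m + 1)) \<le> (a * w) * (G - 2 * real m + 1)" .
      also have "\<dots> \<le> (a * w) * (G + 1)" using a w by (intro mult_left_mono) auto
      also have "\<dots> = a * (h + w)" unfolding Gw[symmetric] by (simp add: algebra_simps)
      also have "\<dots> \<le> a * (h + 1)" using a w1 by (intro mult_left_mono) auto
      also have "\<dots> = \<rho> / (8 * exp 2)" using h by (simp add: a_def)
      finally show ?thesis by (simp add: field_simps)
    qed
    have t3: "exp 2 * (1 / (1 + (a * w)\<^sup>2 * v / 2)) ^ J \<le> \<rho> / 8"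
    proof -
      define x where "x = (a * w)\<^sup>2 * v / 2"
      have x: "0 < x" using a w variance_pos by (simp add: x_def)
      have "M / I * x \<le> 1 + real J * x" using mult_right_mono[OF J(1), of x] x by linarith
      also have "\<dots> \<le> (1 + x) ^ J" using x by (intro Bernoulli_inequality) auto
      finally have le: "M / I * x \<le> (1 + x) ^ J" .
      have eq: "M / I * x = 8 * exp 2 / \<rho>"
        using a variance_pos \<rho> I w by (simp add: M_def x_def power_mult_distrib field_simps)
      have "(1 / (1 + x)) ^ J = 1 / (1 + x) ^ J" by (simp add: power_divide)
      also have "\<dots> \<le> 1 / (8 * exp 2 / \<rho>)"
        using le \<rho> x unfolding eq by (intro divide_left_mono) auto
      finally show ?thesis by (simp add: x_def field_simps)
    qed
    have t4: "real J * (4 * real m) * (real K * \<theta>)\<^sup>2 \<le> \<rho> / 4"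
    proof -
      have "real J * (4 * real m) * (real K * \<theta>)\<^sup>2 \<le> (M + 1) / I * (4 * (real m + 1)) * ((real K + 1) * (I / escape))\<^sup>2"
        using J \<theta> q M I by (intro mult_mono power_mono) auto
      also have "\<dots> = I * ((M + 1) * (4 * (real m + 1)) * (real K + 1)\<^sup>2 / escape\<^sup>2)"
        using I q by (simp add: field_simps power2_eq_square)
      also have "\<dots> \<le> \<rho> * escape\<^sup>2 / (16 * (real m + 1) * (real K + 1)\<^sup>2 * (M + 1)) *
           ((M + 1) * (4 * (real m + 1)) * (real K + 1)\<^sup>2 / escape\<^sup>2)"
        using I M by (intro mult_right_mono) (auto simp: I0_def)
      also have "\<dots> = \<rho> / 4 * ((M + 1) / (M + 1)) * ((real m + 1) / (real m + 1))
          * ((real K + 1)\<^sup>2 / (real K + 1)\<^sup>2) * (escape\<^sup>2 / escape\<^sup>2)"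
        by (simp add: mult_ac)
      also have "\<dots> = \<rho> / 4" using M q by simp
      finally show ?thesis .
    qed
    have t5: "real K * \<theta> * (real J * \<tau>) \<le> \<rho> / 4"
    proof -
      have "real K * \<theta> * (real J * \<tau>) \<le> (real K + 1) * (I / escape) * ((M + 1) / I * \<tau>)"
        using J \<theta> q M I \<tau> by (intro mult_mono) auto
      also have "\<dots> = \<rho> / 4 * ((real K + 1) / (real K + 1)) * ((M + 1) / (M + 1)) * (I / I) * (escape / escape)"
        by (simp add: \<tau>_def mult_ac)
      also have "\<dots> = \<rho> / 4" using I q M by simp
      finally show ?thesis .
    qed
    have "weight \<Delta> G (J + 2 * m) \<le> \<rho>"
    proof -
      have "exp 2 * mean J (\<lambda>xs. exp (- c * occupation (G - 2 * real m) (real m) 0 xs)) \<le> \<rho> / 2"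
        using mult_left_mono[OF hit, of "exp 2"] t1 t2 t3 by (simp only: ring_distribs) simp
      then show ?thesis using stage t4 t5 by linarith
    qed
    also have "\<rho> \<le> exp (- (1 - \<epsilon>) * D * (h + w))"
      unfolding \<rho>_def using \<epsilon> D w1 by (simp add: mult_left_mono)
    also have "- (1 - \<epsilon>) * D * (h + w) = - (1 - \<epsilon>) * sqrt (2 * I / v) * (G + 1)"
    proof -
      have "sqrt (2 * I / v) = D * w" unfolding D_def w_def by (simp flip: real_sqrt_mult)
      moreover have "h + w = (G + 1) * w" unfolding Gw[symmetric] by (simp add: algebra_simps)
      ultimately show ?thesis by (simp add: mult_ac)
    qed
    finally show "\<exists>L. weight \<Delta> (h / sqrt (killing_rate \<Delta>)) L
       \<le> exp (- (1 - \<epsilon>) * sqrt (2 * killing_rate \<Delta> / v) * (h / sqrt (killing_rate \<Delta>) + 1))"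
      unfolding G_def w_def I_def by blast
  qed
qed

text \<open>
  The distance \<open>s\<close> contains \<open>\<lfloor>s / (g + 1)\<rfloor>\<close> stages. The incomplete last stage costs a factor that
  stays bounded, because \<open>sqrt I * (g + 1)\<close> does.
\<close>

lemma weight_exponential_bound:
  assumes q: "escape > 0" and \<epsilon>: "0 < \<epsilon>" "\<epsilon> < 1"
  shows "\<exists>C>0. \<exists>I0>0. \<forall>\<Delta>. (\<forall>i. 0 \<le> \<Delta> i) \<longrightarrow> decseq \<Delta> \<longrightarrow> 0 < killing_rate \<Delta> \<longrightarrow> killing_rate \<Delta> \<le> I0 \<longrightarrow>
    (\<forall>s\<ge>0. \<forall>e. (\<forall>N. e \<le> weight \<Delta> s N) \<longrightarrow> e \<le> C * exp (- (1 - \<epsilon>) * sqrt (2 * killing_rate \<Delta> / v) * s))"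
proof -
  obtain h I0 where h: "h > 0" and I0: "I0 > 0" and stage: "\<And>\<Delta>. \<forall>i. 0 \<le> \<Delta> i \<Longrightarrow> decseq \<Delta> \<Longrightarrow> 0 < killing_rate \<Delta> \<Longrightarrow> killing_rate \<Delta> \<le> I0 \<Longrightarrow>
    \<exists>L. weight \<Delta> (h / sqrt (killing_rate \<Delta>)) L
       \<le> exp (- (1 - \<epsilon>) * sqrt (2 * killing_rate \<Delta> / v) * (h / sqrt (killing_rate \<Delta>) + 1))"
    using stage_bound[OF assms] by blast
  define C where "C = exp (sqrt (2 / v) * (h + 1))"
  have C: "0 < C" and I0': "0 < min I0 1" using I0 by (auto simp: C_def)
  show ?thesis
  proof (rule exI[of _ C], rule conjI[OF C], rule exI[of _ "min I0 1"], rule conjI[OF I0'], intro allI impI)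
    fix \<Delta> :: "nat \<Rightarrow> real" and s e
    assume \<Delta>: "\<forall>i. 0 \<le> \<Delta> i" and dec: "decseq \<Delta>" and pos: "0 < killing_rate \<Delta>" and small: "killing_rate \<Delta> \<le> min I0 1"
      and s: "0 \<le> s" and e: "\<forall>N. e \<le> weight \<Delta> s N"
    define I where "I = killing_rate \<Delta>"
    define g where "g = h / sqrt I"
    define b where "b = (1 - \<epsilon>) * sqrt (2 * I / v)"
    have I: "0 < I" "I \<le> 1" using pos small by (auto simp: I_def)
    have g: "0 < g" using h I by (simp add: g_def)
    have b: "0 \<le> b" using \<epsilon> I variance_pos by (simp add: b_def)
    obtain L where L: "weight \<Delta> g L \<le> exp (- b * (g + 1))"
    proof -
      have "killing_rate \<Delta> \<le> I0" using small by simp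
      from stage[OF \<Delta> dec pos this] obtain L where "weight \<Delta> (h / sqrt (killing_rate \<Delta>)) L
         \<le> exp (- (1 - \<epsilon>) * sqrt (2 * killing_rate \<Delta> / v) * (h / sqrt (killing_rate \<Delta>) + 1))" by blast
      then show ?thesis by (intro that[of L]) (simp only: g_def b_def I_def minus_mult_left)
    qed
    define k where "k = nat \<lfloor>s / (g + 1)\<rfloor>"
    have "0 \<le> s / (g + 1)" using s g by simp
    then have k: "real k \<le> s / (g + 1)" "s / (g + 1) \<le> real k + 1" unfolding k_def by linarith+
    then have k': "real k * (g + 1) \<le> s" "s - (g + 1) \<le> real k * (g + 1)" using g by (auto simp: field_simps)
    have "e \<le> exp (- b * (g + 1)) ^ k"
    proof (rule field_le_epsilon)
      fix \<eta> :: real assume "0 < \<eta>"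
      then obtain N where "weight \<Delta> s N \<le> exp (- b * (g + 1)) ^ k + \<eta>"
        using weight_iterate[of \<Delta> g L, OF _ g L k'(1)] \<Delta> by blast
      with e show "e \<le> exp (- b * (g + 1)) ^ k + \<eta>" using order_trans by blast
    qed
    also have "\<dots> = exp (- (b * (real k * (g + 1))))"
      by (simp flip: exp_of_nat_mult)
    also have "\<dots> \<le> exp (- (b * (s - (g + 1))))"
      using mult_left_mono[OF k'(2) b] by simp
    also have "\<dots> = exp (b * (g + 1)) * exp (- b * s)"
      by (simp add: algebra_simps flip: exp_add)
    also have "\<dots> \<le> C * exp (- b * s)"
    proof -
      have "b * (g + 1) \<le> sqrt (2 * I / v) * (g + 1)"
        unfolding b_def using \<epsilon> I variance_pos g by (intro mult_right_mono) (auto simp: mult_le_cancel_right1)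
      also have "\<dots> = sqrt (2 / v) * (h + sqrt I)"
      proof -
        have "sqrt (2 * I / v) = sqrt (2 / v) * sqrt I" by (simp flip: real_sqrt_mult)
        moreover have "sqrt I * (g + 1) = h + sqrt I" using I by (simp add: g_def algebra_simps)
        ultimately show ?thesis by (simp add: mult.assoc)
      qed
      also have "\<dots> \<le> sqrt (2 / v) * (h + 1)" using I variance_pos by (intro mult_left_mono) auto
      finally show ?thesis by (simp add: C_def)
    qed
    finally show "e \<le> C * exp (- (1 - \<epsilon>) * sqrt (2 * killing_rate \<Delta> / v) * s)"
      by (simp only: b_def I_def minus_mult_left)
  qed
qed

end

section \<open>The simple random walk and the product potential\<close>

lemma axis_steps: "range (\<lambda>i. axis i (1::int)) \<inter> range (\<lambda>i::'d::finite. axis i (- 1)) = {}"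
proof -
  have "axis i (1::int) \<noteq> axis j (- 1)" for i j :: 'd
  proof
    assume "axis i (1::int) = axis j (- 1)"
    then have "axis i (1::int) $ i = axis j (- 1) $ i" by simp
    then show False by (simp add: axis_def split: if_splits)
  qed
  then show ?thesis by auto
qed

lemma inj_axis_unit: "inj (\<lambda>i::'d::finite. axis i (1::int))" "inj (\<lambda>i::'d::finite. axis i (- 1::int))"
  by (auto simp: inj_def axis_eq_axis)

lemma set_step_pmf: "set_pmf (step_pmf :: (int ^ 'd::finite) pmf) = range (\<lambda>i. axis i 1) \<union> range (\<lambda>i. axis i (- 1))"
  unfolding step_pmf_def by (rule set_pmf_of_set) auto

lemma expectation_step_pmf:
  fixes f :: "int ^ 'd::finite \<Rightarrow> real"
  shows "measure_pmf.expectation step_pmf f = (\<Sum>i\<in>UNIV. f (axis i 1) + f (axis i (- 1))) / (2 * real CARD('d))"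
proof -
  let ?A = "range (\<lambda>i::'d. axis i (1::int))" and ?B = "range (\<lambda>i::'d. axis i (- 1::int))"
  have "card (?A \<union> ?B) = 2 * CARD('d)"
    by (subst card_Un_disjoint) (auto simp: axis_steps card_image inj_axis_unit)
  moreover have "sum f (?A \<union> ?B) = (\<Sum>i\<in>UNIV. f (axis i 1) + f (axis i (- 1)))"
    by (subst sum.union_disjoint) (auto simp: axis_steps sum.reindex inj_axis_unit sum.distrib)
  ultimately show ?thesis
    unfolding step_pmf_def by (subst integral_pmf_of_set) auto
qed

lemma of_int_vec_add: "of_int_vec (x + y) = of_int_vec x + of_int_vec y"
  by (simp add: of_int_vec_def vec_eq_iff)

lemma of_int_vec_axis_inner: "of_int_vec (axis i a) \<bullet> l = of_int a * l $ i"
proof -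
  have "of_int_vec (axis i a) = axis i (of_int a)"
    by (simp add: of_int_vec_def axis_def vec_eq_iff)
  then show ?thesis by (simp add: inner_axis')
qed

lemma finite_walk_step_pmf: "finite_walk (step_pmf :: (int ^ 'd::finite) pmf)"
  by unfold_locales (simp add: set_step_pmf)

lemma leveled_walk_step_pmf:
  fixes l :: "real ^ 'd::finite"
  assumes "norm l = 1"
  shows "leveled_walk step_pmf (\<lambda>x. of_int_vec x \<bullet> l) (1 / real CARD('d))"
proof -
  interpret finite_walk "step_pmf :: (int ^ 'd) pmf" by (rule finite_walk_step_pmf)
  show ?thesis
  proof
    show "of_int_vec (x + y) \<bullet> l = of_int_vec x \<bullet> l + of_int_vec y \<bullet> l" for x y
      by (simp add: of_int_vec_add inner_add_left)
    show "\<bar>of_int_vec x \<bullet> l\<bar> \<le> 1" if "x \<in> set_pmf step_pmf" for x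
      using that component_le_norm_cart[of l] assms
      by (auto simp: set_step_pmf of_int_vec_axis_inner)
    have "uminus ` (range (\<lambda>i::'d. axis i (1::int)) \<union> range (\<lambda>i. axis i (- 1)))
        = range (\<lambda>i. axis i 1) \<union> range (\<lambda>i. axis i (- 1))"
    proof -
      have "- axis i (a::int) = axis i (- a)" for i :: 'd and a
        by (simp add: axis_def vec_eq_iff)
      then show ?thesis by (auto simp: image_Un image_image)
    qed
    then show "map_pmf uminus step_pmf = (step_pmf :: (int ^ 'd) pmf)"
      unfolding step_pmf_def by (subst map_pmf_of_set_inj) auto
    have "(\<Sum>i\<in>UNIV. (l $ i)\<^sup>2) = 1"
      using assms by (simp add: norm_eq_1 inner_vec_def power2_eq_square)
    then show "measure_pmf.expectation step_pmf (\<lambda>x. (of_int_vec x \<bullet> l)\<^sup>2) = 1 / real CARD('d)"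
      by (simp add: expectation_step_pmf of_int_vec_axis_inner flip: sum_distrib_left)
  qed simp
qed

lemma pmf_replicate_pmf:
  "length xs = N \<Longrightarrow> pmf (replicate_pmf N p) xs = (\<Prod>i<N. pmf p (xs ! i))"
proof (induction N arbitrary: xs)
  case (Suc N)
  then obtain y ys where xs: "xs = y # ys" "length ys = N" by (cases xs) auto
  have "replicate_pmf (Suc N) p = map_pmf (\<lambda>(x, xs). x # xs) (pair_pmf p (replicate_pmf N p))"
    by (simp add: pair_pmf_def map_bind_pmf)
  moreover have "inj (\<lambda>(x, xs). x # xs :: 'a list)" by (auto simp: inj_def)
  ultimately have "pmf (replicate_pmf (Suc N) p) (y # ys) = pmf p y * pmf (replicate_pmf N p) ys"
    using pmf_map_inj'[of "\<lambda>(x, xs). x # xs" "pair_pmf p (replicate_pmf N p)" "(y, ys)"]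
    by (simp add: pmf_pair)
  then show ?case using Suc.IH[OF xs(2)] xs unfolding prod.lessThan_Suc_shift by (simp del: replicate_pmf.simps)
qed simp

abbreviation walk_steps :: "(nat \<Rightarrow> int ^ 'd::finite) measure" where
  "walk_steps \<equiv> PiM UNIV (\<lambda>_. measure_pmf step_pmf)"

lemma initial_steps_vimage:
  "(\<lambda>\<xi>. map \<xi> [0..<N]) -` {xs} \<inter> space walk_steps =
    (if length xs = N then {\<xi>\<in>space walk_steps. \<forall>i\<in>{..<N}. \<xi> i \<in> {xs ! i}} else {})"
proof -
  have "map \<xi> [0..<N] = xs \<longleftrightarrow> length xs = N \<and> (\<forall>i<N. \<xi> i = xs ! i)" for \<xi>
    unfolding list_eq_iff_nth_eq[of "map \<xi> [0..<N]"] by auto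
  then show ?thesis by auto
qed

lemma measurable_initial_steps:
  "(\<lambda>\<xi>. map \<xi> [0..<N]) \<in> (walk_steps :: (nat \<Rightarrow> int ^ 'd::finite) measure) \<rightarrow>\<^sub>M count_space UNIV"
proof (subst measurable_count_space_eq2_countable, safe)
  fix xs :: "(int ^ 'd) list"
  have if_sets: "A \<in> sets M \<Longrightarrow> (if b then A else {}) \<in> sets M" for A b and M :: "(nat \<Rightarrow> int ^ 'd) measure"
    by simp
  have "{\<xi>\<in>space (walk_steps :: (nat \<Rightarrow> int ^ 'd) measure). \<forall>i\<in>{..<N}. \<xi> i \<in> {xs ! i}} \<in> sets walk_steps"
    by (intro sets.sets_Collect_finite_All sets_Collect_single') simp_all
  then show "(\<lambda>\<xi>. map \<xi> [0..<N]) -` {xs} \<inter> space walk_steps \<in> sets walk_steps"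
    unfolding initial_steps_vimage by (rule if_sets)
qed simp

text \<open>
  This carries statements about lists of steps over to the space of trajectories.
\<close>

lemma distr_initial_steps:
  "distr (walk_steps :: (nat \<Rightarrow> int ^ 'd::finite) measure) (count_space UNIV) (\<lambda>\<xi>. map \<xi> [0..<N])
    = measure_pmf (replicate_pmf N step_pmf)"
proof (rule measure_eqI_countable[where A = UNIV])
  fix xs :: "(int ^ 'd) list"
  interpret P: product_prob_space "\<lambda>_::nat. measure_pmf (step_pmf :: (int ^ 'd) pmf)" UNIV
    by unfold_locales
  have "emeasure (distr walk_steps (count_space UNIV) (\<lambda>\<xi>. map \<xi> [0..<N])) {xs}
      = emeasure walk_steps ((\<lambda>\<xi>. map \<xi> [0..<N]) -` {xs} \<inter> space walk_steps)"
    by (rule emeasure_distr[OF measurable_initial_steps]) simp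
  also have "\<dots> = emeasure (measure_pmf (replicate_pmf N step_pmf)) {xs}"
  proof (cases "length xs = N")
    case True
    then have "(\<lambda>\<xi>. map \<xi> [0..<N]) -` {xs} \<inter> space walk_steps = {\<xi>\<in>space walk_steps. \<forall>i\<in>{..<N}. \<xi> i \<in> {xs ! i}}"
      by (simp only: initial_steps_vimage simp_thms if_True)
    then have "emeasure walk_steps ((\<lambda>\<xi>. map \<xi> [0..<N]) -` {xs} \<inter> space walk_steps)
        = (\<Prod>i<N. emeasure (measure_pmf step_pmf) {xs ! i})"
      using P.emeasure_PiM_Collect[of "{..<N}" "\<lambda>i. {xs ! i}"] by simp
    also have "\<dots> = emeasure (measure_pmf (replicate_pmf N step_pmf)) {xs}"
      using True by (simp add: emeasure_pmf_single pmf_replicate_pmf prod_ennreal)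
    finally show ?thesis .
  next
    case False
    then have "(\<lambda>\<xi>. map \<xi> [0..<N]) -` {xs} \<inter> space walk_steps = {}" by auto
    moreover have "xs \<notin> set_pmf (replicate_pmf N step_pmf)" using False by (simp add: set_replicate_pmf)
    then have "emeasure (measure_pmf (replicate_pmf N step_pmf)) {xs} = 0"
      by (simp add: emeasure_pmf_single set_pmf_iff)
    ultimately show ?thesis by simp
  qed
  finally show "emeasure (distr walk_steps (count_space UNIV) (\<lambda>\<xi>. map \<xi> [0..<N])) {xs}
     = emeasure (measure_pmf (replicate_pmf N step_pmf)) {xs}" .
qed (simp_all only: sets_distr sets_count_space sets_measure_pmf Pow_UNIV countableI_type)

lemma pos_initial_steps: "k \<le> N \<Longrightarrow> pos (map \<xi> [0..<N]) k = (\<Sum>i<k. \<xi> i)"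
  by (simp add: pos_def take_map take_upt interv_sum_list_conv_sum_set_nat atLeast0LessThan)

lemma integral_initial_steps:
  fixes f :: "(int ^ 'd::finite) list \<Rightarrow> real"
  shows "(\<integral>\<xi>. f (map \<xi> [0..<N]) \<partial>walk_steps) = finite_walk.mean step_pmf N f"
  unfolding finite_walk.mean_def[OF finite_walk_step_pmf] distr_initial_steps[symmetric]
  by (subst integral_distr[OF measurable_initial_steps]) auto

lemma escape_prob_eq: "escape_prob TYPE('d::finite) = finite_walk.escape (step_pmf :: (int ^ 'd) pmf)"
proof -
  interpret finite_walk "step_pmf :: (int ^ 'd) pmf" by (rule finite_walk_step_pmf)
  interpret P: product_prob_space "\<lambda>_::nat. measure_pmf (step_pmf :: (int ^ 'd) pmf)" UNIV
    by unfold_locales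
  define A where "A m = {\<xi> \<in> space walk_steps. avoids_start (map \<xi> [0..<m] :: (int ^ 'd) list)}" for m
  have sets_A: "A m \<in> sets walk_steps" for m
    unfolding A_def by (rule measurable_sets_Collect[OF measurable_initial_steps]) simp
  have A_eq: "A m = {\<xi>. \<forall>k\<in>{1..m}. (\<Sum>i<k. \<xi> i) \<noteq> 0}" for m
    by (auto simp: A_def avoids_start_def pos_initial_steps space_PiM)
  have "escape_upto m = P.prob (A m)" for m
  proof -
    have "escape_upto m = (\<integral>\<xi>. of_bool (avoids_start (map \<xi> [0..<m])) \<partial>(walk_steps :: (nat \<Rightarrow> int ^ 'd) measure))"
      unfolding escape_upto_def by (rule integral_initial_steps[symmetric, where f = "\<lambda>xs. of_bool (avoids_start xs)"])
    also have "\<dots> = (\<integral>\<xi>. indicator (A m) \<xi> \<partial>walk_steps)"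
      by (intro Bochner_Integration.integral_cong) (auto simp: A_def)
    also have "\<dots> = P.prob (A m)" using sets_A by simp
    finally show ?thesis .
  qed
  then have "escape_upto = (\<lambda>m. P.prob (A m))" by (rule ext)
  moreover have "(\<lambda>m. P.prob (A m)) \<longlonglongrightarrow> P.prob (\<Inter>m. A m)"
  proof (rule P.finite_Lim_measure_decseq)
    show "range A \<subseteq> sets walk_steps" using sets_A by blast
    show "decseq A" unfolding decseq_def A_eq by fastforce
  qed
  ultimately have "escape_upto \<longlonglongrightarrow> P.prob (\<Inter>m. A m)" by (simp only:)
  then have "P.prob (\<Inter>m. A m) = escape" using tendsto_escape by (rule LIMSEQ_unique)
  moreover have "escape_prob TYPE('d) = P.prob (\<Inter>m. A m)"
  proof -
    let ?E = "{S \<in> space (srw (0 :: int ^ 'd)). \<forall>n\<ge>1. S n \<noteq> 0}"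
    have "?E \<in> sets (srw 0)" by measurable
    then have "measure (srw 0) ?E = P.prob ((\<lambda>\<xi> k. 0 + (\<Sum>i<k. \<xi> i)) -` ?E \<inter> space walk_steps)"
      unfolding srw_def by (subst measure_distr[OF measurable_walk]) (auto simp: space_PiM)
    also have "(\<lambda>\<xi> k. 0 + (\<Sum>i<k. \<xi> i)) -` ?E \<inter> space walk_steps = (\<Inter>m. A m)"
    proof -
      have "(\<forall>m. \<forall>k\<in>{1..m}. P k) \<longleftrightarrow> (\<forall>n\<ge>1. P n)" for P :: "nat \<Rightarrow> bool"
        by (meson atLeastAtMost_iff order_refl)
      then show ?thesis by (simp add: A_eq srw_def space_PiM set_eq_iff)
    qed
    finally show ?thesis by (simp add: escape_prob_def)
  qed
  ultimately show ?thesis by simp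
qed

text \<open>
  The potentials of finitely many sites are independent, although the field is indexed by the
  infinite lattice.
\<close>

lemma integral_potential_prod:
  fixes F :: "int ^ 'd::finite \<Rightarrow> real \<Rightarrow> real"
  assumes "prob_space \<mu>" "finite J" and F: "\<And>y. y \<in> J \<Longrightarrow> integrable \<mu> (F y)"
  shows "(\<integral>V. (\<Prod>y\<in>J. F y (V y)) \<partial>potential \<mu>) = (\<Prod>y\<in>J. \<integral>z. F y z \<partial>\<mu>)"
proof -
  interpret \<mu>: prob_space \<mu> by fact
  interpret P: product_prob_space "\<lambda>_. \<mu>" "UNIV :: (int ^ 'd) set" by unfold_locales
  have [measurable]: "F y \<in> borel_measurable \<mu>" if "y \<in> J" for y using F[OF that] by auto
  have "(\<integral>V. (\<Prod>y\<in>J. F y (V y)) \<partial>potential \<mu>) = (\<integral>V. (\<Prod>y\<in>J. F y (restrict V J y)) \<partial>PiM UNIV (\<lambda>_. \<mu>))"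
    unfolding potential_def by (intro Bochner_Integration.integral_cong prod.cong) auto
  also have "\<dots> = (\<integral>V. (\<Prod>y\<in>J. F y (V y)) \<partial>distr (PiM UNIV (\<lambda>_. \<mu>)) (PiM J (\<lambda>_. \<mu>)) (\<lambda>V. restrict V J))"
    by (subst integral_distr) (auto intro!: borel_measurable_prod measurable_compose[OF measurable_component_singleton] measurable_restrict_subset)
  also have "\<dots> = (\<integral>V. (\<Prod>y\<in>J. F y (V y)) \<partial>PiM J (\<lambda>_. \<mu>))"
    using assms by (subst P.distr_PiM_restrict_finite) auto
  also have "\<dots> = (\<Prod>y\<in>J. \<integral>z. F y z \<partial>\<mu>)"
    by (rule P.product_integral_prod) (use assms in auto)
  finally show ?thesis .
qed

section \<open>The law of the potential\<close>

text \<open>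
  The increments of \<open>k \<mapsto> 1 - \<integral> exp (- \<beta> k z) \<partial>\<mu>\<close>, the probability that a site kills the walk within
  \<open>k\<close> visits.
\<close>

definition increments :: "real measure \<Rightarrow> real \<Rightarrow> nat \<Rightarrow> real" where
  "increments \<mu> \<beta> k = (\<integral>z. (1 - exp (- \<beta> * z)) * exp (- \<beta> * z) ^ k \<partial>\<mu>)"

locale nonneg_law = prob_space \<mu> for \<mu> :: "real measure" +
  assumes sets_law: "sets \<mu> = sets borel" and AE_nonneg: "AE z in \<mu>. 0 \<le> z"
begin

lemma measurable_law [measurable_cong]: "sets \<mu> = sets borel"
  by (rule sets_law)

lemma integrable_law:
  assumes [measurable]: "f \<in> borel_measurable borel" and "\<And>z. 0 \<le> z \<Longrightarrow> \<bar>f z\<bar> \<le> (B :: real)"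
  shows "integrable \<mu> f"
proof (rule integrable_const_bound)
  show "AE z in \<mu>. norm (f z) \<le> B" using AE_nonneg by eventually_elim (simp add: assms)
qed simp

lemma integral_law_mono:
  assumes "integrable \<mu> f" "integrable \<mu> g" "\<And>z. 0 \<le> z \<Longrightarrow> f z \<le> (g z :: real)"
  shows "(\<integral>z. f z \<partial>\<mu>) \<le> (\<integral>z. g z \<partial>\<mu>)"
  using assms AE_nonneg by (intro integral_mono_AE) (auto elim: eventually_mono)

lemma exp_unit: "0 \<le> \<beta> \<Longrightarrow> 0 \<le> z \<Longrightarrow> exp (- \<beta> * z) \<le> (1 :: real)"
  by simp

lemma integrable_increment:
  assumes "0 \<le> \<beta>"
  shows "integrable \<mu> (\<lambda>z. (1 - exp (- \<beta> * z)) * exp (- \<beta> * z) ^ k)"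
proof (rule integrable_law[where B = 1])
  show "\<bar>(1 - exp (- \<beta> * z)) * exp (- \<beta> * z) ^ k\<bar> \<le> 1" if "0 \<le> z" for z
    using exp_unit[OF assms that] by (auto simp: abs_mult intro!: mult_le_one power_le_one)
qed measurable

lemma increments_nonneg:
  assumes "0 \<le> \<beta>" shows "0 \<le> increments \<mu> \<beta> k"
  using AE_nonneg unfolding increments_def
  by (intro integral_nonneg_AE) (auto elim!: eventually_mono intro!: mult_nonneg_nonneg simp: assms)

lemma decseq_increments:
  assumes "0 \<le> \<beta>" shows "decseq (increments \<mu> \<beta>)"
  unfolding decseq_def increments_def
proof (intro allI impI integral_law_mono integrable_increment assms)
  fix i j :: nat and z :: real assume "i \<le> j" "0 \<le> z"
  then show "(1 - exp (- \<beta> * z)) * exp (- \<beta> * z) ^ j \<le> (1 - exp (- \<beta> * z)) * exp (- \<beta> * z) ^ i"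
    using exp_unit[OF assms, of z] by (intro mult_left_mono power_decreasing) auto
qed

lemma psi_increments:
  assumes "0 \<le> \<beta>"
  shows "(\<integral>z. exp (- \<beta> * z) ^ k \<partial>\<mu>) = 1 - psi (increments \<mu> \<beta>) k"
proof -
  have "psi (increments \<mu> \<beta>) k = (\<integral>z. (\<Sum>i<k. (1 - exp (- \<beta> * z)) * exp (- \<beta> * z) ^ i) \<partial>\<mu>)"
    unfolding psi_def increments_def
    by (rule Bochner_Integration.integral_sum[symmetric]) (rule integrable_increment[OF assms])
  also have "\<dots> = (\<integral>z. 1 - exp (- \<beta> * z) ^ k \<partial>\<mu>)"
    by (intro Bochner_Integration.integral_cong refl) (simp only: one_diff_power_eq sum_distrib_left)
  also have "\<dots> = 1 - (\<integral>z. exp (- \<beta> * z) ^ k \<partial>\<mu>)"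
  proof (subst Bochner_Integration.integral_diff)
    show "integrable \<mu> (\<lambda>z. exp (- \<beta> * z) ^ k)"
    proof (rule integrable_law[where B = 1])
      fix z :: real assume "0 \<le> z"
      then have "0 \<le> exp (- \<beta> * z) ^ k" "exp (- \<beta> * z) ^ k \<le> 1"
        using exp_unit[OF assms] by (intro zero_le_power power_le_one; simp)+
      then show "\<bar>exp (- \<beta> * z) ^ k\<bar> \<le> 1" by linarith
    qed measurable
  qed (simp_all add: prob_space)
  finally show ?thesis by simp
qed

text \<open>
  A geometric series in \<open>r * exp (- \<beta> * z)\<close> under the integral. For \<open>r = 1 - q\<close> it identifies the
  killing rate with the constant in the theorem.
\<close>

lemma killing_series:
  assumes "0 \<le> \<beta>" and r: "0 \<le> r" "r < 1"
  shows "(\<Sum>k. increments \<mu> \<beta> k * r ^ k) = (\<integral>z. (1 - exp (- \<beta> * z)) / (1 - r * exp (- \<beta> * z)) \<partial>\<mu>)"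
proof -
  let ?f = "\<lambda>k z. (1 - exp (- \<beta> * z)) * exp (- \<beta> * z) ^ k * r ^ k"
  have int: "integrable \<mu> (?f k)" for k
    by (intro integrable_mult_left integrable_increment assms)
  have bound: "norm (?f k z) \<le> r ^ k" if "0 \<le> z" for k z
  proof -
    have "\<bar>(1 - exp (- \<beta> * z)) * exp (- \<beta> * z) ^ k\<bar> \<le> 1"
      using exp_unit[OF assms(1) that] by (auto simp: abs_mult intro!: mult_le_one power_le_one)
    then show ?thesis using r mult_right_mono[of _ 1 "r ^ k"] by (simp add: abs_mult)
  qed
  have sm: "summable (\<lambda>k. r ^ k)" using r by (intro summable_geometric) auto
  have "(\<integral>z. (\<Sum>k. ?f k z) \<partial>\<mu>) = (\<Sum>k. \<integral>z. ?f k z \<partial>\<mu>)"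
  proof (rule integral_suminf[OF int])
    show "AE z in \<mu>. summable (\<lambda>k. norm (?f k z))"
      using AE_nonneg
    proof eventually_elim
      case (elim z)
      show ?case by (rule summable_comparison_test'[OF sm, of 0]) (use bound[OF elim] in simp)
    qed
    show "summable (\<lambda>k. \<integral>z. norm (?f k z) \<partial>\<mu>)"
    proof (rule summable_comparison_test'[OF sm, of 0])
      fix k
      have "(\<integral>z. norm (?f k z) \<partial>\<mu>) \<le> (\<integral>z. r ^ k \<partial>\<mu>)"
        by (intro integral_law_mono integrable_norm int bound) auto
      then show "norm (\<integral>z. norm (?f k z) \<partial>\<mu>) \<le> r ^ k" by (simp add: prob_space)
    qed
  qed
  also have "(\<Sum>k. \<integral>z. ?f k z \<partial>\<mu>) = (\<Sum>k. increments \<mu> \<beta> k * r ^ k)"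
    unfolding increments_def by simp
  finally have "(\<Sum>k. increments \<mu> \<beta> k * r ^ k) = (\<integral>z. (\<Sum>k. ?f k z) \<partial>\<mu>)" by simp
  also have "\<dots> = (\<integral>z. (1 - exp (- \<beta> * z)) / (1 - r * exp (- \<beta> * z)) \<partial>\<mu>)"
  proof (rule integral_cong_AE)
    show "AE z in \<mu>. (\<Sum>k. ?f k z) = (1 - exp (- \<beta> * z)) / (1 - r * exp (- \<beta> * z))"
      using AE_nonneg
    proof eventually_elim
      case (elim z)
      have "r * exp (- \<beta> * z) \<le> r * 1" using exp_unit[OF assms(1) elim] r by (intro mult_left_mono) auto
      then have lt: "\<bar>r * exp (- \<beta> * z)\<bar> < 1" using r by (simp add: abs_mult)
      have "(\<Sum>k. ?f k z) = (\<Sum>k. (1 - exp (- \<beta> * z)) * (r * exp (- \<beta> * z)) ^ k)"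
        by (simp only: power_mult_distrib mult_ac)
      also have "\<dots> = (1 - exp (- \<beta> * z)) / (1 - r * exp (- \<beta> * z))"
        using lt by (subst suminf_mult) (simp_all add: suminf_geometric summable_geometric)
      finally show ?case .
    qed
  qed measurable
  finally show ?thesis .
qed

text \<open>
  Up to the small probability that \<open>z\<close> exceeds a large \<open>n\<close>, the integrand \<open>1 - exp (- \<beta> * z)\<close> is at
  most \<open>\<beta> * n\<close>. So the killing rate becomes small even if \<open>z\<close> has no mean.
\<close>

lemma increments_0_tendsto: "((\<lambda>\<beta>. increments \<mu> \<beta> 0) \<longlongrightarrow> 0) (at_right 0)"
proof (rule tendstoI)
  fix \<eta> :: real assume "0 < \<eta>"
  have "(\<lambda>n::nat. measure \<mu> {real n<..}) \<longlonglongrightarrow> measure \<mu> (\<Inter>n. {real n<..})"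
    by (intro finite_Lim_measure_decseq) (auto simp: decseq_def sets_law)
  moreover have "(\<Inter>n::nat. {real n<..}) = {}"
  proof -
    have "\<exists>n. z \<notin> {real n<..}" for z
      using reals_Archimedean2[of z] by (auto simp: not_less intro: less_imp_le)
    then show ?thesis by blast
  qed
  ultimately have "(\<lambda>n::nat. measure \<mu> {real n<..}) \<longlonglongrightarrow> 0" by simp
  then have "eventually (\<lambda>n::nat. measure \<mu> {real n<..} < \<eta> / 2) sequentially"
    using \<open>0 < \<eta>\<close> by (intro order_tendstoD) auto
  then obtain n :: nat where n: "measure \<mu> {real n<..} < \<eta> / 2" by (auto simp: eventually_sequentially)
  have "eventually (\<lambda>\<beta>. \<beta> \<in> {0<..<\<eta> / (2 * (real n + 1))}) (at_right (0::real))"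
    using \<open>0 < \<eta>\<close> by (intro eventually_at_right_real) auto
  then show "eventually (\<lambda>\<beta>. dist (increments \<mu> \<beta> 0) 0 < \<eta>) (at_right 0)"
  proof eventually_elim
    case (elim \<beta>)
    then have \<beta>: "0 < \<beta>" "\<beta> * (real n + 1) < \<eta> / 2" by (auto simp: field_simps)
    have "increments \<mu> \<beta> 0 \<le> (\<integral>z. \<beta> * real n + indicator {real n<..} z \<partial>\<mu>)"
      unfolding increments_def
    proof (rule integral_law_mono)
      fix z :: real assume z: "0 \<le> z"
      show "(1 - exp (- \<beta> * z)) * exp (- \<beta> * z) ^ 0 \<le> \<beta> * real n + indicator {real n<..} z"
      proof (cases "z \<le> real n")
        case True
        have "1 - exp (- \<beta> * z) \<le> \<beta> * z" using exp_ge_add_one_self[of "- \<beta> * z"] by simp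
        also have "\<dots> \<le> \<beta> * real n" using True \<beta> by (intro mult_left_mono) auto
        finally show ?thesis using True by simp
      next
        case False
        have "(1 - E) * 1 \<le> B + 1" if "0 \<le> B" "0 \<le> E" for B E :: real using that by simp
        from this[of "\<beta> * real n" "exp (- \<beta> * z)"]
        have "(1 - exp (- \<beta> * z)) * 1 \<le> \<beta> * real n + 1" using \<beta> by simp
        then show ?thesis using False by simp
      qed
    next
      show "integrable \<mu> (\<lambda>z. \<beta> * real n + indicator {real n<..} z)"
        by (intro Bochner_Integration.integrable_add integrable_const integrable_law[where B = 1])
          (auto simp: indicator_def)
    qed (use integrable_increment[of \<beta> 0] \<beta> in simp)
    also have "\<dots> = \<beta> * real n + measure \<mu> {real n<..}"
      by (subst Bochner_Integration.integral_add) (auto simp: prob_space sets_law emeasure_eq_measure)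
    also have "\<dots> < \<eta>" using n \<beta> by (simp add: algebra_simps)
    finally show ?case using increments_nonneg[of \<beta> 0] \<beta> by simp
  qed
qed

end

lemma exp_neg_le:
  assumes "0 \<le> c" "ennreal c \<le> t"
  shows "exp_neg t \<le> exp (- c)"
proof (cases t)
  case (real r)
  then show ?thesis using assms by (simp add: exp_neg_def)
next
  case top
  then show ?thesis by (simp add: exp_neg_def)
qed

text \<open>
  Grouping the times by site: the local time of a site is attached to its first visit.
\<close>

lemma (in leveled_walk) sum_alive_ge_fresh:
  assumes "\<And>y. 0 \<le> (f y :: real)"
  shows "(\<Sum>k\<in>fresh s xs. real (local_time s xs k) * f (pos xs k)) \<le> (\<Sum>i | i < length xs \<and> alive s xs i. f (pos xs i))"
proof -
  let ?L = "\<lambda>k. {i. k \<le> i \<and> i < length xs \<and> alive s xs i \<and> pos xs i = pos xs k}"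
  have "(\<Sum>k\<in>fresh s xs. real (local_time s xs k) * f (pos xs k)) = (\<Sum>k\<in>fresh s xs. \<Sum>i\<in>?L k. f (pos xs i))"
    by (intro sum.cong refl) (simp add: local_time_def)
  also have "\<dots> = (\<Sum>i\<in>(\<Union>k\<in>fresh s xs. ?L k). f (pos xs i))"
  proof (rule sum.UNION_disjoint[symmetric])
    show "\<forall>i\<in>fresh s xs. \<forall>j\<in>fresh s xs. i \<noteq> j \<longrightarrow> ?L i \<inter> ?L j = {}"
      by (auto simp: fresh_def) (metis linorder_neqE_nat)
  qed auto
  also have "\<dots> \<le> (\<Sum>i | i < length xs \<and> alive s xs i. f (pos xs i))"
    using assms by (intro sum_mono2) auto
  finally show ?thesis .
qed

lemma (in leveled_walk) inj_on_fresh: "inj_on (pos xs) (fresh s xs)"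
  by (rule inj_onI) (auto simp: fresh_def, metis linorder_neqE_nat)

section \<open>The crossing bound\<close>

text \<open>
  Integrate over the potential first. Truncating the path at \<open>N\<close> steps and dropping the sites of
  negative level only reduces the cost; this avoids paths that never reach the half-space. The
  visited sites have independent potentials, and \<open>1 - \<psi> \<le> exp (- \<psi>)\<close>.
\<close>

lemma e_crossing_le_weight:
  fixes l :: "real ^ 'd::finite"
  assumes l: "norm l = 1" and \<mu>: "prob_space \<mu>" "sets \<mu> = sets borel" "AE z in \<mu>. 0 \<le> z" and \<beta>: "0 \<le> \<beta>"
  shows "e_crossing \<mu> l \<beta> n \<le> leveled_walk.weight step_pmf (\<lambda>x. of_int_vec x \<bullet> l) (increments \<mu> \<beta>) (real n) N"
proof -
  interpret leveled_walk step_pmf "\<lambda>x. of_int_vec x \<bullet> l" "1 / real CARD('d)"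
    by (rule leveled_walk_step_pmf[OF l])
  interpret \<mu>: nonneg_law \<mu> using \<mu> by (simp add: nonneg_law_def nonneg_law_axioms_def)
  interpret V: prob_space "potential \<mu> :: (int ^ 'd \<Rightarrow> real) measure" by (rule prob_space_potential[OF \<mu>(1)])
  interpret S: prob_space "srw 0 :: (nat \<Rightarrow> int ^ 'd) measure" by (rule prob_space_srw)
  interpret VS: pair_prob_space "potential \<mu> :: (int ^ 'd \<Rightarrow> real) measure" "srw 0 :: (nat \<Rightarrow> int ^ 'd) measure" ..
  interpret P: product_prob_space "\<lambda>_::nat. measure_pmf (step_pmf :: (int ^ 'd) pmf)" UNIV
    by unfold_locales
  let ?g = "\<lambda>V S. exp_neg (path_cost \<beta> l n V S)"
  let ?\<Delta> = "increments \<mu> \<beta>"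
  define walk :: "(nat \<Rightarrow> int ^ 'd) \<Rightarrow> nat \<Rightarrow> int ^ 'd" where "walk \<xi> = (\<lambda>k. 0 + (\<Sum>i<k. \<xi> i))" for \<xi>
  have walk_meas [measurable]: "walk \<in> walk_steps \<rightarrow>\<^sub>M PiM UNIV (\<lambda>_. count_space UNIV)"
    unfolding walk_def[abs_def] by (rule measurable_walk)
  have srw_eq: "srw 0 = distr walk_steps (PiM UNIV (\<lambda>_. count_space UNIV)) walk"
    by (simp add: srw_def walk_def[abs_def])
  have g01: "0 \<le> ?g V S" "?g V S \<le> 1" for V S by (auto simp: exp_neg_def)
  have int: "integrable (potential \<mu> \<Otimes>\<^sub>M srw 0) (\<lambda>(V, S). ?g V S)"
    by (rule VS.integrable_const_bound[where B = 1, OF _ measurable_crossing_weight[OF \<mu>(2)]])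
       (use g01 in \<open>auto intro!: AE_I2\<close>)
  have inner: "(\<integral>V. ?g V (walk \<xi>) \<partial>potential \<mu>) \<le> exp (- cost ?\<Delta> (real n) (map \<xi> [0..<N]))" for \<xi>
  proof -
    define xs where "xs = map \<xi> [0..<N]"
    have pos_xs: "pos xs k = walk \<xi> k" if "k \<le> N" for k
      using that by (simp add: xs_def walk_def pos_initial_steps)
    have len: "length xs = N" by (simp add: xs_def)
    let ?J = "fresh (real n) xs"
    let ?L = "local_time (real n) xs"
    define c where "c V = (\<Sum>k\<in>?J. \<beta> * real (?L k) * max 0 (V (pos xs k)))" for V :: "int ^ 'd \<Rightarrow> real"
    have c0: "0 \<le> c V" for V unfolding c_def using \<beta> by (intro sum_nonneg) auto
    have le: "?g V (walk \<xi>) \<le> exp (- c V)" for V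
    proof (rule exp_neg_le[OF c0])
      let ?A = "{i. i < length xs \<and> alive (real n) xs i}"
      have "c V \<le> (\<Sum>i\<in>?A. \<beta> * max 0 (V (pos xs i)))"
        using sum_alive_ge_fresh[of "\<lambda>y. \<beta> * max 0 (V y)" "real n" xs] \<beta> by (simp add: c_def mult_ac)
      then have "ennreal (c V) \<le> ennreal (\<Sum>i\<in>?A. \<beta> * max 0 (V (pos xs i)))" by (rule ennreal_leI)
      also have "\<dots> = (\<Sum>i\<in>?A. ennreal (\<beta> * max 0 (V (pos xs i))))"
        using \<beta> by (intro sum_ennreal[symmetric]) auto
      also have "\<dots> \<le> (\<Sum>i\<in>?A. if enat i < hit_time l n (walk \<xi>) then ennreal (\<beta> * V (walk \<xi> i)) else 0)"
      proof (rule sum_mono)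
        fix i assume i: "i \<in> ?A"
        then have "enat i < hit_time l n (walk \<xi>)"
          by (auto simp: less_hit_time_iff alive_def pos_xs len)
        moreover have "ennreal (\<beta> * max 0 (V (pos xs i))) = ennreal (\<beta> * V (walk \<xi> i))"
        proof (cases "0 \<le> V (walk \<xi> i)")
          case False
          then have "\<beta> * V (walk \<xi> i) \<le> 0" using \<beta> by (intro mult_nonneg_nonpos) auto
          then show ?thesis using False i len by (simp add: pos_xs ennreal_neg)
        qed (use i len in \<open>simp add: pos_xs\<close>)
        ultimately show "ennreal (\<beta> * max 0 (V (pos xs i))) \<le>
            (if enat i < hit_time l n (walk \<xi>) then ennreal (\<beta> * V (walk \<xi> i)) else 0)" by simp
      qed
      also have "\<dots> \<le> path_cost \<beta> l n V (walk \<xi>)"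
        unfolding path_cost_def by (rule sum_le_suminf) auto
      finally show "ennreal (c V) \<le> path_cost \<beta> l n V (walk \<xi>)" .
    qed
    \<comment> \<open>The product over first visits is rewritten as a product over sites.\<close>
    let ?k = "the_inv_into ?J (pos xs)"
    define F where "F y z = exp (- \<beta> * max 0 z) ^ ?L (?k y)" for y :: "int ^ 'd" and z :: real
    have F_pos: "F (pos xs k) z = exp (- \<beta> * max 0 z) ^ ?L k" if "k \<in> ?J" for k z
      using that by (simp add: F_def the_inv_into_f_f[OF inj_on_fresh])
    have F_meas [measurable]: "F y \<in> borel_measurable borel" for y unfolding F_def by measurable
    have F_int: "integrable \<mu> (F y)" for y
    proof (rule \<mu>.integrable_law[where B = 1])
      fix z :: real
      have "exp (- \<beta> * max 0 z) \<le> 1" using \<beta> by simp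
      then have "0 \<le> F y z" "F y z \<le> 1" unfolding F_def by (intro zero_le_power power_le_one; simp)+
      then show "\<bar>F y z\<bar> \<le> 1" by linarith
    qed measurable
    have exp_c: "exp (- c V) = (\<Prod>y\<in>pos xs ` ?J. F y (V y))" for V
    proof -
      have "exp (- c V) = (\<Prod>k\<in>?J. exp (- (\<beta> * real (?L k) * max 0 (V (pos xs k)))))"
        unfolding c_def sum_negf[symmetric] by (rule exp_sum) simp
      also have "\<dots> = (\<Prod>k\<in>?J. F (pos xs k) (V (pos xs k)))"
        by (intro prod.cong refl) (simp add: F_pos exp_of_nat_mult[symmetric] mult_ac)
      also have "\<dots> = (\<Prod>y\<in>pos xs ` ?J. F y (V y))"
        by (simp add: prod.reindex[OF inj_on_fresh])
      finally show ?thesis .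
    qed
    have int_inner: "integrable (potential \<mu>) (\<lambda>V. ?g V (walk \<xi>))"
    proof -
      have "(\<lambda>V. (V, walk \<xi>)) \<in> potential \<mu> \<rightarrow>\<^sub>M potential \<mu> \<Otimes>\<^sub>M srw 0"
        by (intro measurable_Pair measurable_ident measurable_const) (simp_all add: srw_def space_PiM)
      from measurable_compose[OF this measurable_crossing_weight[OF \<mu>(2)]]
      have "(\<lambda>V. ?g V (walk \<xi>)) \<in> borel_measurable (potential \<mu>)" by simp
      then show ?thesis using g01 by (intro V.integrable_const_bound[where B = 1]) auto
    qed
    have int_c: "integrable (potential \<mu>) (\<lambda>V. exp (- c V))"
    proof (rule V.integrable_const_bound[where B = 1])
      show "AE V in potential \<mu>. norm (exp (- c V)) \<le> 1" using c0 by simp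
      have [measurable_cong]: "sets (potential \<mu> :: (int ^ 'd \<Rightarrow> real) measure) = sets (PiM UNIV (\<lambda>_. borel))"
        unfolding potential_def by (rule sets_PiM_cong) (auto simp: \<mu>)
      show "(\<lambda>V. exp (- c V)) \<in> borel_measurable (potential \<mu>)"
        unfolding c_def by measurable
    qed
    have "(\<integral>V. ?g V (walk \<xi>) \<partial>potential \<mu>) \<le> (\<integral>V. exp (- c V) \<partial>potential \<mu>)"
      by (rule integral_mono[OF int_inner int_c le])
    also have "\<dots> = (\<Prod>y\<in>pos xs ` ?J. \<integral>z. F y z \<partial>\<mu>)"
      unfolding exp_c by (rule integral_potential_prod[OF \<mu>(1)]) (auto intro: F_int)
    also have "\<dots> = (\<Prod>k\<in>?J. \<integral>z. F (pos xs k) z \<partial>\<mu>)"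
      by (simp add: prod.reindex[OF inj_on_fresh])
    also have "\<dots> = (\<Prod>k\<in>?J. 1 - psi ?\<Delta> (?L k))"
    proof (rule prod.cong[OF refl])
      fix k assume k: "k \<in> ?J"
      have "(\<integral>z. F (pos xs k) z \<partial>\<mu>) = (\<integral>z. exp (- \<beta> * z) ^ ?L k \<partial>\<mu>)"
      proof (rule integral_cong_AE)
        show "AE z in \<mu>. F (pos xs k) z = exp (- \<beta> * z) ^ ?L k"
          using \<mu>(3) by eventually_elim (simp add: F_pos[OF k])
      qed measurable
      then show "(\<integral>z. F (pos xs k) z \<partial>\<mu>) = 1 - psi ?\<Delta> (?L k)"
        using \<mu>.psi_increments[OF \<beta>] by simp
    qed
    also have "\<dots> \<le> (\<Prod>k\<in>?J. exp (- psi ?\<Delta> (?L k)))"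
    proof (intro prod_mono conjI)
      fix k
      have "0 \<le> (\<integral>z. exp (- \<beta> * z) ^ ?L k \<partial>\<mu>)" by (intro integral_nonneg_AE) auto
      then show "0 \<le> 1 - psi ?\<Delta> (?L k)" unfolding \<mu>.psi_increments[OF \<beta>] .
      show "1 - psi ?\<Delta> (?L k) \<le> exp (- psi ?\<Delta> (?L k))"
        using exp_ge_add_one_self[of "- psi ?\<Delta> (?L k)"] by simp
    qed
    also have "\<dots> = exp (- cost ?\<Delta> (real n) xs)"
      unfolding cost_def sum_negf[symmetric] by (rule exp_sum[symmetric]) simp
    finally show ?thesis unfolding xs_def .
  qed
  have "e_crossing \<mu> l \<beta> n = (\<integral>S. (\<integral>V. ?g V S \<partial>potential \<mu>) \<partial>srw 0)"
    unfolding e_crossing_def by (rule VS.Fubini_integral[OF int, symmetric])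
  also have "\<dots> = (\<integral>\<xi>. (\<integral>V. ?g V (walk \<xi>) \<partial>potential \<mu>) \<partial>walk_steps)"
  proof -
    have "(\<lambda>S. \<integral>V. ?g V S \<partial>potential \<mu>) \<in> borel_measurable (srw 0)"
      using VS.integrable_snd[OF int] by (auto dest: borel_measurable_integrable)
    then have "(\<lambda>S. \<integral>V. ?g V S \<partial>potential \<mu>) \<in> borel_measurable (PiM UNIV (\<lambda>_. count_space UNIV))"
      by (simp cong: measurable_cong_sets add: sets_srw)
    then show ?thesis unfolding srw_eq by (rule integral_distr[OF walk_meas])
  qed
  also have "\<dots> \<le> (\<integral>\<xi>. exp (- cost ?\<Delta> (real n) (map \<xi> [0..<N])) \<partial>walk_steps)"
  proof (rule integral_mono[OF _ _ inner])
    have "(\<lambda>S. \<integral>V. ?g V S \<partial>potential \<mu>) \<in> borel_measurable (srw 0)"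
      using VS.integrable_snd[OF int] by (auto dest: borel_measurable_integrable)
    then have "(\<lambda>S. \<integral>V. ?g V S \<partial>potential \<mu>) \<in> borel_measurable (PiM UNIV (\<lambda>_. count_space UNIV))"
      by (simp cong: measurable_cong_sets add: sets_srw)
    from measurable_compose[OF walk_meas this]
    have m: "(\<lambda>\<xi>. \<integral>V. ?g V (walk \<xi>) \<partial>potential \<mu>) \<in> borel_measurable walk_steps" .
    have "\<bar>\<integral>V. ?g V S \<partial>potential \<mu>\<bar> \<le> 1" for S
    proof -
      have "0 \<le> (\<integral>V. ?g V S \<partial>potential \<mu>)" using g01 by (intro integral_nonneg_AE) auto
      moreover have "(\<integral>V. ?g V S \<partial>potential \<mu>) \<le> 1"
      proof (cases "integrable (potential \<mu>) (\<lambda>V. ?g V S)")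
        case True
        then show ?thesis using g01 by (intro V.integral_le_const) auto
      qed (simp add: not_integrable_integral_eq)
      ultimately show ?thesis by linarith
    qed
    then show "integrable walk_steps (\<lambda>\<xi>. \<integral>V. ?g V (walk \<xi>) \<partial>potential \<mu>)"
      by (intro P.integrable_const_bound[where B = 1] m) auto
    have "(\<lambda>\<xi>. exp (- cost ?\<Delta> (real n) (map \<xi> [0..<N]))) \<in> borel_measurable walk_steps"
      by (rule measurable_compose[OF measurable_initial_steps]) simp
    moreover have "0 \<le> cost ?\<Delta> (real n) xs" for xs
      using \<mu>.increments_nonneg[OF \<beta>] by (rule cost_nonneg)
    ultimately show "integrable walk_steps (\<lambda>\<xi>. exp (- cost ?\<Delta> (real n) (map \<xi> [0..<N])))"
      by (intro P.integrable_const_bound[where B = 1]) auto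
  qed
  also have "\<dots> = weight ?\<Delta> (real n) N"
    unfolding weight_def by (rule integral_initial_steps[where f = "\<lambda>xs. exp (- cost ?\<Delta> (real n) xs)"])
  finally show ?thesis .
qed

lemma e_crossing_le_1:
  fixes l :: "real ^ 'd::finite"
  assumes l: "norm l = 1" and \<mu>: "prob_space \<mu>" "sets \<mu> = sets borel" "AE z in \<mu>. 0 \<le> z" and \<beta>: "0 \<le> \<beta>"
  shows "e_crossing \<mu> l \<beta> n \<le> 1"
proof -
  interpret leveled_walk step_pmf "\<lambda>x. of_int_vec x \<bullet> l" "1 / real CARD('d)"
    by (rule leveled_walk_step_pmf[OF l])
  have "weight (increments \<mu> \<beta>) (real n) 0 = 1"
    by (simp add: weight_def cost_def fresh_def)
  then show ?thesis using e_crossing_le_weight[OF assms, of n 0] by simp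
qed

theorem theorem1p1:
  fixes \<mu> :: "real measure" and l :: "real ^ 'd::finite" and \<epsilon> :: real
  assumes "CARD('d) \<ge> 3"
    and "norm l = 1"
    and "prob_space \<mu>"
    and "sets \<mu> = sets borel"
    and "AE z in \<mu>. 0 \<le> z"
    and "(\<integral>\<^sup>+V. ennreal (V (0 :: int ^ 'd)) \<partial>potential \<mu>) = \<infinity>"
    and "\<epsilon> > 0"
  shows "\<exists>C>0. \<forall>\<^sub>F \<beta> in at_right 0. \<forall>n.
    e_crossing \<mu> l \<beta> n \<le>
      C * exp (- (1 - \<epsilon>) * sqrt (2 * real CARD('d) * I_const TYPE('d) \<mu> \<beta>) * real n)"
proof -
  interpret leveled_walk step_pmf "\<lambda>x. of_int_vec x \<bullet> l" "1 / real CARD('d)"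
    by (rule leveled_walk_step_pmf) fact
  interpret \<mu>: nonneg_law \<mu> using assms by (simp add: nonneg_law_def nonneg_law_axioms_def)
  note le1 = e_crossing_le_1[OF assms(2-5)]
  have pos: "eventually (\<lambda>\<beta>. 0 < \<beta>) (at_right (0::real))" by (rule eventually_at_right_less)
  let ?I = "I_const TYPE('d) \<mu>"
  have rate: "?I \<beta> = killing_rate (increments \<mu> \<beta>)" if "0 < escape" "0 \<le> \<beta>" for \<beta>
    unfolding I_const_def killing_rate_def escape_prob_eq
    using \<mu>.killing_series[of \<beta> "1 - escape"] that escape_bounds by simp
  have trivial: ?thesis if triv: "\<And>\<beta>. 0 < \<beta> \<Longrightarrow> (1 - \<epsilon>) * sqrt (2 * real CARD('d) * ?I \<beta>) \<le> 0"
  proof (intro exI[of _ 1] conjI)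
    show "\<forall>\<^sub>F \<beta> in at_right 0. \<forall>n. e_crossing \<mu> l \<beta> n \<le>
      1 * exp (- (1 - \<epsilon>) * sqrt (2 * real CARD('d) * ?I \<beta>) * real n)"
      using pos
    proof (eventually_elim, intro allI)
      fix \<beta> :: real and n assume "0 < \<beta>"
      then have "(1 - \<epsilon>) * sqrt (2 * real CARD('d) * ?I \<beta>) * real n \<le> 0"
        by (intro mult_nonpos_nonneg triv) auto
      then have "0 \<le> - (1 - \<epsilon>) * sqrt (2 * real CARD('d) * ?I \<beta>) * real n"
        by (simp only: mult_minus_left neg_0_le_iff_le)
      then have "1 \<le> exp (- (1 - \<epsilon>) * sqrt (2 * real CARD('d) * ?I \<beta>) * real n)"
        by (simp only: one_le_exp_iff)
      then show "e_crossing \<mu> l \<beta> n \<le> 1 * exp (- (1 - \<epsilon>) * sqrt (2 * real CARD('d) * ?I \<beta>) * real n)"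
        using le1[OF less_imp_le[OF \<open>0 < \<beta>\<close>], of n] by linarith
    qed
  qed simp
  \<comment> \<open>In the first two cases the exponent is nonnegative, and \<open>e_crossing\<close> is at most \<open>1\<close>.\<close>
  consider "escape = 0" | "escape > 0" "\<epsilon> \<ge> 1" | "escape > 0" "\<epsilon> < 1"
    using escape_bounds(1) by linarith
  then show ?thesis
  proof cases
    case 1
    then have "?I \<beta> = 0" for \<beta> by (simp add: I_const_def escape_prob_eq)
    then show ?thesis by (intro trivial) simp
  next
    case 2
    have "0 \<le> ?I \<beta>" if "0 < \<beta>" for \<beta>
    proof -
      have "0 \<le> escape * increments \<mu> \<beta> 0"
        using \<mu>.increments_nonneg[of \<beta>] that 2 by simp
      also have "\<dots> \<le> ?I \<beta>" using that 2 rate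
        by (simp add: killing_rate_ge \<mu>.increments_nonneg \<mu>.decseq_increments)
      finally show ?thesis .
    qed
    then show ?thesis using 2 by (intro trivial mult_nonpos_nonneg) auto
  next
    case 3
    obtain C I0 where C: "C > 0" and I0: "I0 > 0" and bound:
      "\<forall>\<Delta>. (\<forall>i. 0 \<le> \<Delta> i) \<longrightarrow> decseq \<Delta> \<longrightarrow> 0 < killing_rate \<Delta> \<longrightarrow> killing_rate \<Delta> \<le> I0 \<longrightarrow>
        (\<forall>s\<ge>0. \<forall>e. (\<forall>N. e \<le> weight \<Delta> s N) \<longrightarrow>
          e \<le> C * exp (- (1 - \<epsilon>) * sqrt (2 * killing_rate \<Delta> / (1 / real CARD('d))) * s))"
      using weight_exponential_bound[OF 3(1) assms(7) 3(2)] by (elim exE conjE) (rule that)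
    have rate_le: "?I \<beta> \<le> increments \<mu> \<beta> 0" if "0 < \<beta>" for \<beta>
    proof -
      have sm: "summable (\<lambda>k. increments \<mu> \<beta> k * (1 - escape) ^ k)"
        using that 3 by (intro summable_killing \<mu>.increments_nonneg \<mu>.decseq_increments) auto
      have "(\<Sum>k. increments \<mu> \<beta> k * (1 - escape) ^ k) \<le> (\<Sum>k. increments \<mu> \<beta> 0 * (1 - escape) ^ k)"
        using that 3 escape_bounds \<mu>.decseq_increments[of \<beta>]
        by (intro suminf_le sm mult_right_mono summable_mult summable_geometric) (auto simp: decseq_def)
      also have "\<dots> = increments \<mu> \<beta> 0 / escape"
        using 3 escape_bounds by (subst suminf_mult) (simp_all add: suminf_geometric summable_geometric)
      finally show ?thesis using that 3 by (simp add: rate killing_rate_def field_simps)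
    qed
    have small: "eventually (\<lambda>\<beta>. increments \<mu> \<beta> 0 < I0) (at_right 0)"
      using \<mu>.increments_0_tendsto I0 by (rule order_tendstoD(2))
    show ?thesis
    proof (intro exI[of _ "max C 1"] conjI)
      show "\<forall>\<^sub>F \<beta> in at_right 0. \<forall>n. e_crossing \<mu> l \<beta> n \<le>
        max C 1 * exp (- (1 - \<epsilon>) * sqrt (2 * real CARD('d) * ?I \<beta>) * real n)"
        using pos small
      proof (eventually_elim, intro allI)
        fix \<beta> :: real and n assume \<beta>: "0 < \<beta>" and lt: "increments \<mu> \<beta> 0 < I0"
        let ?E = "exp (- (1 - \<epsilon>) * sqrt (2 * real CARD('d) * ?I \<beta>) * real n)"
        have "0 \<le> escape * increments \<mu> \<beta> 0"
          using \<mu>.increments_nonneg[of \<beta>] \<beta> 3 by simp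
        also have "\<dots> \<le> ?I \<beta>" using \<beta> 3 rate
          by (simp add: killing_rate_ge \<mu>.increments_nonneg \<mu>.decseq_increments)
        finally have I_nonneg: "0 \<le> ?I \<beta>" .
        show "e_crossing \<mu> l \<beta> n \<le> max C 1 * ?E"
        proof (cases "?I \<beta> = 0")
          case True
          then have "1 \<le> max C 1 * ?E" by simp
          with le1[OF less_imp_le[OF \<beta>], of n] show ?thesis by (rule order_trans)
        next
          case False
          have eq: "killing_rate (increments \<mu> \<beta>) = ?I \<beta>" using rate \<beta> 3 by simp
          have "e_crossing \<mu> l \<beta> n \<le> C * exp (- (1 - \<epsilon>) * sqrt (2 * killing_rate (increments \<mu> \<beta>) / (1 / real CARD('d))) * real n)"
          proof (rule bound[rule_format])
            show "0 \<le> increments \<mu> \<beta> i" for i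
              using \<mu>.increments_nonneg \<beta> by simp
            show "decseq (increments \<mu> \<beta>)"
              using \<mu>.decseq_increments \<beta> by simp
            show "0 < killing_rate (increments \<mu> \<beta>)" "killing_rate (increments \<mu> \<beta>) \<le> I0"
              unfolding eq using False I_nonneg rate_le[OF \<beta>] lt by auto
            show "e_crossing \<mu> l \<beta> n \<le> weight (increments \<mu> \<beta>) (real n) N" for N
              using \<beta> by (intro e_crossing_le_weight assms) simp
          qed simp
          also have "2 * killing_rate (increments \<mu> \<beta>) / (1 / real CARD('d)) = 2 * real CARD('d) * ?I \<beta>"
            by (simp add: eq)
          also have "C * ?E \<le> max C 1 * ?E" by (intro mult_right_mono) auto
          finally show ?thesis .
        qed
      qed
    qed simp
  qed
qed

end
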